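(* Let $\{n(j)\}_{j\ge1}$ be a sequence of integers $n(j)\ge 2$ diverging to infinity, let $\{a_{ij}\}$, $i=1,\dots,n(j)$, $j=1,2,\dots$, be positive real numbers, and let $\{a_i\}_{i\ge1}$ be an $l^2$-sequence of nonnegative real numbers (i.e. $\sum_{i=1}^\infty a_i^2<+\infty$). Assume $$\lim_{j\to\infty}\sum_{i=1}^{n(j)}(a_{ij}-a_i)^2=0.$$ Then, regarding all measures as Borel probability measures on the Hilbert space $H=l^2$, (1) $\epsilon^{n(j)}_{\{\sqrt{n(j)-1}\,a_{ij}\}_i}$ converges weakly to $\gamma^\infty_{\{a_i^2\}}$ as $j\to\infty$; (2) $\sigma^{n(j)-1}_{\{\sqrt{n(j)-1}\,a_{ij}\}_i}$ converges to $\gamma^\infty_{\{a_i^2\}}$ in the $2$-Wasserstein metric as $j\to\infty$. In particular, with $E^n_{\{\alpha_i\}}$ denoting either the solid ellipsoid $\mathcal{E}^n_{\{\alpha_i\}}$ or the ellipsoid $\mathcal{S}^{n-1}_{\{\alpha_i\}}$ (either choice), $E^{n(j)}_{\{\sqrt{n(j)-1}\,a_{ij}\}_i}$ box converges to $\Gamma^\infty_{\{a_i^2\}}$ as $j\to\infty$, i.e. $\square\bigl(E^{n(j)}_{\{\sqrt{n(j)-1}\,a_{ij}\}_i},\Gamma^\infty_{\{a_i^2\}}\bigr)\to0$.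
   Context: Ellipsoids. For $n\ge2$ and positive reals $\alpha_1,\dots,\alpha_n$, let $\mathcal{E}^n_{\{\alpha_i\}}=\{x\in\mathbb{R}^n\mid \sum_i x_i^2/\alpha_i^2\le 1\}$, with the restricted Euclidean distance and the normalized (probability) Lebesgue measure $\epsilon^n_{\{\alpha_i\}}$; let $\mathcal{S}^{n-1}_{\{\alpha_i\}}=\{x\in\mathbb{R}^n\mid \sum_i x_i^2/\alpha_i^2=1\}$, with the restricted Euclidean distance and the measure $\sigma^{n-1}_{\{\alpha_i\}}$, the push-forward of the normalized volume measure $\sigma^{n-1}$ on the unit sphere $S^{n-1}(1)\subset\mathbb{R}^n$ under the linear map $x\mapsto(\alpha_1x_1,\dots,\alpha_nx_n)$. The space $\mathbb{R}^n$ is naturally embedded in $H=l^2=\{x\in\mathbb{R}^\infty\mid\|x\|<+\infty\}$ as the first $n$ coordinates, and measures on $\mathbb{R}^n$ are regarded as measures on $H$. Gaussian space. $\gamma^1_{a^2}$ is the centered Gaussian measure on $\mathbb{R}$ of variance $a^2$ (Dirac measure at $0$ if $a=0$). When $\sum a_i^2<\infty$, $\gamma^\infty_{\{a_i^2\}}=\bigotimes_{i\ge1}\gamma^1_{a_i^2}$ is a Borel probability measure on $H$, and $\Gamma^\infty_{\{a_i^2\}}=(H,\|\cdot\|,\gamma^\infty_{\{a_i^2\}})$. The $2$-Wasserstein distance is $W_2(\mu,\nu)=\inf_\pi(\int d(x,x')^2\,d\pi(x,x'))^{1/2}$ over couplings $\pi$ of $\mu$ and $\nu$. Box distance. An mm-space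 is a triple $(X,d_X,\mu_X)$ of a complete separable metric space with a Borel probability measure. With $I=[0,1)$ and Lebesgue measure $\mathcal{L}^1$, a parameter of $X$ is a Borel map $\varphi:I\to X$ with $\varphi_*\mathcal{L}^1=\mu_X$. $\square(X,Y)$ is the infimum of $\varepsilon\ge0$ for which there are parameters $\varphi$ of $X$, $\psi$ of $Y$ and a Borel set $\tilde I\subset I$ with $\mathcal{L}^1(\tilde I)\ge1-\varepsilon$ and $|d_X(\varphi(s),\varphi(t))-d_Y(\psi(s),\psi(t))|\le\varepsilon$ for all $s,t\in\tilde I$. *)

theory Defs
  imports "HOL-Probability.Probability"
begin

section \<open>The Hilbert space of square-summable sequences\<close>

typedef l2 = "{x :: nat \<Rightarrow> real. summable (\<lambda>i. (x i)\<^sup>2)}"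
  morphisms coord Abs_l2
  by (rule exI[of _ "\<lambda>_. 0"]) simp

lemma summable_coord_sq: "summable (\<lambda>i. (coord x i)\<^sup>2)"
  using coord[of x] by simp

lemma summable_mult_of_sq:
  fixes x y :: "nat \<Rightarrow> real"
  assumes "summable (\<lambda>i. (x i)\<^sup>2)" and "summable (\<lambda>i. (y i)\<^sup>2)"
  shows "summable (\<lambda>i. x i * y i)"
proof (rule summable_comparison_test')
  show "summable (\<lambda>i. (x i)\<^sup>2 + (y i)\<^sup>2)"
    using assms by (rule summable_add)
  show "norm (x i * y i) \<le> (x i)\<^sup>2 + (y i)\<^sup>2" for i
  proof -
    have "2 * (\<bar>x i\<bar> * \<bar>y i\<bar>) \<le> \<bar>x i\<bar>\<^sup>2 + \<bar>y i\<bar>\<^sup>2"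
      using sum_squares_bound[of "\<bar>x i\<bar>" "\<bar>y i\<bar>"] by simp
    moreover have "0 \<le> \<bar>x i\<bar> * \<bar>y i\<bar>" by simp
    ultimately show ?thesis
      unfolding real_norm_def abs_mult power2_abs by linarith
  qed
qed

lemma summable_sq_add:
  fixes x y :: "nat \<Rightarrow> real"
  assumes "summable (\<lambda>i. (x i)\<^sup>2)" and "summable (\<lambda>i. (y i)\<^sup>2)"
  shows "summable (\<lambda>i. (x i + y i)\<^sup>2)"
proof -
  have "summable (\<lambda>i. (x i)\<^sup>2 + (y i)\<^sup>2 + 2 * (x i * y i))"
    by (intro summable_add summable_mult assms summable_mult_of_sq)
  then show ?thesis by (simp add: power2_sum mult.assoc)
qed

lemma summable_sq_scale:
  fixes x :: "nat \<Rightarrow> real"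
  assumes "summable (\<lambda>i. (x i)\<^sup>2)"
  shows "summable (\<lambda>i. (c * x i)\<^sup>2)"
  using summable_mult[OF assms, of "c\<^sup>2"] by (simp add: power_mult_distrib)

lemma l2_eqI: "(\<And>i. coord x i = coord y i) \<Longrightarrow> x = y"
  by (metis coord_inject ext)

instantiation l2 :: real_inner
begin

definition "0 = Abs_l2 (\<lambda>_. 0)"
definition "x + y = Abs_l2 (\<lambda>i. coord x i + coord y i)"
definition "- x = Abs_l2 (\<lambda>i. - coord x i)"
definition "x - y = Abs_l2 (\<lambda>i. coord x i - coord y i)"
definition "c *\<^sub>R x = Abs_l2 (\<lambda>i. c * coord x i)"
definition "inner x y = (\<Sum>i. coord x i * coord y i)"
definition "norm x = sqrt (inner x x)" for x :: l2
definition "sgn x = inverse (norm x) *\<^sub>R x" for x :: l2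
definition "dist x y = norm (x - y)" for x y :: l2
definition [code del]:
  "(uniformity :: (l2 \<times> l2) filter) = (INF e\<in>{0 <..}. principal {(x, y). dist x y < e})"
definition [code del]:
  "open (U :: l2 set) \<longleftrightarrow> (\<forall>x\<in>U. eventually (\<lambda>(x', y). x' = x \<longrightarrow> y \<in> U) uniformity)"

lemma coord_zero: "coord 0 i = 0"
  by (simp add: zero_l2_def Abs_l2_inverse)

lemma coord_add: "coord (x + y) i = coord x i + coord y i"
  by (simp add: plus_l2_def Abs_l2_inverse summable_sq_add summable_coord_sq)

lemma coord_uminus: "coord (- x) i = - coord x i"
  by (simp add: uminus_l2_def Abs_l2_inverse summable_coord_sq)

lemma coord_diff: "coord (x - y) i = coord x i - coord y i"
proof -
  have "summable (\<lambda>i. (coord x i + - coord y i)\<^sup>2)"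
    by (rule summable_sq_add) (simp_all add: summable_coord_sq)
  then show ?thesis by (simp add: minus_l2_def Abs_l2_inverse)
qed

lemma coord_scaleR: "coord (c *\<^sub>R x) i = c * coord x i"
  by (simp add: scaleR_l2_def Abs_l2_inverse summable_sq_scale summable_coord_sq)

lemmas coord_simps = coord_zero coord_add coord_uminus coord_diff coord_scaleR

instance
proof
  fix x y z :: l2 and a b :: real
  show "a *\<^sub>R (x + y) = a *\<^sub>R x + a *\<^sub>R y" "(a + b) *\<^sub>R x = a *\<^sub>R x + b *\<^sub>R x"
    "a *\<^sub>R b *\<^sub>R x = (a * b) *\<^sub>R x" "1 *\<^sub>R x = x" "x + y + z = x + (y + z)" "x + y = y + x"
    "0 + x = x" "- x + x = 0" "x - y = x + - y"
    by (rule l2_eqI; simp add: coord_simps algebra_simps)+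
  show "sgn x = inverse (norm x) *\<^sub>R x" "dist x y = norm (x - y)" "norm x = sqrt (inner x x)"
    by (simp_all only: sgn_l2_def dist_l2_def norm_l2_def)
  show "uniformity = (INF e\<in>{0 <..}. principal {(x :: l2, y). dist x y < e})"
    by (rule uniformity_l2_def)
  show "open U \<longleftrightarrow> (\<forall>x\<in>U. eventually (\<lambda>(x', y). x' = x \<longrightarrow> y \<in> U) uniformity)" for U :: "l2 set"
    by (rule open_l2_def)
  show "inner x y = inner y x"
    by (simp add: inner_l2_def mult.commute)
  have sm: "summable (\<lambda>i. coord u i * coord v i)" for u v
    by (intro summable_mult_of_sq summable_coord_sq)
  show "inner (x + y) z = inner x z + inner y z"
    by (simp add: inner_l2_def coord_simps distrib_right suminf_add sm)
  show "inner (a *\<^sub>R x) y = a * inner x y"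
    by (simp add: inner_l2_def coord_simps mult.assoc suminf_mult sm)
  show "0 \<le> inner x x"
    unfolding inner_l2_def by (rule suminf_nonneg) (simp_all add: sm)
  show "inner x x = 0 \<longleftrightarrow> x = 0"
  proof -
    have "inner x x = 0 \<longleftrightarrow> (\<forall>i. coord x i * coord x i = 0)"
      unfolding inner_l2_def by (rule suminf_eq_zero_iff) (simp_all add: sm)
    also have "\<dots> \<longleftrightarrow> x = 0"
      by (auto simp: coord_simps intro: l2_eqI)
    finally show ?thesis .
  qed
qed

end

lemma norm_l2_sq: "(norm x)\<^sup>2 = (\<Sum>i. (coord x i)\<^sup>2)" for x :: l2
  unfolding power2_norm_eq_inner inner_l2_def by (simp only: power2_eq_square)

lemma sum_coord_sq_le: "(\<Sum>i<N. (coord x i)\<^sup>2) \<le> (norm x)\<^sup>2"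
  unfolding norm_l2_sq by (rule sum_le_suminf) (simp_all add: summable_coord_sq)

lemma abs_coord_le: "\<bar>coord x i\<bar> \<le> norm x"
proof -
  have "(coord x i)\<^sup>2 \<le> (\<Sum>i<Suc i. (coord x i)\<^sup>2)"
    by (simp add: sum_nonneg)
  also have "\<dots> \<le> (norm x)\<^sup>2" by (rule sum_coord_sq_le)
  finally have "\<bar>coord x i\<bar>\<^sup>2 \<le> (norm x)\<^sup>2" by simp
  then show ?thesis by (rule power2_le_imp_le) simp
qed

instance l2 :: banach
proof
  fix X :: "nat \<Rightarrow> l2"
  assume C: "Cauchy X"
  have "Cauchy (\<lambda>n. coord (X n) i)" for i
  proof (rule metric_CauchyI)
    fix e :: real assume "0 < e"
    then obtain M where M: "\<forall>m\<ge>M. \<forall>n\<ge>M. dist (X m) (X n) < e"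
      using metric_CauchyD[OF C] by blast
    have "dist (coord (X m) i) (coord (X n) i) < e" if "m \<ge> M" "n \<ge> M" for m n
    proof -
      have "dist (coord (X m) i) (coord (X n) i) \<le> dist (X m) (X n)"
        using abs_coord_le[of "X m - X n" i] by (simp add: coord_simps dist_norm)
      also have "\<dots> < e" using M that by blast
      finally show ?thesis .
    qed
    then show "\<exists>M. \<forall>m\<ge>M. \<forall>n\<ge>M. dist (coord (X m) i) (coord (X n) i) < e" by blast
  qed
  then have "\<exists>l. (\<lambda>n. coord (X n) i) \<longlonglongrightarrow> l" for i
    by (simp add: Cauchy_convergent_iff convergent_def)
  then obtain L where L: "\<And>i. (\<lambda>n. coord (X n) i) \<longlonglongrightarrow> L i" by metis
  have bound: "\<exists>M. \<forall>m\<ge>M. \<forall>N. (\<Sum>i<N. (coord (X m) i - L i)\<^sup>2) \<le> e\<^sup>2" if "0 < e" for e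
  proof -
    obtain M where M: "\<forall>m\<ge>M. \<forall>n\<ge>M. dist (X m) (X n) < e"
      using metric_CauchyD[OF C \<open>0 < e\<close>] by blast
    have "(\<Sum>i<N. (coord (X m) i - L i)\<^sup>2) \<le> e\<^sup>2" if m: "m \<ge> M" for m N
    proof (rule LIMSEQ_le_const2)
      show "(\<lambda>n. \<Sum>i<N. (coord (X m) i - coord (X n) i)\<^sup>2) \<longlonglongrightarrow> (\<Sum>i<N. (coord (X m) i - L i)\<^sup>2)"
        by (intro tendsto_intros L)
      have "(\<Sum>i<N. (coord (X m) i - coord (X n) i)\<^sup>2) \<le> e\<^sup>2" if n: "n \<ge> M" for n
      proof -
        have "(\<Sum>i<N. (coord (X m) i - coord (X n) i)\<^sup>2) \<le> (norm (X m - X n))\<^sup>2"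
          using sum_coord_sq_le[where x = "X m - X n" and N = N] by (simp add: coord_simps)
        also have "\<dots> \<le> e\<^sup>2"
          using M m n by (intro power_mono) (auto simp: dist_norm intro: less_imp_le)
        finally show ?thesis .
      qed
      then show "\<exists>K. \<forall>n\<ge>K. (\<Sum>i<N. (coord (X m) i - coord (X n) i)\<^sup>2) \<le> e\<^sup>2" by blast
    qed
    then show ?thesis by blast
  qed
  obtain M where M: "\<And>N. (\<Sum>i<N. (coord (X M) i - L i)\<^sup>2) \<le> 1\<^sup>2"
    using bound[of 1] by auto
  have sdiff: "summable (\<lambda>i. (coord (X M) i - L i)\<^sup>2)"
    by (rule summableI_nonneg_bounded[where x = "1\<^sup>2"]) (use M in auto)
  have "summable (\<lambda>i. (coord (X M) i + - (coord (X M) i - L i))\<^sup>2)"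
    by (rule summable_sq_add[OF summable_coord_sq]) (use sdiff in \<open>simp add: power2_commute\<close>)
  then have cl: "coord (Abs_l2 L) = L"
    by (simp add: Abs_l2_inverse)
  have "X \<longlonglongrightarrow> Abs_l2 L"
  proof (rule metric_LIMSEQ_I)
    fix r :: real assume "0 < r"
    then obtain M where M: "\<forall>m\<ge>M. \<forall>N. (\<Sum>i<N. (coord (X m) i - L i)\<^sup>2) \<le> (r / 2)\<^sup>2"
      using bound[of "r / 2"] by auto
    have "dist (X m) (Abs_l2 L) < r" if "m \<ge> M" for m
    proof -
      have "(norm (X m - Abs_l2 L))\<^sup>2 = (\<Sum>i. (coord (X m) i - L i)\<^sup>2)"
        by (simp add: norm_l2_sq coord_simps cl)
      also have "\<dots> \<le> (r / 2)\<^sup>2"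
      proof (rule suminf_le_const)
        show "summable (\<lambda>i. (coord (X m) i - L i)\<^sup>2)"
          using summable_coord_sq[of "X m - Abs_l2 L"] by (simp add: coord_simps cl)
      qed (use M that in blast)
      finally have "norm (X m - Abs_l2 L) \<le> r / 2"
        by (rule power2_le_imp_le) (use \<open>0 < r\<close> in simp)
      then show ?thesis using \<open>0 < r\<close> by (simp add: dist_norm)
    qed
    then show "\<exists>M. \<forall>m\<ge>M. dist (X m) (Abs_l2 L) < r" by blast
  qed
  then show "convergent X" by (auto simp: convergent_def)
qed


definition embed :: "nat \<Rightarrow> (nat \<Rightarrow> real) \<Rightarrow> l2" where
  "embed n x = Abs_l2 (\<lambda>i. if i < n then x i else 0)"

lemma coord_embed: "coord (embed n x) i = (if i < n then x i else 0)"
proof -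
  have "summable (\<lambda>i. (if i < n then x i else 0)\<^sup>2)"
    by (rule summable_finite[of "{..<n}"]) auto
  then show ?thesis by (simp add: embed_def Abs_l2_inverse)
qed

lemma l2_countable_dense:
  "\<exists>D :: l2 set. countable D \<and> (\<forall>x. \<forall>e>0. \<exists>d\<in>D. dist d x < e)"
proof (intro exI conjI allI impI)
  let ?D = "range (\<lambda>q :: rat list. embed (length q) (\<lambda>i. of_rat (q ! i)))"
  show "countable ?D" by simp
  fix x :: l2 and e :: real
  assume e: "0 < e"
  have "(\<lambda>N. \<Sum>i<N. (coord x i)\<^sup>2) \<longlonglongrightarrow> (norm x)\<^sup>2"
    unfolding norm_l2_sq by (rule summable_LIMSEQ[OF summable_coord_sq])
  then obtain N where N: "norm ((\<Sum>i<N. (coord x i)\<^sup>2) - (norm x)\<^sup>2) < e\<^sup>2 / 2"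
    using e by (meson LIMSEQ_D half_gt_zero order_refl zero_less_power)
  define b where "b = e\<^sup>2 / (2 * (real N + 1))"
  have b: "0 < b" using e by (simp add: b_def)
  have "\<exists>q. \<bar>of_rat q - coord x i\<bar> < sqrt b" for i
  proof -
    have "coord x i - sqrt b < coord x i + sqrt b" using b by simp
    then obtain q where "coord x i - sqrt b < of_rat q" "of_rat q < coord x i + sqrt b"
      using of_rat_dense by blast
    then have "\<bar>of_rat q - coord x i\<bar> < sqrt b" by linarith
    then show ?thesis ..
  qed
  then obtain q where q: "\<And>i. \<bar>of_rat (q i) - coord x i\<bar> < sqrt b" by metis
  define d where "d = embed N (\<lambda>i. of_rat (q i))"
  have "d = embed (length (map q [0..<N])) (\<lambda>i. of_rat (map q [0..<N] ! i))"
    unfolding d_def by (rule l2_eqI) (simp add: coord_embed)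
  then have dD: "d \<in> ?D" by blast
  have "(norm (d - x))\<^sup>2 = (\<Sum>i. (coord (d - x) (i + N))\<^sup>2) + (\<Sum>i<N. (coord (d - x) i)\<^sup>2)"
    unfolding norm_l2_sq by (rule suminf_split_initial_segment[OF summable_coord_sq])
  moreover have "(\<Sum>i. (coord (d - x) (i + N))\<^sup>2) < e\<^sup>2 / 2"
  proof -
    have "(\<Sum>i. (coord (d - x) (i + N))\<^sup>2) = (\<Sum>i. (coord x (i + N))\<^sup>2)"
      by (simp add: d_def coord_simps coord_embed)
    also have "\<dots> = (norm x)\<^sup>2 - (\<Sum>i<N. (coord x i)\<^sup>2)"
      unfolding norm_l2_sq by (rule suminf_minus_initial_segment[OF summable_coord_sq])
    also have "\<dots> < e\<^sup>2 / 2" using N unfolding real_norm_def by linarith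
    finally show ?thesis .
  qed
  moreover have "(\<Sum>i<N. (coord (d - x) i)\<^sup>2) \<le> e\<^sup>2 / 2"
  proof -
    have "(coord (d - x) i)\<^sup>2 \<le> b" if "i < N" for i
    proof -
      have "\<bar>of_rat (q i) - coord x i\<bar>\<^sup>2 \<le> (sqrt b)\<^sup>2"
        using q[of i] by (intro power_mono) auto
      then show ?thesis using that b by (simp add: d_def coord_simps coord_embed)
    qed
    then have "(\<Sum>i<N. (coord (d - x) i)\<^sup>2) \<le> (\<Sum>i<N. b)"
      by (intro sum_mono) simp
    also have "\<dots> \<le> e\<^sup>2 / 2"
      using e by (simp add: b_def field_simps)
    finally show ?thesis .
  qed
  ultimately have "(norm (d - x))\<^sup>2 < e\<^sup>2" by linarith
  then have "dist d x < e"
    using e by (metis dist_norm power2_less_imp_less less_imp_le)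
  with dD show "\<exists>d\<in>?D. dist d x < e" by blast
qed

instance l2 :: polish_space
proof
  obtain D :: "l2 set" where D: "countable D" "\<And>x e. 0 < e \<Longrightarrow> \<exists>d\<in>D. dist d x < e"
    using l2_countable_dense by blast
  define B where "B = (\<lambda>(d, r). ball d (of_rat r)) ` (D \<times> (UNIV :: rat set))"
  have "topological_basis B"
  proof (rule topological_basisI)
    show "open B'" if "B' \<in> B" for B' using that by (auto simp: B_def)
    fix U and x :: l2
    assume "open U" "x \<in> U"
    then obtain e where e: "0 < e" "ball x e \<subseteq> U" by (meson open_contains_ball)
    obtain d where d: "d \<in> D" "dist d x < e / 3" using D(2)[of "e / 3" x] e by auto
    obtain r where r: "e / 3 < of_rat r" "of_rat r < e / 2"
      using of_rat_dense[of "e / 3" "e / 2"] e by auto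
    have "ball d (of_rat r) \<subseteq> ball x e"
    proof
      fix y assume "y \<in> ball d (of_rat r)"
      then show "y \<in> ball x e"
        using dist_triangle[of x y d] d r e by (simp add: dist_commute)
    qed
    moreover have "x \<in> ball d (of_rat r)" using d r by simp
    moreover have "ball d (of_rat r) \<in> B" using d(1) by (auto simp: B_def)
    ultimately show "\<exists>B'\<in>B. x \<in> B' \<and> B' \<subseteq> U" using e(2) by blast
  qed
  moreover have "countable B" using D(1) by (simp add: B_def)
  ultimately show "\<exists>B :: l2 set set. countable B \<and> open = generate_topology B"
    using topological_basis_imp_subbasis by blast
qed

section \<open>Measures on $\mathbb{R}^n$\<close>

text \<open>
  $\mathbb{R}^n$ is the set of extensional functions on \<^term>\<open>{..<n}\<close>; coordinates are numbered
  from 0.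
\<close>

abbreviation Rn :: "nat \<Rightarrow> (nat \<Rightarrow> real) set" where
  "Rn n \<equiv> {..<n} \<rightarrow>\<^sub>E UNIV"

abbreviation borel_Rn :: "nat \<Rightarrow> (nat \<Rightarrow> real) measure" where
  "borel_Rn n \<equiv> Pi\<^sub>M {..<n} (\<lambda>_. borel)"

abbreviation lborel_Rn :: "nat \<Rightarrow> (nat \<Rightarrow> real) measure" where
  "lborel_Rn n \<equiv> Pi\<^sub>M {..<n} (\<lambda>_. lborel)"

definition metric_Rn :: "nat \<Rightarrow> (nat \<Rightarrow> real) metric" where
  "metric_Rn n = metric (Rn n, \<lambda>x y. L2_set (\<lambda>i. x i - y i) {..<n})"

lemma Metric_space_Rn: "Metric_space (Rn n) (\<lambda>x y. L2_set (\<lambda>i. x i - y i) {..<n})"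
proof
  fix x y z :: "nat \<Rightarrow> real"
  show "0 \<le> L2_set (\<lambda>i. x i - y i) {..<n}" by simp
  show "L2_set (\<lambda>i. x i - y i) {..<n} = L2_set (\<lambda>i. y i - x i) {..<n}"
    by (simp add: L2_set_def power2_commute)
  show "L2_set (\<lambda>i. x i - z i) {..<n} \<le> L2_set (\<lambda>i. x i - y i) {..<n} + L2_set (\<lambda>i. y i - z i) {..<n}"
    using L2_set_triangle_ineq[of "\<lambda>i. x i - y i" "\<lambda>i. y i - z i" "{..<n}"] by simp
  assume "x \<in> Rn n" "y \<in> Rn n"
  then show "L2_set (\<lambda>i. x i - y i) {..<n} = 0 \<longleftrightarrow> x = y"
    by (auto simp: L2_set_eq_0_iff intro: PiE_ext)
qed

lemma mspace_metric_Rn [simp]: "mspace (metric_Rn n) = Rn n"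
  and mdist_metric_Rn [simp]: "mdist (metric_Rn n) x y = L2_set (\<lambda>i. x i - y i) {..<n}"
  by (simp_all add: metric_Rn_def Metric_space.mspace_metric[OF Metric_space_Rn]
      Metric_space.mdist_metric[OF Metric_space_Rn])

definition solid_ellipsoid :: "nat \<Rightarrow> (nat \<Rightarrow> real) \<Rightarrow> (nat \<Rightarrow> real) set" where
  "solid_ellipsoid n \<alpha> = {x \<in> Rn n. (\<Sum>i<n. (x i)\<^sup>2 / (\<alpha> i)\<^sup>2) \<le> 1}"

definition ellipsoid :: "nat \<Rightarrow> (nat \<Rightarrow> real) \<Rightarrow> (nat \<Rightarrow> real) set" where
  "ellipsoid n \<alpha> = {x \<in> Rn n. (\<Sum>i<n. (x i)\<^sup>2 / (\<alpha> i)\<^sup>2) = 1}"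

definition solid_ellipsoid_measure :: "nat \<Rightarrow> (nat \<Rightarrow> real) \<Rightarrow> (nat \<Rightarrow> real) measure" where
  "solid_ellipsoid_measure n \<alpha> = uniform_measure (lborel_Rn n) (solid_ellipsoid n \<alpha>)"

text \<open>
  The \<open>m\<close>-dimensional Riemannian volume measure of the graph of \<open>h\<close> over an open set \<open>U\<close>, as a
  measure on $\mathbb{R}^{m+1}$. In the chart $y \mapsto (y, h(y))$ the induced metric is
  $\mathrm{id} + \nabla h \, \nabla h^T$, whose determinant is $1 + |\nabla h|^2$.
\<close>

definition graph_volume ::
    "nat \<Rightarrow> (nat \<Rightarrow> real) set \<Rightarrow> ((nat \<Rightarrow> real) \<Rightarrow> real) \<Rightarrow> (nat \<Rightarrow> real) measure" where
  "graph_volume m U h =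
     distr
       (density (lborel_Rn m)
         (\<lambda>y. indicator U y *
           ennreal (sqrt (1 + (\<Sum>i<m. (deriv (\<lambda>t. h (y(i := t))) (y i))\<^sup>2)))))
       (borel_Rn (Suc m)) (\<lambda>y. y(m := h y))"

text \<open>
  The unit sphere is covered, up to its equator $x_{n-1} = 0$, which has volume zero, by the two
  graphs $\pm\sqrt{1 - |y|^2}$ over the open unit ball of $\mathbb{R}^{n-1}$.
\<close>

definition sphere_volume :: "nat \<Rightarrow> (nat \<Rightarrow> real) measure" where
  "sphere_volume n =
     (let U = {y \<in> Rn (n - 1). (\<Sum>i<n - 1. (y i)\<^sup>2) < 1};
          h = (\<lambda>y. sqrt (1 - (\<Sum>i<n - 1. (y i)\<^sup>2)))
      in measure_of (space (borel_Rn n)) (sets (borel_Rn n))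
           (\<lambda>A. emeasure (graph_volume (n - 1) U h) A
              + emeasure (graph_volume (n - 1) U (\<lambda>y. - h y)) A))"

definition sphere_measure :: "nat \<Rightarrow> (nat \<Rightarrow> real) measure" where
  "sphere_measure n = uniform_measure (sphere_volume n) (ellipsoid n (\<lambda>_. 1))"

definition ellipsoid_measure :: "nat \<Rightarrow> (nat \<Rightarrow> real) \<Rightarrow> (nat \<Rightarrow> real) measure" where
  "ellipsoid_measure n \<alpha> = distr (sphere_measure n) (borel_Rn n) (\<lambda>x. \<lambda>i\<in>{..<n}. \<alpha> i * x i)"

definition on_l2 :: "nat \<Rightarrow> (nat \<Rightarrow> real) measure \<Rightarrow> l2 measure" where
  "on_l2 n \<mu> = distr \<mu> borel (embed n)"

section \<open>Gaussian measures\<close>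

text \<open>The argument is the variance; \<^const>\<open>normal_density\<close> takes the standard deviation.\<close>

definition gauss1 :: "real \<Rightarrow> real measure" where
  "gauss1 v = (if v = 0 then return borel 0 else density lborel (normal_density 0 (sqrt v)))"

text \<open>
  The product measure lives on $\mathbb{R}^\infty$; if the variances are summable, it is
  concentrated on the square-summable sequences.
\<close>

definition gauss_l2 :: "(nat \<Rightarrow> real) \<Rightarrow> l2 measure" where
  "gauss_l2 v =
     distr
       (restrict_space (Pi\<^sub>M UNIV (\<lambda>i. gauss1 (v i))) {x. summable (\<lambda>i. (x i)\<^sup>2)})
       borel Abs_l2"

section \<open>Weak convergence and the Wasserstein distance\<close>

definition weakly_converges_to ::
    "(nat \<Rightarrow> 'a::topological_space measure) \<Rightarrow> 'a measure \<Rightarrow> bool" where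
  "weakly_converges_to \<mu> \<nu> \<longleftrightarrow>
     (\<forall>f :: 'a \<Rightarrow> real. continuous_on UNIV f \<and> bounded (range f) \<longrightarrow>
        (\<lambda>j. \<integral>x. f x \<partial>\<mu> j) \<longlonglongrightarrow> (\<integral>x. f x \<partial>\<nu>))"

definition couplings :: "'a measure \<Rightarrow> 'b measure \<Rightarrow> ('a \<times> 'b) measure set" where
  "couplings \<mu> \<nu> =
     {\<pi>. sets \<pi> = sets (\<mu> \<Otimes>\<^sub>M \<nu>) \<and> distr \<pi> \<mu> fst = \<mu> \<and> distr \<pi> \<nu> snd = \<nu>}"

definition ennreal_sqrt :: "ennreal \<Rightarrow> ennreal" where
  "ennreal_sqrt x = (if x = \<top> then \<top> else ennreal (sqrt (enn2real x)))"

definition W2 :: "'a::metric_space measure \<Rightarrow> 'a measure \<Rightarrow> ennreal" where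
  "W2 \<mu> \<nu> =
     (INF \<pi>\<in>couplings \<mu> \<nu>. ennreal_sqrt (\<integral>\<^sup>+ (x, x'). ennreal ((dist x x')\<^sup>2) \<partial>\<pi>))"

section \<open>Metric measure spaces and the box distance\<close>

type_synonym 'a mm = "'a metric \<times> 'a measure"

definition mm_space :: "'a mm \<Rightarrow> bool" where
  "mm_space = (\<lambda>(m, \<mu>).
     mcomplete_of m \<and> separable_space (mtopology_of m) \<and>
     space \<mu> = mspace m \<and> sets \<mu> = sigma_sets (mspace m) {U. openin (mtopology_of m) U} \<and>
     prob_space \<mu>)"

definition parameters :: "'a mm \<Rightarrow> (real \<Rightarrow> 'a) set" where
  "parameters = (\<lambda>(m, \<mu>).
     {\<phi> \<in> measurable (restrict_space lborel {0..<1}) \<mu>.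
        distr (restrict_space lborel {0..<1}) \<mu> \<phi> = \<mu>})"

definition box_dist :: "'a mm \<Rightarrow> 'b mm \<Rightarrow> ennreal" where
  "box_dist X Y = Inf {ennreal \<epsilon> | \<epsilon>. 0 \<le> \<epsilon> \<and>
     (\<exists>\<phi>\<in>parameters X. \<exists>\<psi>\<in>parameters Y. \<exists>J\<in>sets borel.
        J \<subseteq> {0..<1} \<and> measure lborel J \<ge> 1 - \<epsilon> \<and>
        (\<forall>s\<in>J. \<forall>t\<in>J.
           \<bar>mdist (fst X) (\<phi> s) (\<phi> t) - mdist (fst Y) (\<psi> s) (\<psi> t)\<bar> \<le> \<epsilon>))}"

definition box_converges_to :: "(nat \<Rightarrow> 'a mm) \<Rightarrow> 'b mm \<Rightarrow> bool" where
  "box_converges_to X Y \<longleftrightarrow>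
     (\<forall>j. mm_space (X j)) \<and> mm_space Y \<and> (\<lambda>j. box_dist (X j) Y) \<longlonglongrightarrow> 0"

definition solid_ellipsoid_mm :: "nat \<Rightarrow> (nat \<Rightarrow> real) \<Rightarrow> (nat \<Rightarrow> real) mm" where
  "solid_ellipsoid_mm n \<alpha> =
     (submetric (metric_Rn n) (solid_ellipsoid n \<alpha>),
      restrict_space (solid_ellipsoid_measure n \<alpha>) (solid_ellipsoid n \<alpha>))"

definition ellipsoid_mm :: "nat \<Rightarrow> (nat \<Rightarrow> real) \<Rightarrow> (nat \<Rightarrow> real) mm" where
  "ellipsoid_mm n \<alpha> =
     (submetric (metric_Rn n) (ellipsoid n \<alpha>),
      restrict_space (ellipsoid_measure n \<alpha>) (ellipsoid n \<alpha>))"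

definition gauss_mm :: "(nat \<Rightarrow> real) \<Rightarrow> l2 mm" where
  "gauss_mm v = (euclidean_metric, gauss_l2 v)"

end

theory Submission
  imports Defs
begin

text \<open>
  All the measures are realised on one probability space, on which the ellipsoids and the Gaussian
  limit become random points of the Hilbert space that are close in quadratic mean.

  Let \<open>X\<^sub>0, X\<^sub>1, \<dots>\<close> be independent standard Gaussians, let \<open>u\<close> be uniform on \<open>[0, 1]\<close> and independent
  of them, and write \<open>|X|\<close> for the norm of the first \<open>n\<close> coordinates. Since the Gaussian density is
  radial, the direction \<open>\<theta> = X / |X|\<close> is distributed by the normalised volume of the unit
  sphere (\<open>sphere_measure_eq_gauss_direction\<close>), and the point \<open>u\<^bsup>1/n\<^esup> \<theta>\<close> is uniform in the unit ball;
  stretching the axes gives the measures of the two ellipsoids (\<open>ellipsoid_measure_eq_model\<close>,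
  \<open>solid_ellipsoid_measure_eq_model\<close>). On the other side, \<open>(a\<^sub>i X\<^sub>i)\<^sub>i\<close> has the limiting Gaussian law
  (\<open>gauss_l2_eq_distr\<close>). With \<open>\<rho> = 1\<close> for the ellipsoid and \<open>\<rho> = u\<^bsup>1/n\<^esup>\<close> for the solid ellipsoid, the
  points to compare are \<open>\<rho> \<surd>(n - 1) A\<^sub>i \<theta>\<^sub>i\<close> and \<open>a\<^sub>i X\<^sub>i\<close>.

  Their difference is split by replacing first \<open>\<rho>\<close> by \<open>1\<close>, then \<open>A\<^sub>i\<close> by \<open>a\<^sub>i\<close>, and at last
  \<open>\<surd>(n - 1) \<theta>\<^sub>i\<close> by \<open>X\<^sub>i\<close>. Exchangeability of the coordinates gives \<open>E \<theta>\<^sub>i\<^sup>2 = 1/n\<close> and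
  \<open>E (\<surd>(n - 1) \<theta>\<^sub>i - X\<^sub>i)\<^sup>2 = E (\<surd>(n - 1) - |X|)\<^sup>2 / n\<close>, and the latter is at most \<open>5/n\<close> because
  \<open>|X|\<^sup>2\<close> has mean \<open>n\<close> and variance \<open>2n\<close>. So the expected squared distance is at most
  \<open>3 (E (1 - \<rho>)\<^sup>2 \<Sum>A\<^sub>i\<^sup>2 + \<Sum>(A\<^sub>i - a\<^sub>i)\<^sup>2 + (5/n) \<Sum>a\<^sub>i\<^sup>2)\<close> plus the tail \<open>\<Sum>a\<^sub>i\<^sup>2\<close> over \<open>i \<ge> n\<close>
  (\<open>nn_integral_coupled_dist\<close>), which tends to \<open>0\<close>.

  All the modes of convergence follow from this. The joint law is a coupling, which
  bounds the Wasserstein distance (\<open>W2_coupling_le\<close>); convergence in quadratic mean implies weak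
  convergence (\<open>weakly_converges_to_coupling\<close>); and by Chebyshev's inequality the two points are
  close outside an event of small probability, which the box distance is allowed to discard
  (\<open>box_dist_coupling_le\<close>). For the box distance the probability space has to be an image of
  the unit interval: a sequence of reals is encoded in one real number, to which the quantile
  function applies (\<open>exists_parameter\<close>).
\<close>

section \<open>Lebesgue measure on coordinate spaces\<close>

interpretation lborel_prod: product_sigma_finite "\<lambda>_::nat. lborel :: real measure"
  by standard

lemma sets_lborel_Rn [simp, measurable_cong]: "sets (lborel_Rn n) = sets (borel_Rn n)"
  by (intro sets_PiM_cong) auto

lemma space_borel_Rn: "space (borel_Rn n) = Rn n"
  by (simp add: space_PiM)

lemma sigma_finite_lborel_Rn: "sigma_finite_measure (lborel_Rn n)"
  by (rule lborel_prod.sigma_finite) simp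

lemma measurable_fun_upd_Rn [measurable]:
  assumes [measurable]: "f \<in> M \<rightarrow>\<^sub>M borel_Rn m" "g \<in> borel_measurable M"
  shows "(\<lambda>x. (f x)(m := g x)) \<in> M \<rightarrow>\<^sub>M borel_Rn (Suc m)"
  by (rule measurable_fun_upd[where J = "{..<m}"]) (auto simp: lessThan_Suc)

lemma nn_integral_lborel_Rn_Suc:
  assumes [measurable]: "f \<in> borel_measurable (borel_Rn (Suc m))"
  shows "(\<integral>\<^sup>+x. f x \<partial>lborel_Rn (Suc m)) = (\<integral>\<^sup>+z. \<integral>\<^sup>+s. f (z(m := s)) \<partial>lborel \<partial>lborel_Rn m)"
proof -
  have "f \<in> borel_measurable (lborel_Rn (Suc m))" by measurable
  then show ?thesis
    unfolding lessThan_Suc by (intro lborel_prod.product_nn_integral_insert) auto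
qed

text \<open>
  The factors may differ from axis to axis: equal factors are used for polar coordinates, the
  semi-axes of an ellipsoid for its volume.
\<close>

lemma nn_integral_lborel_Rn_scale:
  assumes "f \<in> borel_measurable (borel_Rn m)" "\<And>i. i < m \<Longrightarrow> 0 < c i"
  shows "(\<integral>\<^sup>+x. f x \<partial>lborel_Rn m)
    = ennreal (\<Prod>i<m. c i) * (\<integral>\<^sup>+x. f (\<lambda>i\<in>{..<m}. c i * x i) \<partial>lborel_Rn m)"
  using assms
proof (induction m arbitrary: f)
  case 0
  then show ?case by (simp add: PiM_empty nn_integral_count_space_finite restrict_def)
next
  case (Suc m)
  note [measurable] = Suc.prems(1)
  interpret sigma_finite_measure "lborel_Rn m" by (rule sigma_finite_lborel_Rn)
  have c: "0 < c m" using Suc.prems(2) by simp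
  have "(\<integral>\<^sup>+x. f x \<partial>lborel_Rn (Suc m)) = (\<integral>\<^sup>+z. \<integral>\<^sup>+s. f (z(m := s)) \<partial>lborel \<partial>lborel_Rn m)"
    by (rule nn_integral_lborel_Rn_Suc) fact
  also have "\<dots> = (\<integral>\<^sup>+z. ennreal (c m) * (\<integral>\<^sup>+s. f (z(m := c m * s)) \<partial>lborel) \<partial>lborel_Rn m)"
  proof (rule nn_integral_cong)
    fix z assume "z \<in> space (lborel_Rn m)"
    then have [measurable]: "(\<lambda>s. z(m := s)) \<in> borel \<rightarrow>\<^sub>M borel_Rn (Suc m)"
      by (intro measurable_fun_upd_Rn) (auto simp: space_PiM)
    show "(\<integral>\<^sup>+s. f (z(m := s)) \<partial>lborel) = ennreal (c m) * (\<integral>\<^sup>+s. f (z(m := c m * s)) \<partial>lborel)"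
      using c by (subst nn_integral_real_affine[where c = "c m" and t = 0]) auto
  qed
  also have "\<dots> = ennreal (c m) * (\<integral>\<^sup>+z. (\<integral>\<^sup>+s. f (z(m := c m * s)) \<partial>lborel) \<partial>lborel_Rn m)"
    by (rule nn_integral_cmult) measurable
  also have "(\<integral>\<^sup>+z. (\<integral>\<^sup>+s. f (z(m := c m * s)) \<partial>lborel) \<partial>lborel_Rn m) = ennreal (\<Prod>i<m. c i) *
      (\<integral>\<^sup>+z. (\<integral>\<^sup>+s. f ((\<lambda>i\<in>{..<m}. c i * z i)(m := c m * s)) \<partial>lborel) \<partial>lborel_Rn m)"
    by (rule Suc.IH) (measurable, use Suc.prems(2) in \<open>auto simp: less_Suc_eq\<close>)
  also have "(\<integral>\<^sup>+z. (\<integral>\<^sup>+s. f ((\<lambda>i\<in>{..<m}. c i * z i)(m := c m * s)) \<partial>lborel) \<partial>lborel_Rn m)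
      = (\<integral>\<^sup>+z. (\<integral>\<^sup>+s. f (\<lambda>i\<in>{..<Suc m}. c i * (z(m := s)) i) \<partial>lborel) \<partial>lborel_Rn m)"
    by (intro nn_integral_cong arg_cong[where f = f]) (auto simp: fun_eq_iff restrict_def)
  also have "\<dots> = (\<integral>\<^sup>+x. f (\<lambda>i\<in>{..<Suc m}. c i * x i) \<partial>lborel_Rn (Suc m))"
    by (rule nn_integral_lborel_Rn_Suc[symmetric]) measurable
  finally have "(\<integral>\<^sup>+x. f x \<partial>lborel_Rn (Suc m)) = (ennreal (c m) * ennreal (\<Prod>i<m. c i)) *
      (\<integral>\<^sup>+x. f (\<lambda>i\<in>{..<Suc m}. c i * x i) \<partial>lborel_Rn (Suc m))"
    by (simp only: mult.assoc)
  also have "ennreal (c m) * ennreal (\<Prod>i<m. c i) = ennreal (\<Prod>i<Suc m. c i)"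
    using c by (simp add: ennreal_mult' mult.commute)
  finally show ?case .
qed

section \<open>Polar coordinates in a half-space\<close>

lemma nn_integral_incseq_sets:
  assumes [measurable]: "F \<in> borel_measurable M" "\<And>k. A k \<in> sets M" and A: "incseq A"
  shows "(SUP k. \<integral>\<^sup>+x. F x * indicator (A k) x \<partial>M) = (\<integral>\<^sup>+x. F x * indicator (\<Union>k. A k) x \<partial>M)"
proof -
  have "range A \<subseteq> sets (density M F)" by auto
  from SUP_emeasure_incseq[OF this A] show ?thesis by (simp add: emeasure_density)
qed

text \<open>
  The substitution \<open>r = \<surd>(s\<^sup>2 + q)\<close>, \<open>dr = s/r ds\<close>. It expresses the height
  \<open>s = \<surd>(r\<^sup>2 - q)\<close> of a point above the equatorial hyperplane through its distance \<open>r\<close> from the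
  origin, where \<open>q\<close> is the squared norm of its projection to that hyperplane.
\<close>

lemma nn_integral_hyperbola_substitution:
  fixes G :: "real \<Rightarrow> ennreal"
  assumes G [measurable]: "G \<in> borel_measurable borel" and q: "0 \<le> q"
  shows "(\<integral>\<^sup>+r. ennreal (r / sqrt (r\<^sup>2 - q)) * G (sqrt (r\<^sup>2 - q)) * indicator {r. 0 < r \<and> q < r\<^sup>2} r \<partial>lborel)
    = (\<integral>\<^sup>+s. G s * indicator {0<..} s \<partial>lborel)"
proof -
  define g where "g s = sqrt (s\<^sup>2 + q)" for s
  define H where "H r = ennreal (r / sqrt (r\<^sup>2 - q)) * G (sqrt (r\<^sup>2 - q))" for r
  have [measurable]: "H \<in> borel_measurable borel" unfolding H_def by measurable
  (* The substitution rule is for compact intervals, and the square root is not differentiable at 0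
     if q = 0. So (0, infinity) is exhausted by the intervals [l k, u k + 1]; the added 1 makes them
     nondegenerate, as l 0 = u 0. *)
  define l where "l k = 1 / (real k + 1)" for k
  define u where "u k = real k + 1" for k
  have lu: "0 < l k" "l k < u k + 1" "0 < u k" for k
    by (auto simp: l_def u_def field_simps add_pos_nonneg)
  have inc: "l (Suc k) \<le> l k" "u k \<le> u (Suc k)" for k
    by (auto simp: l_def u_def field_simps)
  have g_mono: "g s \<le> g t" if "0 \<le> s" "s \<le> t" for s t
    using that by (simp add: g_def power_mono)
  have g_inc: "g (l (Suc k)) \<le> g (l k)" "g (u k + 1) \<le> g (u (Suc k) + 1)" for k
    using inc[of k] lu[of k] lu[of "Suc k"] by (auto intro!: g_mono)
  have step: "(\<integral>\<^sup>+r. H r * indicator {g (l k)..g (u k + 1)} r \<partial>lborel)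
      = (\<integral>\<^sup>+s. G s * indicator {l k..u k + 1} s \<partial>lborel)" for k
  proof -
    have "(\<integral>\<^sup>+r. H r * indicator {g (l k)..g (u k + 1)} r \<partial>lborel)
      = (\<integral>\<^sup>+s. H (g s) * ennreal (s / g s) * indicator {l k..u k + 1} s \<partial>lborel)"
    proof (rule nn_integral_substitution_aux)
      fix s assume "s \<in> {l k..u k + 1}"
      then have s: "0 < s" using lu(1)[of k] by auto
      then have "0 < s\<^sup>2 + q" using q by (simp add: add_pos_nonneg)
      then show "(g has_real_derivative s / g s) (at s)"
        unfolding g_def by (auto intro!: derivative_eq_intros simp: field_simps)
      show "0 \<le> s / g s" using s q by (simp add: g_def)
    next
      show "continuous_on {l k..u k + 1} (\<lambda>s. s / g s)"
        unfolding g_def using lu(1)[of k] q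
        by (intro continuous_intros) (auto simp: add_nonneg_eq_0_iff)
    qed (use lu in auto)
    also have "\<dots> = (\<integral>\<^sup>+s. G s * indicator {l k..u k + 1} s \<partial>lborel)"
    proof (rule nn_integral_cong)
      fix s :: real
      show "H (g s) * ennreal (s / g s) * indicator {l k..u k + 1} s = G s * indicator {l k..u k + 1} s"
      proof (cases "s \<in> {l k..u k + 1}")
        case True
        then have s: "0 < s" using lu(1)[of k] by auto
        then have "0 < s\<^sup>2 + q" using q by (simp add: add_pos_nonneg)
        then have "0 < g s" "(g s)\<^sup>2 - q = s\<^sup>2" by (simp_all add: g_def)
        then have "ennreal (g s / s) * ennreal (s / g s) = 1"
          using s by (simp add: ennreal_mult'[symmetric])
        then have "H (g s) * ennreal (s / g s) = G s"
          using s \<open>(g s)\<^sup>2 - q = s\<^sup>2\<close> by (simp add: H_def mult.commute mult.left_commute)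
        then show ?thesis by simp
      qed auto
    qed
    finally show ?thesis .
  qed
  have U1: "(\<Union>k. {l k..u k + 1}) = {0<..}"
  proof (intro equalityI subsetI)
    fix s :: real assume "s \<in> {0<..}"
    then have s: "0 < s" by simp
    obtain k1 where "1 / s < real k1" using reals_Archimedean2 by blast
    moreover obtain k2 where "s < real k2" using reals_Archimedean2 by blast
    ultimately have "s \<in> {l (max k1 k2)..u (max k1 k2) + 1}"
      using s by (auto simp: l_def u_def field_simps max_def) (smt (verit) mult_left_mono of_nat_mono)+
    then show "s \<in> (\<Union>k. {l k..u k + 1})" by blast
  qed (auto intro: less_le_trans[OF lu(1)])
  have U2: "(\<Union>k. {g (l k)..g (u k + 1)}) = {r. 0 < r \<and> q < r\<^sup>2}"
  proof (intro equalityI subsetI)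
    fix r assume "r \<in> {r. 0 < r \<and> q < r\<^sup>2}"
    then have r: "0 < r" "q < r\<^sup>2" by auto
    then have "0 < sqrt (r\<^sup>2 - q)" by simp
    then obtain k where k: "sqrt (r\<^sup>2 - q) \<in> {l k..u k + 1}" using U1 by blast
    have "r = g (sqrt (r\<^sup>2 - q))" using r by (simp add: g_def)
    moreover have "g (l k) \<le> g (sqrt (r\<^sup>2 - q))" "g (sqrt (r\<^sup>2 - q)) \<le> g (u k + 1)"
      using k lu[of k] r by (auto intro!: g_mono)
    ultimately show "r \<in> (\<Union>k. {g (l k)..g (u k + 1)})" by auto
  next
    fix r assume "r \<in> (\<Union>k. {g (l k)..g (u k + 1)})"
    then obtain k where k: "g (l k) \<le> r" by auto
    have "0 < (l k)\<^sup>2" using lu[of k] by simp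
    then have "0 < (l k)\<^sup>2 + q" "q < (l k)\<^sup>2 + q" using q by linarith+
    then have g: "0 < g (l k)" "q < (g (l k))\<^sup>2" by (simp_all add: g_def)
    then have "(g (l k))\<^sup>2 \<le> r\<^sup>2" using k by (intro power_mono) auto
    then have "0 < r" "q < r\<^sup>2" using k g by linarith+
    then show "r \<in> {r. 0 < r \<and> q < r\<^sup>2}" by simp
  qed
  have "(\<integral>\<^sup>+r. H r * indicator {r. 0 < r \<and> q < r\<^sup>2} r \<partial>lborel)
      = (SUP k. \<integral>\<^sup>+r. H r * indicator {g (l k)..g (u k + 1)} r \<partial>lborel)"
    unfolding U2[symmetric]
    by (intro nn_integral_incseq_sets[symmetric] incseq_SucI)
       (use g_inc in auto)
  also have "\<dots> = (SUP k. \<integral>\<^sup>+s. G s * indicator {l k..u k + 1} s \<partial>lborel)"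
    by (simp add: step)
  also have "\<dots> = (\<integral>\<^sup>+s. G s * indicator {0<..} s \<partial>lborel)"
    unfolding U1[symmetric] by (intro nn_integral_incseq_sets incseq_SucI) (use inc in auto)
  finally show ?thesis by (simp add: H_def)
qed

definition cap_height :: "nat \<Rightarrow> (nat \<Rightarrow> real) \<Rightarrow> real" where
  "cap_height m y = sqrt (1 - (\<Sum>i<m. (y i)\<^sup>2))"

definition unit_disc :: "nat \<Rightarrow> (nat \<Rightarrow> real) set" where
  "unit_disc m = {y \<in> Rn m. (\<Sum>i<m. (y i)\<^sup>2) < 1}"

lemma measurable_cap_height [measurable]: "cap_height m \<in> borel_measurable (borel_Rn m)"
  unfolding cap_height_def by measurable

lemma sets_unit_disc [measurable]: "unit_disc m \<in> sets (borel_Rn m)"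
proof -
  have "{y \<in> space (borel_Rn m). (\<Sum>i<m. (y i)\<^sup>2) < 1} \<in> sets (borel_Rn m)" by measurable
  then show ?thesis by (simp add: unit_disc_def space_borel_Rn)
qed

text \<open>
  For \<open>e = \<plusminus>1\<close>, the half-space of the points whose last coordinate has the sign \<open>e\<close> is swept
  out by the multiples \<open>r (y, e h(y))\<close> of the points of a hemisphere, where \<open>h = cap_height m\<close>. For fixed \<open>r\<close> put \<open>z = r y\<close>, so that \<open>r\<^sup>m dy = dz\<close> and
  \<open>1/h(y) = r / \<surd>(r\<^sup>2 - |z|\<^sup>2)\<close>; after exchanging the integrals, for fixed \<open>z\<close> the height
  \<open>s = \<surd>(r\<^sup>2 - |z|\<^sup>2)\<close> satisfies \<open>ds = r / \<surd>(r\<^sup>2 - |z|\<^sup>2) dr\<close>. The factor \<open>1/h\<close> is thus exactly the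
  density which turns the right-hand side into Lebesgue measure.
\<close>

lemma polar_half_space:
  assumes f [measurable]: "f \<in> borel_measurable (borel_Rn (Suc m))"
  shows "(\<integral>\<^sup>+z. \<integral>\<^sup>+s. f (z(m := e * s)) * indicator {0<..} s \<partial>lborel \<partial>lborel_Rn m)
    = (\<integral>\<^sup>+r. ennreal (r ^ m) * indicator {0<..} r *
        (\<integral>\<^sup>+y. indicator (unit_disc m) y * ennreal (1 / cap_height m y) *
          f (\<lambda>i\<in>{..<Suc m}. r * (y(m := e * cap_height m y)) i) \<partial>lborel_Rn m) \<partial>lborel)"
proof -
  interpret S: sigma_finite_measure "lborel_Rn m" by (rule sigma_finite_lborel_Rn)
  interpret P: pair_sigma_finite "lborel_Rn m" "lborel :: real measure" ..
  define q where "q z = (\<Sum>i<m. (z i)\<^sup>2)" for z :: "nat \<Rightarrow> real"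
  have q_meas [measurable]: "q \<in> borel_measurable (borel_Rn m)" unfolding q_def by measurable
  have q0: "0 \<le> q z" for z by (simp add: q_def sum_nonneg)
  (* The common integrand in the variables z and r, between the two substitutions. *)
  define L where "L z r = ennreal (r / sqrt (r\<^sup>2 - q z)) * f (z(m := e * sqrt (r\<^sup>2 - q z))) *
      indicator {r. 0 < r \<and> q z < r\<^sup>2} r" for z and r :: real
  have L_alt: "L z r = (if 0 < r \<and> q z < r\<^sup>2 then
      ennreal (r / sqrt (r\<^sup>2 - q z)) * f (z(m := e * sqrt (r\<^sup>2 - q z))) else 0)" for z r
    by (simp add: L_def)
  have [measurable]: "(\<lambda>(z, r). L z r) \<in> borel_measurable (lborel_Rn m \<Otimes>\<^sub>M lborel)"
    unfolding L_alt split_def by measurable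
  have L_meas: "(\<lambda>z. L z r) \<in> borel_measurable (borel_Rn m)" for r
    unfolding L_alt by measurable
  have "(\<integral>\<^sup>+z. \<integral>\<^sup>+s. f (z(m := e * s)) * indicator {0<..} s \<partial>lborel \<partial>lborel_Rn m)
      = (\<integral>\<^sup>+z. \<integral>\<^sup>+r. L z r \<partial>lborel \<partial>lborel_Rn m)"
  proof (rule nn_integral_cong)
    fix z assume "z \<in> space (lborel_Rn m)"
    then have [measurable]: "(\<lambda>s. z(m := e * s)) \<in> borel \<rightarrow>\<^sub>M borel_Rn (Suc m)"
      by (intro measurable_fun_upd_Rn) (auto simp: space_PiM)
    show "(\<integral>\<^sup>+s. f (z(m := e * s)) * indicator {0<..} s \<partial>lborel) = (\<integral>\<^sup>+r. L z r \<partial>lborel)"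
      unfolding L_def by (rule nn_integral_hyperbola_substitution[symmetric]) (auto simp: q0)
  qed
  also have "\<dots> = (\<integral>\<^sup>+r. \<integral>\<^sup>+z. L z r \<partial>lborel_Rn m \<partial>lborel)"
    by (rule P.Fubini'[symmetric]) measurable
  also have "\<dots> = (\<integral>\<^sup>+r. ennreal (r ^ m) * indicator {0<..} r *
        (\<integral>\<^sup>+y. indicator (unit_disc m) y * ennreal (1 / cap_height m y) *
          f (\<lambda>i\<in>{..<Suc m}. r * (y(m := e * cap_height m y)) i) \<partial>lborel_Rn m) \<partial>lborel)"
  proof (rule nn_integral_cong)
    fix r :: real
    show "(\<integral>\<^sup>+z. L z r \<partial>lborel_Rn m) = ennreal (r ^ m) * indicator {0<..} r *
        (\<integral>\<^sup>+y. indicator (unit_disc m) y * ennreal (1 / cap_height m y) *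
          f (\<lambda>i\<in>{..<Suc m}. r * (y(m := e * cap_height m y)) i) \<partial>lborel_Rn m)"
    proof (cases "0 < r")
      case r: True
      have "(\<integral>\<^sup>+z. L z r \<partial>lborel_Rn m)
          = ennreal (\<Prod>i<m. r) * (\<integral>\<^sup>+y. L (\<lambda>i\<in>{..<m}. r * y i) r \<partial>lborel_Rn m)"
        using r by (intro nn_integral_lborel_Rn_scale L_meas) auto
      also have "(\<integral>\<^sup>+y. L (\<lambda>i\<in>{..<m}. r * y i) r \<partial>lborel_Rn m) =
        (\<integral>\<^sup>+y. indicator (unit_disc m) y * ennreal (1 / cap_height m y) *
          f (\<lambda>i\<in>{..<Suc m}. r * (y(m := e * cap_height m y)) i) \<partial>lborel_Rn m)"
      proof (rule nn_integral_cong)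
        fix y assume "y \<in> space (lborel_Rn m)"
        then have y: "y \<in> Rn m" by (simp add: space_PiM)
        have qr: "q (\<lambda>i\<in>{..<m}. r * y i) = r\<^sup>2 * q y"
          by (simp add: q_def power_mult_distrib sum_distrib_left)
        have "r\<^sup>2 - r\<^sup>2 * q y = r\<^sup>2 * (1 - q y)" by (simp add: algebra_simps)
        then have sq: "sqrt (r\<^sup>2 - r\<^sup>2 * q y) = r * cap_height m y"
          using r by (simp add: real_sqrt_mult cap_height_def q_def)
        have iff: "r\<^sup>2 * q y < r\<^sup>2 \<longleftrightarrow> y \<in> unit_disc m"
          using r y by (simp add: unit_disc_def q_def)
        have fe: "(\<lambda>i\<in>{..<m}. r * y i)(m := e * (r * cap_height m y))
            = (\<lambda>i\<in>{..<Suc m}. r * (y(m := e * cap_height m y)) i)"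
          by (auto simp: fun_eq_iff restrict_def)
        show "L (\<lambda>i\<in>{..<m}. r * y i) r = indicator (unit_disc m) y * ennreal (1 / cap_height m y) *
          f (\<lambda>i\<in>{..<Suc m}. r * (y(m := e * cap_height m y)) i)"
          unfolding L_alt qr sq fe iff using r by (simp add: indicator_def)
      qed
      finally show ?thesis using r by simp
    qed (simp add: L_def)
  qed
  finally show ?thesis .
qed

section \<open>The volume of the sphere\<close>

text \<open>
  The two hemispheres are put together by adding measures as set functions.
\<close>

lemma
  fixes M N :: "'a measure"
  defines "K \<equiv> measure_of (space M) (sets M) (\<lambda>A. emeasure M A + emeasure N A)"
  assumes N: "sets N = sets M"
  shows sets_measure_add: "sets K = sets M"
    and emeasure_measure_add: "A \<in> sets M \<Longrightarrow> emeasure K A = emeasure M A + emeasure N A"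
    and nn_integral_measure_add: "f \<in> borel_measurable M \<Longrightarrow>
      integral\<^sup>N K f = integral\<^sup>N M f + integral\<^sup>N N f"
proof -
  show sets_K [simp, measurable_cong]: "sets K = sets M" by (simp add: K_def)
  note [measurable_cong] = N
  have em: "emeasure K A = emeasure M A + emeasure N A" if "A \<in> sets M" for A
    unfolding K_def
  proof (rule emeasure_measure_of_sigma)
    show "sigma_algebra (space M) (sets M)" by (rule sets.sigma_algebra_axioms)
    show "positive (sets M) (\<lambda>A. emeasure M A + emeasure N A)" by (simp add: positive_def)
    show "countably_additive (sets M) (\<lambda>A. emeasure M A + emeasure N A)"
    proof (rule countably_additiveI)
      fix B :: "nat \<Rightarrow> 'a set"
      assume B: "range B \<subseteq> sets M" "disjoint_family B"
      show "(\<Sum>i. emeasure M (B i) + emeasure N (B i)) = emeasure M (\<Union>i. B i) + emeasure N (\<Union>i. B i)"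
        using B N by (subst suminf_add[symmetric]) (simp_all add: suminf_emeasure)
    qed
  qed (fact that)
  then show "A \<in> sets M \<Longrightarrow> emeasure K A = emeasure M A + emeasure N A" .
  assume "f \<in> borel_measurable M"
  then show "integral\<^sup>N K f = integral\<^sup>N M f + integral\<^sup>N N f"
  proof (induction rule: borel_measurable_induct)
    case (cong f g)
    then have "integral\<^sup>N L f = integral\<^sup>N L g" if "sets L = sets M" for L
      using sets_eq_imp_space_eq[OF that] by (intro nn_integral_cong) simp
    with cong.IH show ?case by (simp add: N)
  next
    case (set A)
    then show ?case by (simp add: em N)
  next
    case (mult u c)
    then show ?case by (simp add: nn_integral_cmult distrib_left)
  next
    case (add u v)
    then show ?case by (simp add: nn_integral_add ac_simps)
  next
    case (seq U)
    have "integral\<^sup>N L (\<lambda>x. SUP i. U i x) = (SUP i. integral\<^sup>N L (U i))" if "sets L = sets M" for L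
      using \<open>incseq U\<close> seq.hyps(1) that by (intro nn_integral_monotone_convergence_SUP) (auto cong: measurable_cong_sets)
    moreover have "(SUP i. integral\<^sup>N M (U i) + integral\<^sup>N N (U i))
        = (SUP i. integral\<^sup>N M (U i)) + (SUP i. integral\<^sup>N N (U i))"
      using \<open>incseq U\<close> by (intro ennreal_SUP_add) (auto simp: incseq_def le_fun_def intro!: nn_integral_mono)
    ultimately show ?case
      using seq.IH N by (simp add: SUP_apply image_comp)
  qed
qed

lemma sets_graph_volume [simp, measurable_cong]: "sets (graph_volume m U h) = sets (borel_Rn (Suc m))"
  by (simp add: graph_volume_def)

lemma deriv_cap_height:
  assumes y: "y \<in> unit_disc m" and i: "i < m"
  shows "deriv (\<lambda>t. e * cap_height m (y(i := t))) (y i) = - e * y i / cap_height m y"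
proof (rule DERIV_imp_deriv)
  define c where "c = (\<Sum>k\<in>{..<m} - {i}. (y k)\<^sup>2)"
  have eq: "(\<Sum>k<m. ((y(i := t)) k)\<^sup>2) = t\<^sup>2 + c" for t
  proof -
    have "(\<Sum>k<m. ((y(i := t)) k)\<^sup>2)
        = ((y(i := t)) i)\<^sup>2 + (\<Sum>k\<in>{..<m} - {i}. ((y(i := t)) k)\<^sup>2)"
      using i by (intro sum.remove) auto
    also have "(\<Sum>k\<in>{..<m} - {i}. ((y(i := t)) k)\<^sup>2) = c"
      unfolding c_def by (intro sum.cong) auto
    finally show ?thesis by simp
  qed
  have pos: "0 < 1 - ((y i)\<^sup>2 + c)"
    using y eq[of "y i"] by (simp add: unit_disc_def)
  have "((\<lambda>t. e * sqrt (1 - (t\<^sup>2 + c))) has_real_derivative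
      - e * y i / sqrt (1 - ((y i)\<^sup>2 + c))) (at (y i))"
    using pos by (auto intro!: derivative_eq_intros simp: field_simps)
  then show "((\<lambda>t. e * cap_height m (y(i := t))) has_real_derivative
      - e * y i / cap_height m y) (at (y i))"
    using eq[of "y i"] by (simp only: cap_height_def eq fun_upd_triv)
qed

text \<open>
  As \<open>\<partial>h/\<partial>y\<^sub>i = - y\<^sub>i/h\<close> on the open unit disc, the area element is \<open>\<surd>(1 + |y|\<^sup>2/h\<^sup>2) = 1/h\<close>, for the lower
  hemisphere as for the upper one.
\<close>

lemma nn_integral_graph_volume:
  assumes e: "e\<^sup>2 = 1" and F [measurable]: "F \<in> borel_measurable (borel_Rn (Suc m))"
  shows "integral\<^sup>N (graph_volume m (unit_disc m) (\<lambda>y. e * cap_height m y)) F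
    = (\<integral>\<^sup>+y. indicator (unit_disc m) y * ennreal (1 / cap_height m y) *
        F (y(m := e * cap_height m y)) \<partial>lborel_Rn m)"
proof -
  have dens: "indicator (unit_disc m) y *
      ennreal (sqrt (1 + (\<Sum>i<m. (deriv (\<lambda>t. e * cap_height m (y(i := t))) (y i))\<^sup>2)))
    = indicator (unit_disc m) y * ennreal (1 / cap_height m y)" for y
  proof (cases "y \<in> unit_disc m")
    case True
    define q where "q = (\<Sum>i<m. (y i)\<^sup>2)"
    have q: "q < 1" using True by (simp add: unit_disc_def q_def)
    then have h: "(cap_height m y)\<^sup>2 = 1 - q" by (simp add: cap_height_def q_def)
    have "(\<Sum>i<m. (deriv (\<lambda>t. e * cap_height m (y(i := t))) (y i))\<^sup>2) = (\<Sum>i<m. (y i)\<^sup>2 / (1 - q))"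
      using e h by (intro sum.cong) (simp_all add: deriv_cap_height[OF True] power_divide power_mult_distrib)
    also have "\<dots> = q / (1 - q)" by (simp add: q_def sum_divide_distrib)
    also have "1 + q / (1 - q) = 1 / (1 - q)" using q by (simp add: field_simps)
    finally show ?thesis
      by (simp add: real_sqrt_divide cap_height_def q_def)
  qed simp
  show ?thesis
    unfolding graph_volume_def dens
    by (subst nn_integral_distr) (simp_all add: nn_integral_density cong: nn_integral_cong)
qed

lemma sphere_volume_Suc:
  "sphere_volume (Suc m) = (let N = (\<lambda>e. graph_volume m (unit_disc m) (\<lambda>y. e * cap_height m y)) in
     measure_of (space (N 1)) (sets (N 1)) (\<lambda>A. emeasure (N 1) A + emeasure (N (- 1)) A))"
proof -
  have "space (graph_volume m (unit_disc m) h) = space (borel_Rn (Suc m))" for h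
    by (rule sets_eq_imp_space_eq) simp
  then show ?thesis
    unfolding sphere_volume_def Let_def unit_disc_def cap_height_def by simp
qed

lemma sets_sphere_volume [simp, measurable_cong]: "sets (sphere_volume (Suc m)) = sets (borel_Rn (Suc m))"
  unfolding sphere_volume_Suc Let_def by (subst sets_measure_add) simp_all

lemma nn_integral_sphere_volume:
  assumes F [measurable]: "F \<in> borel_measurable (borel_Rn (Suc m))"
  shows "integral\<^sup>N (sphere_volume (Suc m)) F
    = (\<integral>\<^sup>+y. indicator (unit_disc m) y * ennreal (1 / cap_height m y) *
        F (y(m := cap_height m y)) \<partial>lborel_Rn m)
    + (\<integral>\<^sup>+y. indicator (unit_disc m) y * ennreal (1 / cap_height m y) *
        F (y(m := - cap_height m y)) \<partial>lborel_Rn m)"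
  unfolding sphere_volume_Suc Let_def
  using nn_integral_graph_volume[OF _ F, of 1] nn_integral_graph_volume[OF _ F, of "- 1"]
  by (subst nn_integral_measure_add) simp_all

text \<open>
  The two half-spaces add up to the whole space, since the hyperplane between them is a null set.
\<close>

theorem polar_coordinates:
  assumes f [measurable]: "f \<in> borel_measurable (borel_Rn (Suc m))"
  shows "(\<integral>\<^sup>+x. f x \<partial>lborel_Rn (Suc m)) = (\<integral>\<^sup>+r. ennreal (r ^ m) * indicator {0<..} r *
      (\<integral>\<^sup>+\<theta>. f (\<lambda>i\<in>{..<Suc m}. r * \<theta> i) \<partial>sphere_volume (Suc m)) \<partial>lborel)"
proof -
  interpret S: sigma_finite_measure "lborel_Rn m" by (rule sigma_finite_lborel_Rn)
  define half where "half e r = (\<integral>\<^sup>+y. indicator (unit_disc m) y * ennreal (1 / cap_height m y) *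
          f (\<lambda>i\<in>{..<Suc m}. r * (y(m := e * cap_height m y)) i) \<partial>lborel_Rn m)" for e r
  have [measurable]: "half e \<in> borel_measurable borel" for e
    unfolding half_def by measurable
  have "(\<integral>\<^sup>+x. f x \<partial>lborel_Rn (Suc m)) = (\<integral>\<^sup>+z. \<integral>\<^sup>+s. f (z(m := s)) \<partial>lborel \<partial>lborel_Rn m)"
    by (rule nn_integral_lborel_Rn_Suc) fact
  also have "\<dots> = (\<integral>\<^sup>+z. (\<integral>\<^sup>+s. f (z(m := 1 * s)) * indicator {0<..} s \<partial>lborel)
      + (\<integral>\<^sup>+s. f (z(m := - 1 * s)) * indicator {0<..} s \<partial>lborel) \<partial>lborel_Rn m)"
  proof (rule nn_integral_cong)
    fix z assume "z \<in> space (lborel_Rn m)"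
    then have [measurable]: "(\<lambda>s. z(m := s)) \<in> borel \<rightarrow>\<^sub>M borel_Rn (Suc m)"
      by (intro measurable_fun_upd_Rn) (auto simp: space_PiM)
    have "(\<integral>\<^sup>+s. f (z(m := s)) \<partial>lborel)
        = (\<integral>\<^sup>+s. f (z(m := s)) * indicator {0<..} s + f (z(m := s)) * indicator {..<0} s \<partial>lborel)"
      using AE_lborel_singleton[of 0]
      by (intro nn_integral_cong_AE) (auto simp: indicator_def)
    also have "\<dots> = (\<integral>\<^sup>+s. f (z(m := s)) * indicator {0<..} s \<partial>lborel)
        + (\<integral>\<^sup>+s. f (z(m := s)) * indicator {..<0} s \<partial>lborel)"
      by (rule nn_integral_add) auto
    also have "(\<integral>\<^sup>+s. f (z(m := s)) * indicator {..<0} s \<partial>lborel)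
        = (\<integral>\<^sup>+s. f (z(m := - 1 * s)) * indicator {0<..} s \<partial>lborel)"
      by (subst nn_integral_real_affine[where c = "-1" and t = 0])
         (auto intro!: nn_integral_cong simp: indicator_def)
    finally show "(\<integral>\<^sup>+s. f (z(m := s)) \<partial>lborel) =
        (\<integral>\<^sup>+s. f (z(m := 1 * s)) * indicator {0<..} s \<partial>lborel)
      + (\<integral>\<^sup>+s. f (z(m := - 1 * s)) * indicator {0<..} s \<partial>lborel)" by (simp only: mult_1)
  qed
  also have "\<dots> = (\<integral>\<^sup>+z. \<integral>\<^sup>+s. f (z(m := 1 * s)) * indicator {0<..} s \<partial>lborel \<partial>lborel_Rn m)
      + (\<integral>\<^sup>+z. \<integral>\<^sup>+s. f (z(m := - 1 * s)) * indicator {0<..} s \<partial>lborel \<partial>lborel_Rn m)"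
    by (rule nn_integral_add) measurable
  also have "\<dots> = (\<integral>\<^sup>+r. ennreal (r ^ m) * indicator {0<..} r * half 1 r \<partial>lborel)
      + (\<integral>\<^sup>+r. ennreal (r ^ m) * indicator {0<..} r * half (- 1) r \<partial>lborel)"
    unfolding half_def by (simp only: polar_half_space[OF f])
  also have "\<dots> = (\<integral>\<^sup>+r. ennreal (r ^ m) * indicator {0<..} r * half 1 r
      + ennreal (r ^ m) * indicator {0<..} r * half (- 1) r \<partial>lborel)"
    by (rule nn_integral_add[symmetric]) auto
  also have "\<dots> = (\<integral>\<^sup>+r. ennreal (r ^ m) * indicator {0<..} r *
      (\<integral>\<^sup>+\<theta>. f (\<lambda>i\<in>{..<Suc m}. r * \<theta> i) \<partial>sphere_volume (Suc m)) \<partial>lborel)"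
    unfolding half_def
    by (subst nn_integral_sphere_volume) (simp_all add: distrib_left)
  finally show ?thesis .
qed

section \<open>The direction of a Gaussian vector\<close>

definition std_gauss :: "real measure" where
  "std_gauss = density lborel std_normal_density"

abbreviation gauss_seq :: "(nat \<Rightarrow> real) measure" where
  "gauss_seq \<equiv> Pi\<^sub>M UNIV (\<lambda>_. std_gauss)"

lemma sets_std_gauss [simp, measurable_cong]: "sets std_gauss = sets borel"
  by (simp add: std_gauss_def)

lemma prob_space_std_gauss: "prob_space std_gauss"
  unfolding std_gauss_def by (rule prob_space_normal_density) simp

interpretation std_gauss: prob_space std_gauss
  by (rule prob_space_std_gauss)

interpretation gauss_seq: prob_space gauss_seq
  by (rule prob_space_PiM) (rule prob_space_std_gauss)

interpretation gauss_prod: product_prob_space "\<lambda>_::nat. std_gauss" UNIV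
  by standard

lemma sets_gauss_prod [simp, measurable_cong]:
  "sets (Pi\<^sub>M I (\<lambda>_::nat. std_gauss)) = sets (Pi\<^sub>M I (\<lambda>_. borel))"
  by (intro sets_PiM_cong) auto

lemma gauss_prod_density:
  "Pi\<^sub>M {..<n} (\<lambda>_. std_gauss)
    = density (lborel_Rn n) (\<lambda>x. ennreal ((1 / sqrt (2 * pi)) ^ n * exp (- (\<Sum>i<n. (x i)\<^sup>2) / 2)))"
proof (rule gauss_prod.PiM_eqI[symmetric])
  have dens: "ennreal ((1 / sqrt (2 * pi)) ^ n * exp (- (\<Sum>i<n. (x i)\<^sup>2) / 2))
      = (\<Prod>i<n. ennreal (std_normal_density (x i)))" for x :: "nat \<Rightarrow> real"
    by (simp add: prod_ennreal std_normal_density_def prod.distrib exp_sum[symmetric] sum_divide_distrib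
        sum_negf prod_dividef power_one_over)
  fix A :: "nat \<Rightarrow> real set"
  assume "\<And>i. i \<in> {..<n} \<Longrightarrow> A i \<in> sets std_gauss"
  then have A [measurable]: "\<And>i. i \<in> {..<n} \<Longrightarrow> A i \<in> sets borel" by simp
  have "emeasure (density (lborel_Rn n)
        (\<lambda>x. ennreal ((1 / sqrt (2 * pi)) ^ n * exp (- (\<Sum>i<n. (x i)\<^sup>2) / 2)))) (Pi\<^sub>E {..<n} A)
      = (\<integral>\<^sup>+x. (\<Prod>i<n. ennreal (std_normal_density (x i))) * indicator (Pi\<^sub>E {..<n} A) x \<partial>lborel_Rn n)"
    unfolding dens by (rule emeasure_density) (auto intro!: sets_PiM_I_finite)
  also have "\<dots> = (\<integral>\<^sup>+x. (\<Prod>i<n. ennreal (std_normal_density (x i)) * indicator (A i) (x i)) \<partial>lborel_Rn n)"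
    unfolding prod.distrib
    by (intro nn_integral_cong) (auto simp: indicator_def space_PiM PiE_iff prod_zero_iff)
  also have "\<dots> = (\<Prod>i<n. emeasure std_gauss (A i))"
    using A by (subst lborel_prod.product_nn_integral_prod)
      (auto simp: std_gauss_def emeasure_density intro!: prod.cong)
  finally show "emeasure (density (lborel_Rn n)
        (\<lambda>x. ennreal ((1 / sqrt (2 * pi)) ^ n * exp (- (\<Sum>i<n. (x i)\<^sup>2) / 2)))) (Pi\<^sub>E {..<n} A)
      = (\<Prod>i<n. emeasure std_gauss (A i))" .
qed auto

definition sqnorm :: "nat \<Rightarrow> (nat \<Rightarrow> real) \<Rightarrow> real" where
  "sqnorm n x = (\<Sum>i<n. (x i)\<^sup>2)"

text \<open>
  The value at the origin is the first basis vector, so that the direction is always a point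
  of the unit sphere; the spaces underlying the box distance require this for every sample, not just
  for almost every one.
\<close>

definition direction :: "nat \<Rightarrow> (nat \<Rightarrow> real) \<Rightarrow> nat \<Rightarrow> real" where
  "direction n x = (\<lambda>i\<in>{..<n}. if sqnorm n x = 0 then of_bool (i = 0) else x i / sqrt (sqnorm n x))"

lemma sqnorm_nonneg [simp]: "0 \<le> sqnorm n x"
  by (simp add: sqnorm_def sum_nonneg)

lemma measurable_sqnorm [measurable]: "{..<n} \<subseteq> I \<Longrightarrow> sqnorm n \<in> borel_measurable (Pi\<^sub>M I (\<lambda>_. borel))"
  unfolding sqnorm_def by (intro borel_measurable_sum borel_measurable_power measurable_component_singleton) auto

lemma measurable_direction [measurable]:
  "{..<n} \<subseteq> I \<Longrightarrow> direction n \<in> Pi\<^sub>M I (\<lambda>_. borel) \<rightarrow>\<^sub>M borel_Rn n"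
proof -
  assume [measurable]: "{..<n} \<subseteq> I"
  have [measurable]: "(\<lambda>x. x i) \<in> borel_measurable (Pi\<^sub>M I (\<lambda>_. borel))" if "i \<in> {..<n}" for i
    using \<open>{..<n} \<subseteq> I\<close> that by (intro measurable_component_singleton) auto
  show ?thesis unfolding direction_def by measurable
qed

lemma sqnorm_direction: "0 < n \<Longrightarrow> sqnorm n (direction n x) = 1"
proof (cases "sqnorm n x = 0")
  case True
  assume "0 < n"
  have "sqnorm n (direction n x) = (\<Sum>i<n. if i = 0 then 1 else 0)"
    unfolding sqnorm_def[of n "direction n x"] using True by (intro sum.cong) (auto simp: direction_def)
  with \<open>0 < n\<close> show ?thesis by simp
next
  case False
  have "sqnorm n (direction n x) = (\<Sum>i<n. (x i)\<^sup>2 / sqnorm n x)"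
    unfolding sqnorm_def[of n "direction n x"] using False
    by (intro sum.cong) (auto simp: direction_def power_divide)
  also have "\<dots> = sqnorm n x / sqnorm n x"
    by (simp only: sqnorm_def sum_divide_distrib)
  finally have "sqnorm n (direction n x) = sqnorm n x / sqnorm n x" .
  with False show ?thesis by simp
qed

lemma direction_scale:
  assumes "\<theta> \<in> Rn n" "sqnorm n \<theta> = 1" "0 < r"
  shows "direction n (\<lambda>i\<in>{..<n}. r * \<theta> i) = \<theta>"
proof -
  have "sqnorm n (\<lambda>i\<in>{..<n}. r * \<theta> i) = r\<^sup>2 * sqnorm n \<theta>"
    by (simp add: sqnorm_def power_mult_distrib sum_distrib_left)
  then show ?thesis
    using assms by (auto simp: direction_def fun_eq_iff PiE_def extensional_def)
qed

lemma ellipsoid_unit: "ellipsoid n (\<lambda>_. 1) = {\<theta> \<in> Rn n. sqnorm n \<theta> = 1}"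
  by (simp add: ellipsoid_def sqnorm_def)

lemma sets_ellipsoid [measurable]: "ellipsoid n \<alpha> \<in> sets (borel_Rn n)"
proof -
  have "{x \<in> space (borel_Rn n). (\<Sum>i<n. (x i)\<^sup>2 / (\<alpha> i)\<^sup>2) = 1} \<in> sets (borel_Rn n)" by measurable
  then show ?thesis by (simp add: ellipsoid_def space_borel_Rn)
qed

lemma sets_solid_ellipsoid [measurable]: "solid_ellipsoid n \<alpha> \<in> sets (borel_Rn n)"
proof -
  have "{x \<in> space (borel_Rn n). (\<Sum>i<n. (x i)\<^sup>2 / (\<alpha> i)\<^sup>2) \<le> 1} \<in> sets (borel_Rn n)" by measurable
  then show ?thesis by (simp add: solid_ellipsoid_def space_borel_Rn)
qed

lemma space_sphere_volume: "space (sphere_volume (Suc m)) = Rn (Suc m)"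
  by (subst sets_eq_imp_space_eq[OF sets_sphere_volume]) (simp add: space_PiM)

lemma AE_sphere_volume: "AE \<theta> in sphere_volume (Suc m). \<theta> \<in> ellipsoid (Suc m) (\<lambda>_. 1)"
proof (rule AE_I)
  show "{\<theta> \<in> space (sphere_volume (Suc m)). \<theta> \<notin> ellipsoid (Suc m) (\<lambda>_. 1)}
      \<subseteq> Rn (Suc m) - ellipsoid (Suc m) (\<lambda>_. 1)" by (auto simp: space_sphere_volume)
  have [measurable]: "Rn (Suc m) \<in> sets (borel_Rn (Suc m))"
    using sets.top[of "borel_Rn (Suc m)"] by (simp add: space_borel_Rn)
  then show "Rn (Suc m) - ellipsoid (Suc m) (\<lambda>_. 1) \<in> sets (sphere_volume (Suc m))" by simp
  have on: "y(m := e * cap_height m y) \<in> ellipsoid (Suc m) (\<lambda>_. 1)"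
    if "y \<in> unit_disc m" "e = 1 \<or> e = - 1" for y e
    using that by (auto simp: unit_disc_def ellipsoid_def cap_height_def PiE_iff extensional_def
        lessThan_Suc power_mult_distrib less_Suc_eq)
  have "emeasure (sphere_volume (Suc m)) (Rn (Suc m) - ellipsoid (Suc m) (\<lambda>_. 1))
      = (\<integral>\<^sup>+\<theta>. indicator (Rn (Suc m) - ellipsoid (Suc m) (\<lambda>_. 1)) \<theta> \<partial>sphere_volume (Suc m))"
    by simp
  also have "\<dots> = 0"
    using on[of _ 1] on[of _ "- 1"]
    by (subst nn_integral_sphere_volume) (auto simp: nn_integral_0_iff_AE indicator_def)
  finally show "emeasure (sphere_volume (Suc m)) (Rn (Suc m) - ellipsoid (Suc m) (\<lambda>_. 1)) = 0" .
qed

text \<open>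
  The Gaussian density depends only on \<open>r\<close> and the direction only on \<open>\<theta>\<close>, so in polar coordinates
  the integral factorises.
\<close>

lemma emeasure_gauss_direction:
  assumes A [measurable]: "A \<in> sets (borel_Rn (Suc m))"
  shows "emeasure (distr (Pi\<^sub>M {..<Suc m} (\<lambda>_. std_gauss)) (borel_Rn (Suc m)) (direction (Suc m))) A
    = (\<integral>\<^sup>+r. ennreal (r ^ m) * indicator {0<..} r *
        ennreal ((1 / sqrt (2 * pi)) ^ Suc m * exp (- r\<^sup>2 / 2)) \<partial>lborel)
      * emeasure (sphere_volume (Suc m)) A"
proof -
  let ?n = "Suc m"
  define \<phi> where "\<phi> q = ennreal ((1 / sqrt (2 * pi)) ^ ?n * exp (- q / 2))" for q :: real
  have [measurable]: "\<phi> \<in> borel_measurable borel" unfolding \<phi>_def by measurable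
  have [measurable]: "sqnorm ?n \<in> borel_measurable (borel_Rn ?n)" "direction ?n \<in> borel_Rn ?n \<rightarrow>\<^sub>M borel_Rn ?n"
    by (auto intro: measurable_sqnorm measurable_direction)
  have gd: "Pi\<^sub>M {..<?n} (\<lambda>_. std_gauss) = density (lborel_Rn ?n) (\<lambda>x. \<phi> (sqnorm ?n x))"
    unfolding gauss_prod_density \<phi>_def sqnorm_def ..
  have "emeasure (distr (Pi\<^sub>M {..<?n} (\<lambda>_. std_gauss)) (borel_Rn ?n) (direction ?n)) A
      = (\<integral>\<^sup>+x. indicator A (direction ?n x) \<partial>Pi\<^sub>M {..<?n} (\<lambda>_. std_gauss))"
    by (subst nn_integral_indicator[symmetric], simp, subst nn_integral_distr) simp_all
  also have "\<dots> = (\<integral>\<^sup>+x. \<phi> (sqnorm ?n x) * indicator A (direction ?n x) \<partial>lborel_Rn ?n)"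
    unfolding gd by (rule nn_integral_density) measurable
  also have "\<dots> = (\<integral>\<^sup>+r. ennreal (r ^ m) * indicator {0<..} r *
      (\<integral>\<^sup>+\<theta>. \<phi> (sqnorm ?n (\<lambda>i\<in>{..<?n}. r * \<theta> i)) * indicator A (direction ?n (\<lambda>i\<in>{..<?n}. r * \<theta> i))
        \<partial>sphere_volume ?n) \<partial>lborel)"
    by (rule polar_coordinates) measurable
  also have "\<dots> = (\<integral>\<^sup>+r. (ennreal (r ^ m) * indicator {0<..} r * \<phi> (r\<^sup>2)) *
      emeasure (sphere_volume ?n) A \<partial>lborel)"
  proof (rule nn_integral_cong)
    fix r :: real
    have "(\<integral>\<^sup>+\<theta>. \<phi> (sqnorm ?n (\<lambda>i\<in>{..<?n}. r * \<theta> i)) * indicator A (direction ?n (\<lambda>i\<in>{..<?n}. r * \<theta> i))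
        \<partial>sphere_volume ?n) = (\<integral>\<^sup>+\<theta>. \<phi> (r\<^sup>2) * indicator A \<theta> \<partial>sphere_volume ?n)" if r: "0 < r"
    proof (rule nn_integral_cong_AE)
      show "AE \<theta> in sphere_volume ?n. \<phi> (sqnorm ?n (\<lambda>i\<in>{..<?n}. r * \<theta> i)) *
          indicator A (direction ?n (\<lambda>i\<in>{..<?n}. r * \<theta> i)) = \<phi> (r\<^sup>2) * indicator A \<theta>"
        using AE_sphere_volume
      proof eventually_elim
        case (elim \<theta>)
        then have \<theta>: "\<theta> \<in> Rn ?n" "sqnorm ?n \<theta> = 1" by (auto simp: ellipsoid_unit)
        have "sqnorm ?n (\<lambda>i\<in>{..<?n}. r * \<theta> i) = r\<^sup>2 * sqnorm ?n \<theta>"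
          unfolding sqnorm_def sum_distrib_left by (intro sum.cong) (auto simp: power_mult_distrib)
        with \<theta> direction_scale[OF \<theta> r] show ?case by simp
      qed
    qed
    also have "(\<integral>\<^sup>+\<theta>. \<phi> (r\<^sup>2) * indicator A \<theta> \<partial>sphere_volume ?n) = \<phi> (r\<^sup>2) * emeasure (sphere_volume ?n) A"
      by (rule nn_integral_cmult_indicator) simp
    finally show "ennreal (r ^ m) * indicator {0<..} r *
      (\<integral>\<^sup>+\<theta>. \<phi> (sqnorm ?n (\<lambda>i\<in>{..<?n}. r * \<theta> i)) * indicator A (direction ?n (\<lambda>i\<in>{..<?n}. r * \<theta> i))
        \<partial>sphere_volume ?n) = (ennreal (r ^ m) * indicator {0<..} r * \<phi> (r\<^sup>2)) * emeasure (sphere_volume ?n) A"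
      by (cases "0 < r") (simp_all add: mult.assoc)
  qed
  also have "\<dots> = (\<integral>\<^sup>+r. ennreal (r ^ m) * indicator {0<..} r * \<phi> (r\<^sup>2) \<partial>lborel) * emeasure (sphere_volume ?n) A"
    by (rule nn_integral_multc) measurable
  finally show ?thesis by (simp add: \<phi>_def)
qed

text \<open>
  Taking the whole space in the factorised formula, the total volume times the radial integral is the
  total Gaussian mass \<open>1\<close>. Hence both factors are finite and nonzero, without computing either of
  them, and the radial integral is the normalising constant.
\<close>

lemma sphere_volume_finite_nonzero:
  "emeasure (sphere_volume (Suc m)) (Rn (Suc m)) \<noteq> 0 \<and> emeasure (sphere_volume (Suc m)) (Rn (Suc m)) \<noteq> \<infinity>"
  and sphere_measure_eq_gauss_direction:
  "sphere_measure (Suc m) = distr (Pi\<^sub>M {..<Suc m} (\<lambda>_. std_gauss)) (borel_Rn (Suc m)) (direction (Suc m))"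
proof -
  let ?n = "Suc m"
  define C where "C = (\<integral>\<^sup>+r. ennreal (r ^ m) * indicator {0<..} r *
        ennreal ((1 / sqrt (2 * pi)) ^ Suc m * exp (- r\<^sup>2 / 2)) \<partial>lborel)"
  let ?S = "sphere_volume ?n" and ?D = "distr (Pi\<^sub>M {..<?n} (\<lambda>_. std_gauss)) (borel_Rn ?n) (direction ?n)"
  have eq: "emeasure ?D A = C * emeasure ?S A" if "A \<in> sets (borel_Rn ?n)" for A
    unfolding C_def by (rule emeasure_gauss_direction[OF that])
  interpret G: prob_space "Pi\<^sub>M {..<?n} (\<lambda>_. std_gauss)" by (rule prob_space_PiM) (rule prob_space_std_gauss)
  interpret D: prob_space ?D 
    using measurable_direction[of ?n "{..<?n}"] by (intro G.prob_space_distr) (simp cong: measurable_cong_sets)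
  have Rn: "Rn ?n \<in> sets (borel_Rn ?n)" using sets.top[of "borel_Rn ?n"] by (simp add: space_borel_Rn)
  have one: "C * emeasure ?S (Rn ?n) = 1"
    using eq[OF Rn] D.emeasure_space_1 by (simp add: space_PiM)
  then show "emeasure ?S (Rn ?n) \<noteq> 0 \<and> emeasure ?S (Rn ?n) \<noteq> \<infinity>"
    by (auto simp: ennreal_mult_top split: if_splits)
  then have inv: "C = inverse (emeasure ?S (Rn ?n))"
    using one by (metis ennreal_divide_self divide_ennreal_def mult.commute mult.assoc mult.right_neutral top.not_eq_extremum infinity_ennreal_def)
  have E: "emeasure ?S (ellipsoid ?n (\<lambda>_. 1) \<inter> A) = emeasure ?S A" if "A \<in> sets (borel_Rn ?n)" for A
    using that AE_sphere_volume[of m] by (intro emeasure_eq_AE) auto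
  have "Rn ?n \<inter> ellipsoid ?n (\<lambda>_. 1) = ellipsoid ?n (\<lambda>_. 1)" by (auto simp: ellipsoid_def)
  then have E1: "emeasure ?S (ellipsoid ?n (\<lambda>_. 1)) = emeasure ?S (Rn ?n)"
    using E[OF Rn] by (simp add: Int_commute)
  show "sphere_measure ?n = ?D"
  proof (rule measure_eqI)
    fix A assume "A \<in> sets (sphere_measure ?n)"
    then have A: "A \<in> sets (borel_Rn ?n)" by (simp add: sphere_measure_def)
    show "emeasure (sphere_measure ?n) A = emeasure ?D A"
      unfolding sphere_measure_def eq[OF A] inv
      using A by (subst emeasure_uniform_measure)
        (auto simp: E E1 divide_ennreal_def mult.commute)
  qed (simp add: sphere_measure_def)
qed

section \<open>A probability space carrying all the ellipsoids\<close>

definition unif01 :: "real measure" where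
  "unif01 = density lborel (indicator {0..1})"

definition model_space :: "((nat \<Rightarrow> real) \<times> real) measure" where
  "model_space = gauss_seq \<Otimes>\<^sub>M unif01"

definition ellipsoid_point :: "nat \<Rightarrow> (nat \<Rightarrow> real) \<Rightarrow> real \<Rightarrow> (nat \<Rightarrow> real) \<Rightarrow> nat \<Rightarrow> real" where
  "ellipsoid_point n \<alpha> t x = (\<lambda>i\<in>{..<n}. t * (\<alpha> i * direction n x i))"

text \<open>
  The radius \<open>u\<^bsup>1/n\<^esup>\<close>, clamped so that it lies in \<open>[0, 1]\<close> also for the \<open>u\<close> outside of the support
  of \<open>unif01\<close>.
\<close>

definition clamped_root :: "nat \<Rightarrow> real \<Rightarrow> real" where
  "clamped_root n u = root n (max 0 (min 1 u))"

lemma sets_unif01 [simp, measurable_cong]: "sets unif01 = sets borel"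
  by (simp add: unif01_def)

lemma prob_space_unif01: "prob_space unif01"
  by (rule prob_spaceI) (simp add: unif01_def emeasure_density)

interpretation unif01: prob_space unif01
  by (rule prob_space_unif01)

interpretation gauss_unif: pair_prob_space gauss_seq unif01 ..

interpretation model_space: prob_space model_space
  unfolding model_space_def by (rule gauss_unif.prob_space_axioms)

lemma sets_model_space [simp, measurable_cong]:
  "sets model_space = sets (Pi\<^sub>M UNIV (\<lambda>_. borel) \<Otimes>\<^sub>M borel)"
  unfolding model_space_def by (intro sets_pair_measure_cong) auto

lemma nn_integral_model_space:
  assumes "f \<in> borel_measurable (Pi\<^sub>M UNIV (\<lambda>_. borel) \<Otimes>\<^sub>M borel)"
  shows "integral\<^sup>N model_space f = (\<integral>\<^sup>+x. \<integral>\<^sup>+u. f (x, u) \<partial>unif01 \<partial>gauss_seq)"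
    and "integral\<^sup>N model_space f = (\<integral>\<^sup>+u. \<integral>\<^sup>+x. f (x, u) \<partial>gauss_seq \<partial>unif01)"
proof -
  have f: "f \<in> borel_measurable (gauss_seq \<Otimes>\<^sub>M unif01)"
    using assms sets_model_space by (simp add: model_space_def cong: measurable_cong_sets)
  show "integral\<^sup>N model_space f = (\<integral>\<^sup>+x. \<integral>\<^sup>+u. f (x, u) \<partial>unif01 \<partial>gauss_seq)"
    unfolding model_space_def by (rule unif01.nn_integral_fst[symmetric, OF f])
  show "integral\<^sup>N model_space f = (\<integral>\<^sup>+u. \<integral>\<^sup>+x. f (x, u) \<partial>gauss_seq \<partial>unif01)"
    unfolding model_space_def by (rule gauss_unif.nn_integral_snd[symmetric, OF f])
qed

lemma measurable_direction_seq [measurable]: "direction n \<in> Pi\<^sub>M UNIV (\<lambda>_. borel) \<rightarrow>\<^sub>M borel_Rn n"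
  by (rule measurable_direction) simp

lemma measurable_direction_Rn [measurable]: "direction n \<in> borel_Rn n \<rightarrow>\<^sub>M borel_Rn n"
  by (rule measurable_direction) simp

lemma measurable_ellipsoid_point_pair [measurable]:
  "(\<lambda>(x, t). ellipsoid_point n \<alpha> t x) \<in> Pi\<^sub>M UNIV (\<lambda>_. borel) \<Otimes>\<^sub>M borel \<rightarrow>\<^sub>M borel_Rn n"
  unfolding ellipsoid_point_def split_def
proof (rule measurable_restrict)
  fix i assume [measurable]: "i \<in> {..<n}"
  have [measurable]: "(\<lambda>x. direction n x i) \<in> borel_measurable (Pi\<^sub>M UNIV (\<lambda>_. borel))"
    by (rule measurable_compose[OF measurable_direction_seq]) (rule measurable_component_singleton, fact)
  show "(\<lambda>p. snd p * (\<alpha> i * direction n (fst p) i)) \<in> borel_measurable (Pi\<^sub>M UNIV (\<lambda>_. borel) \<Otimes>\<^sub>M borel)"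
    by measurable
qed

lemma measurable_ellipsoid_point [measurable (raw)]:
  assumes "f \<in> M \<rightarrow>\<^sub>M Pi\<^sub>M UNIV (\<lambda>_. borel)" "t \<in> borel_measurable M"
  shows "(\<lambda>w. ellipsoid_point n \<alpha> (t w) (f w)) \<in> M \<rightarrow>\<^sub>M borel_Rn n"
  using measurable_compose[OF measurable_Pair[OF assms] measurable_ellipsoid_point_pair[of n \<alpha>]] by simp

lemma measurable_clamped_root [measurable]: "clamped_root n \<in> borel_measurable borel"
  unfolding clamped_root_def
  by (intro borel_measurable_continuous_onI continuous_intros)

lemma clamped_root_bounds: "0 \<le> clamped_root n u" "clamped_root n u \<le> 1"
  by (cases "n = 0"; simp add: clamped_root_def)+

lemma sphere_measure_eq_gauss_seq:
  assumes "0 < n"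
  shows "sphere_measure n = distr gauss_seq (borel_Rn n) (direction n)"
proof -
  obtain m where n: "n = Suc m" using assms by (cases n) auto
  have "sphere_measure n = distr (Pi\<^sub>M {..<n} (\<lambda>_. std_gauss)) (borel_Rn n) (direction n)"
    unfolding n by (rule sphere_measure_eq_gauss_direction)
  also have "Pi\<^sub>M {..<n} (\<lambda>_. std_gauss)
      = distr gauss_seq (Pi\<^sub>M {..<n} (\<lambda>_. std_gauss)) (\<lambda>x. restrict x {..<n})"
    by (rule gauss_prod.distr_PiM_restrict_finite[symmetric]) auto
  also have "distr \<dots> (borel_Rn n) (direction n) = distr gauss_seq (borel_Rn n) (direction n \<circ> (\<lambda>x. restrict x {..<n}))"
    by (rule distr_distr) measurable
  also have "direction n \<circ> (\<lambda>x. restrict x {..<n}) = direction n"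
    by (auto simp: fun_eq_iff direction_def sqnorm_def)
  finally show ?thesis .
qed

lemma ellipsoid_measure_eq_model:
  assumes "0 < n"
  shows "ellipsoid_measure n \<alpha> = distr model_space (borel_Rn n) (\<lambda>(x, u). ellipsoid_point n \<alpha> 1 x)"
proof -
  have "distr model_space (borel_Rn n) (\<lambda>(x, u). ellipsoid_point n \<alpha> 1 x)
      = distr (distr model_space gauss_seq fst) (borel_Rn n) (\<lambda>x. \<lambda>i\<in>{..<n}. \<alpha> i * direction n x i)"
    by (subst distr_distr) (auto simp: ellipsoid_point_def split_def comp_def)
  also have "distr model_space gauss_seq fst = gauss_seq"
    unfolding model_space_def by (rule unif01.distr_pair_fst)
  also have "distr gauss_seq (borel_Rn n) (\<lambda>x. \<lambda>i\<in>{..<n}. \<alpha> i * direction n x i) = ellipsoid_measure n \<alpha>"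
    unfolding ellipsoid_measure_def sphere_measure_eq_gauss_seq[OF assms]
    by (subst distr_distr) (auto simp: comp_def)
  finally show ?thesis ..
qed

text \<open>
  The radius of a uniform point of the unit ball in dimension \<open>m + 1\<close> has density \<open>(m + 1) r\<^sup>m\<close>, and
  this is the distribution of \<open>u\<^bsup>1/(m+1)\<^esup>\<close>.
\<close>

lemma nn_integral_root_substitution:
  fixes K :: "real \<Rightarrow> ennreal"
  assumes K [measurable]: "K \<in> borel_measurable borel"
  shows "ennreal (real (Suc m)) * (\<integral>\<^sup>+r. ennreal (r ^ m) * K r * indicator {0..1} r \<partial>lborel)
    = (\<integral>\<^sup>+u. K (clamped_root (Suc m) u) \<partial>unif01)"
proof -
  let ?n = "Suc m"
  have "(\<integral>\<^sup>+u. K (clamped_root ?n u) \<partial>unif01)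
      = (\<integral>\<^sup>+u. K (clamped_root ?n u) * indicator {0 ^ ?n..1 ^ ?n} u \<partial>lborel)"
    unfolding unif01_def by (subst nn_integral_density) (auto simp: mult.commute)
  also have "\<dots> = (\<integral>\<^sup>+r. K (clamped_root ?n (r ^ ?n)) * ennreal (real ?n * r ^ m) * indicator {0..1} r \<partial>lborel)"
  proof (rule nn_integral_substitution_aux)
    fix r :: real
    show "((\<lambda>r. r ^ ?n) has_real_derivative real ?n * r ^ m) (at r)"
      using DERIV_pow[of ?n r] by simp
  qed (auto intro!: continuous_intros)
  also have "\<dots> = (\<integral>\<^sup>+r. ennreal (real ?n) * (ennreal (r ^ m) * K r * indicator {0..1} r) \<partial>lborel)"
  proof (rule nn_integral_cong)
    fix r :: real
    show "K (clamped_root ?n (r ^ ?n)) * ennreal (real ?n * r ^ m) * indicator {0..1} r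
      = ennreal (real ?n) * (ennreal (r ^ m) * K r * indicator {0..1} r)"
    proof (cases "r \<in> {0..1}")
      case True
      then have "clamped_root ?n (r ^ ?n) = r"
        unfolding clamped_root_def using power_le_one[of r ?n]
        by (simp add: max_def min_def real_root_power_cancel del: power_Suc)
      then show ?thesis
        using True by (simp add: ennreal_mult' ac_simps del: power_Suc of_nat_Suc)
    qed simp
  qed
  also have "\<dots> = ennreal (real ?n) * (\<integral>\<^sup>+r. ennreal (r ^ m) * K r * indicator {0..1} r \<partial>lborel)"
    by (rule nn_integral_cmult) measurable
  finally show ?thesis ..
qed

text \<open>
  The axes are scaled back to the unit ball, where polar coordinates separate the radius from the
  direction. The factors in front are kept symbolic: only the ratio of two such volumes
  is needed.
\<close>

lemma emeasure_solid_ellipsoid_Int: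
  assumes \<alpha>: "\<And>i. i < Suc m \<Longrightarrow> 0 < \<alpha> i" and A [measurable]: "A \<in> sets (borel_Rn (Suc m))"
  shows "ennreal (real (Suc m)) * emeasure (lborel_Rn (Suc m)) (solid_ellipsoid (Suc m) \<alpha> \<inter> A)
    = ennreal (\<Prod>i<Suc m. \<alpha> i) * emeasure (sphere_volume (Suc m)) (Rn (Suc m)) *
      emeasure (distr model_space (borel_Rn (Suc m))
        (\<lambda>(x, u). ellipsoid_point (Suc m) \<alpha> (clamped_root (Suc m) u) x)) A"
proof -
  let ?n = "Suc m"
  let ?V = "emeasure (sphere_volume ?n) (Rn ?n)"
  have V: "?V \<noteq> 0" "?V \<noteq> \<infinity>" using sphere_volume_finite_nonzero by auto
  (* The probability that the stretched random direction of length r falls into A. *)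
  define K where "K r = (\<integral>\<^sup>+x. indicator A (ellipsoid_point ?n \<alpha> r x) \<partial>gauss_seq)" for r
  have [measurable]: "(\<lambda>(r, x). ellipsoid_point ?n \<alpha> r x) \<in> borel \<Otimes>\<^sub>M gauss_seq \<rightarrow>\<^sub>M borel_Rn ?n"
    using measurable_comp[OF measurable_pair_swap' measurable_ellipsoid_point_pair[of ?n \<alpha>]]
    by (simp add: comp_def split_def cong: measurable_cong_sets sets_pair_measure_cong)
  have [measurable]: "K \<in> borel_measurable borel"
    unfolding K_def by measurable
  have K_sphere: "(\<integral>\<^sup>+\<theta>. indicator A (\<lambda>i\<in>{..<?n}. r * (\<alpha> i * \<theta> i)) \<partial>sphere_volume ?n) = ?V * K r" for r
  proof -
    have [measurable]: "(\<lambda>\<theta>. \<lambda>i\<in>{..<?n}. r * (\<alpha> i * \<theta> i)) \<in> borel_Rn ?n \<rightarrow>\<^sub>M borel_Rn ?n" by measurable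
    have "K r = (\<integral>\<^sup>+\<theta>. indicator A (\<lambda>i\<in>{..<?n}. r * (\<alpha> i * \<theta> i)) \<partial>sphere_measure ?n)"
      unfolding sphere_measure_eq_gauss_seq[OF zero_less_Suc]
      by (subst nn_integral_distr) (simp_all add: K_def ellipsoid_point_def cong: restrict_cong)
    also have "\<dots> = (\<integral>\<^sup>+\<theta>. indicator A (\<lambda>i\<in>{..<?n}. r * (\<alpha> i * \<theta> i)) *
        indicator (ellipsoid ?n (\<lambda>_. 1)) \<theta> \<partial>sphere_volume ?n)
        / emeasure (sphere_volume ?n) (ellipsoid ?n (\<lambda>_. 1))"
      unfolding sphere_measure_def by (rule nn_integral_uniform_measure) measurable
    also have "emeasure (sphere_volume ?n) (ellipsoid ?n (\<lambda>_. 1)) = ?V"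
      using AE_sphere_volume[of m] sets.top[of "sphere_volume ?n"]
      by (intro emeasure_eq_AE) (auto simp: space_sphere_volume ellipsoid_def)
    also have "(\<integral>\<^sup>+\<theta>. indicator A (\<lambda>i\<in>{..<?n}. r * (\<alpha> i * \<theta> i)) *
        indicator (ellipsoid ?n (\<lambda>_. 1)) \<theta> \<partial>sphere_volume ?n)
      = (\<integral>\<^sup>+\<theta>. indicator A (\<lambda>i\<in>{..<?n}. r * (\<alpha> i * \<theta> i)) \<partial>sphere_volume ?n)"
      using AE_sphere_volume[of m] by (intro nn_integral_cong_AE) (auto simp: indicator_def)
    finally have "?V * K r
        = (\<integral>\<^sup>+\<theta>. indicator A (\<lambda>i\<in>{..<?n}. r * (\<alpha> i * \<theta> i)) \<partial>sphere_volume ?n) * ?V / ?V"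
      by (simp only: ennreal_times_divide mult.commute[of ?V])
    then show ?thesis
      using V by (simp add: mult_divide_eq_ennreal)
  qed
  have scale: "(\<lambda>i\<in>{..<?n}. \<alpha> i * x i) \<in> solid_ellipsoid ?n \<alpha> \<longleftrightarrow> sqnorm ?n x \<le> 1" for x
  proof -
    have "(\<Sum>i<?n. ((\<lambda>i\<in>{..<?n}. \<alpha> i * x i) i)\<^sup>2 / (\<alpha> i)\<^sup>2) = sqnorm ?n x"
      unfolding sqnorm_def
    proof (rule sum.cong)
      fix i assume "i \<in> {..<?n}"
      then show "((\<lambda>i\<in>{..<?n}. \<alpha> i * x i) i)\<^sup>2 / (\<alpha> i)\<^sup>2 = (x i)\<^sup>2"
        using \<alpha>[of i] by (simp add: power_mult_distrib)
    qed simp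
    then show ?thesis by (simp add: solid_ellipsoid_def del: sum.lessThan_Suc)
  qed
  have [measurable]: "sqnorm ?n \<in> borel_measurable (borel_Rn ?n)" by (rule measurable_sqnorm) simp
  have "emeasure (lborel_Rn ?n) (solid_ellipsoid ?n \<alpha> \<inter> A)
      = (\<integral>\<^sup>+x. indicator (solid_ellipsoid ?n \<alpha> \<inter> A) x \<partial>lborel_Rn ?n)" by simp
  also have "\<dots> = ennreal (\<Prod>i<?n. \<alpha> i) *
      (\<integral>\<^sup>+x. indicator (solid_ellipsoid ?n \<alpha> \<inter> A) (\<lambda>i\<in>{..<?n}. \<alpha> i * x i) \<partial>lborel_Rn ?n)"
    by (rule nn_integral_lborel_Rn_scale) (measurable, rule \<alpha>)
  also have "(\<integral>\<^sup>+x. indicator (solid_ellipsoid ?n \<alpha> \<inter> A) (\<lambda>i\<in>{..<?n}. \<alpha> i * x i) \<partial>lborel_Rn ?n)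
      = (\<integral>\<^sup>+x. indicator {..1} (sqnorm ?n x) * indicator A (\<lambda>i\<in>{..<?n}. \<alpha> i * x i) \<partial>lborel_Rn ?n)"
    by (intro nn_integral_cong) (simp add: indicator_def scale)
  also have "\<dots> = (\<integral>\<^sup>+r. ennreal (r ^ m) * indicator {0<..} r *
      (\<integral>\<^sup>+\<theta>. indicator {..1} (sqnorm ?n (\<lambda>i\<in>{..<?n}. r * \<theta> i)) *
        indicator A (\<lambda>i\<in>{..<?n}. \<alpha> i * (\<lambda>i\<in>{..<?n}. r * \<theta> i) i) \<partial>sphere_volume ?n) \<partial>lborel)"
    by (rule polar_coordinates) measurable
  also have "\<dots> = (\<integral>\<^sup>+r. ?V * (ennreal (r ^ m) * K r * indicator {0..1} r) \<partial>lborel)"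
  proof (rule nn_integral_cong_AE)
    show "AE r in lborel. ennreal (r ^ m) * indicator {0<..} r *
      (\<integral>\<^sup>+\<theta>. indicator {..1} (sqnorm ?n (\<lambda>i\<in>{..<?n}. r * \<theta> i)) *
        indicator A (\<lambda>i\<in>{..<?n}. \<alpha> i * (\<lambda>i\<in>{..<?n}. r * \<theta> i) i) \<partial>sphere_volume ?n)
      = ?V * (ennreal (r ^ m) * K r * indicator {0..1} r)"
      using AE_lborel_singleton[of 0]
    proof eventually_elim
      case (elim r)
      have "(\<integral>\<^sup>+\<theta>. indicator {..1} (sqnorm ?n (\<lambda>i\<in>{..<?n}. r * \<theta> i)) *
          indicator A (\<lambda>i\<in>{..<?n}. \<alpha> i * (\<lambda>i\<in>{..<?n}. r * \<theta> i) i) \<partial>sphere_volume ?n)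
        = (\<integral>\<^sup>+\<theta>. indicator {..1} r * indicator A (\<lambda>i\<in>{..<?n}. r * (\<alpha> i * \<theta> i)) \<partial>sphere_volume ?n)"
        if r: "0 < r"
      proof (rule nn_integral_cong_AE)
        show "AE \<theta> in sphere_volume ?n. indicator {..1} (sqnorm ?n (\<lambda>i\<in>{..<?n}. r * \<theta> i)) *
          indicator A (\<lambda>i\<in>{..<?n}. \<alpha> i * (\<lambda>i\<in>{..<?n}. r * \<theta> i) i)
          = (indicator {..1} r * indicator A (\<lambda>i\<in>{..<?n}. r * (\<alpha> i * \<theta> i)) :: ennreal)"
          using AE_sphere_volume
        proof eventually_elim
          case (elim \<theta>)
          then have \<theta>: "sqnorm ?n \<theta> = 1" by (auto simp: ellipsoid_unit)
          have "sqnorm ?n (\<lambda>i\<in>{..<?n}. r * \<theta> i) = r\<^sup>2 * sqnorm ?n \<theta>"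
            unfolding sqnorm_def sum_distrib_left by (intro sum.cong) (auto simp: power_mult_distrib)
          moreover have "r\<^sup>2 \<le> 1 \<longleftrightarrow> r \<le> 1" using r by (simp add: power2_le_iff_abs_le abs_square_le_1)
          moreover have "(\<lambda>i\<in>{..<?n}. \<alpha> i * (\<lambda>i\<in>{..<?n}. r * \<theta> i) i) = (\<lambda>i\<in>{..<?n}. r * (\<alpha> i * \<theta> i))"
            by (auto simp: fun_eq_iff restrict_def)
          ultimately show ?case using \<theta> by (simp add: indicator_def)
        qed
      qed
      also have "(\<integral>\<^sup>+\<theta>. indicator {..1} r * indicator A (\<lambda>i\<in>{..<?n}. r * (\<alpha> i * \<theta> i)) \<partial>sphere_volume ?n)
          = indicator {..1} r * (?V * K r)"
        unfolding K_sphere[symmetric] by (rule nn_integral_cmult) measurable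
      finally show ?case
        using elim by (cases "0 < r") (auto simp: indicator_def ac_simps)
    qed
  qed
  also have "\<dots> = ?V * (\<integral>\<^sup>+r. ennreal (r ^ m) * K r * indicator {0..1} r \<partial>lborel)"
    by (rule nn_integral_cmult) measurable
  finally have "ennreal (real ?n) * emeasure (lborel_Rn ?n) (solid_ellipsoid ?n \<alpha> \<inter> A)
      = ennreal (\<Prod>i<?n. \<alpha> i) * ?V *
        (ennreal (real ?n) * (\<integral>\<^sup>+r. ennreal (r ^ m) * K r * indicator {0..1} r \<partial>lborel))"
    by (simp only: ac_simps)
  also have "ennreal (real ?n) * (\<integral>\<^sup>+r. ennreal (r ^ m) * K r * indicator {0..1} r \<partial>lborel)
      = (\<integral>\<^sup>+u. K (clamped_root ?n u) \<partial>unif01)"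
    by (rule nn_integral_root_substitution) measurable
  also have "\<dots> = (\<integral>\<^sup>+p. indicator A (case p of (x, u) \<Rightarrow> ellipsoid_point ?n \<alpha> (clamped_root ?n u) x) \<partial>model_space)"
    unfolding K_def split_beta by (subst nn_integral_model_space(2)) simp_all
  also have "\<dots> = emeasure (distr model_space (borel_Rn ?n)
        (\<lambda>(x, u). ellipsoid_point ?n \<alpha> (clamped_root ?n u) x)) A"
    by (subst nn_integral_indicator[symmetric], simp, subst nn_integral_distr) simp_all
  finally show ?thesis .
qed

lemma solid_ellipsoid_measure_eq_model:
  assumes n: "0 < n" and \<alpha>: "\<And>i. i < n \<Longrightarrow> 0 < \<alpha> i"
  shows "solid_ellipsoid_measure n \<alpha>
    = distr model_space (borel_Rn n) (\<lambda>(x, u). ellipsoid_point n \<alpha> (clamped_root n u) x)"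
    (is "_ = ?D")
proof (rule measure_eqI)
  obtain m where nm: "n = Suc m" using n by (cases n) auto
  define c where "c = ennreal (\<Prod>i<n. \<alpha> i) * emeasure (sphere_volume n) (Rn n)"
  define v where "v A = emeasure (lborel_Rn n) (solid_ellipsoid n \<alpha> \<inter> A)" for A
  have "0 < (\<Prod>i<n. \<alpha> i)" using \<alpha> by (intro prod_pos) auto
  then have c: "c \<noteq> 0" "c \<noteq> \<infinity>"
    using sphere_volume_finite_nonzero[of m]
    unfolding c_def nm[symmetric] by (auto simp: ennreal_mult_eq_top_iff simp del: prod_zero_iff)
  have eq: "ennreal (real n) * v A = c * emeasure ?D A" if "A \<in> sets (borel_Rn n)" for A
    unfolding v_def c_def nm using that \<alpha> nm by (intro emeasure_solid_ellipsoid_Int) auto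
  interpret D: prob_space ?D by (rule model_space.prob_space_distr) measurable
  have tot: "ennreal (real n) * v (Rn n) = c"
    using eq[of "Rn n"] D.emeasure_space_1 sets.top[of "borel_Rn n"] by (simp add: space_PiM)
  have S: "solid_ellipsoid n \<alpha> \<inter> Rn n = solid_ellipsoid n \<alpha>" by (auto simp: solid_ellipsoid_def)
  fix A assume "A \<in> sets (solid_ellipsoid_measure n \<alpha>)"
  then have A [measurable]: "A \<in> sets (borel_Rn n)" by (simp add: solid_ellipsoid_measure_def)
  have "emeasure (solid_ellipsoid_measure n \<alpha>) A = v A / v (Rn n)"
    by (simp add: solid_ellipsoid_measure_def v_def S)
  also have "ennreal (real n) * v A = ennreal (real n) * (emeasure ?D A * v (Rn n))"
    unfolding eq[OF A] tot[symmetric] by (simp only: ac_simps)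
  then have "v A = emeasure ?D A * v (Rn n)"
    using n by (simp add: ennreal_mult_cancel_left)
  also have "\<dots> / v (Rn n) = emeasure ?D A"
    using c tot by (intro mult_divide_eq_ennreal) (auto simp: ennreal_mult_eq_top_iff)
  finally show "emeasure (solid_ellipsoid_measure n \<alpha>) A = emeasure ?D A" .
qed (simp add: solid_ellipsoid_measure_def)

section \<open>The Hilbert space as a measurable space\<close>

lemma continuous_on_coord: "continuous_on UNIV (\<lambda>x. coord x i)"
proof (rule continuous_onI)
  fix x :: l2 and e :: real assume "0 < e"
  have "dist (coord y i) (coord x i) \<le> dist y x" for y
    using abs_coord_le[of "y - x" i] by (simp add: coord_simps dist_norm)
  with \<open>0 < e\<close> show "\<exists>d>0. \<forall>y\<in>UNIV. dist y x < d \<longrightarrow> dist (coord y i) (coord x i) \<le> e"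
    by (meson less_imp_le order_trans)
qed

text \<open>
  By separability (in the form of the Lindeloef property) open sets are countable unions of balls,
  and the distance to a fixed point is a measurable function of the coordinates.
\<close>

lemma measurable_l2I:
  fixes f :: "'a \<Rightarrow> l2"
  assumes [measurable]: "\<And>i. (\<lambda>w. coord (f w) i) \<in> borel_measurable M"
  shows "f \<in> borel_measurable M"
proof (rule borel_measurableI)
  fix S :: "l2 set" assume "open S"
  define F where "F = {ball x e | x e. ball x e \<subseteq> S}"
  have "\<Union>F = S"
    using \<open>open S\<close> unfolding F_def by (auto simp: open_contains_ball) (metis centre_in_ball)
  moreover obtain F' where F': "F' \<subseteq> F" "countable F'" "\<Union>F' = \<Union>F"
    using Lindelof[of F] by (auto simp: F_def)
  ultimately have "\<Union>F' = S" by simp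
  then have S: "f -` S \<inter> space M = (\<Union>B\<in>F'. f -` B \<inter> space M)" by auto
  have "f -` ball x e \<inter> space M \<in> sets M" for x e
  proof -
    have d: "dist x y = sqrt (\<Sum>i. (coord x i - coord y i)\<^sup>2)" for y
      using norm_l2_sq[of "x - y"] by (simp add: dist_norm coord_simps real_sqrt_unique)
    have "(\<lambda>w. dist x (f w)) \<in> borel_measurable M" unfolding d by measurable
    then have "{w \<in> space M. dist x (f w) < e} \<in> sets M" by measurable
    also have "{w \<in> space M. dist x (f w) < e} = f -` ball x e \<inter> space M" by auto
    finally show ?thesis .
  qed
  then show "f -` S \<inter> space M \<in> sets M"
    unfolding S using F' by (intro sets.countable_UN'') (auto simp: F_def)
qed

lemma measurable_embed [measurable]: "embed n \<in> borel_Rn n \<rightarrow>\<^sub>M borel"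
proof (rule measurable_l2I)
  fix i show "(\<lambda>x. coord (embed n x) i) \<in> borel_measurable (borel_Rn n)"
    by (cases "i < n") (simp_all add: coord_embed measurable_component_singleton)
qed

lemma measurable_summable [measurable (raw)]:
  fixes f :: "nat \<Rightarrow> 'a \<Rightarrow> real"
  assumes [measurable]: "\<And>i. f i \<in> borel_measurable M"
  shows "Measurable.pred M (\<lambda>x. summable (\<lambda>i. f i x))"
  unfolding summable_iff_convergent Cauchy_convergent_iff[symmetric] pred_def
  by (intro sets_Collect_Cauchy) measurable

section \<open>The Gaussian measure on the Hilbert space\<close>

text \<open>
  The default value outside of the square-summable sequences only affects a null set
  (\<open>AE_gauss_summable\<close>).
\<close>

definition gauss_point :: "(nat \<Rightarrow> real) \<Rightarrow> (nat \<Rightarrow> real) \<Rightarrow> l2" where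
  "gauss_point a x = (if summable (\<lambda>i. (a i * x i)\<^sup>2) then Abs_l2 (\<lambda>i. a i * x i) else 0)"

lemma coord_gauss_point:
  "coord (gauss_point a x) i = (if summable (\<lambda>i. (a i * x i)\<^sup>2) then a i * x i else 0)"
  by (simp add: gauss_point_def Abs_l2_inverse coord_zero)

lemma measurable_gauss_point [measurable]: "gauss_point a \<in> Pi\<^sub>M UNIV (\<lambda>_. borel) \<rightarrow>\<^sub>M borel"
  by (rule measurable_l2I) (unfold coord_gauss_point, measurable)

lemma distr_gauss_coordinate: "distr gauss_seq borel (\<lambda>x. x i) = std_gauss"
proof -
  have "distr gauss_seq borel (\<lambda>x. x i) = distr gauss_seq std_gauss (\<lambda>x. x i)"
    by (rule distr_cong) simp_all
  then show ?thesis using gauss_prod.PiM_component[of i] by simp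
qed

lemma nn_integral_gauss_coordinate:
  assumes [measurable]: "f \<in> borel_measurable borel"
  shows "(\<integral>\<^sup>+x. f (x i) \<partial>gauss_seq) = (\<integral>\<^sup>+y. f y \<partial>std_gauss)"
  by (subst distr_gauss_coordinate[of i, symmetric], subst nn_integral_distr) simp_all

lemma has_bochner_integral_std_gauss:
  assumes [measurable]: "f \<in> borel_measurable borel"
    and f: "has_bochner_integral lborel (\<lambda>x. std_normal_density x * f x) c"
  shows "has_bochner_integral std_gauss (f :: real \<Rightarrow> real) c"
  unfolding std_gauss_def using f
  by (intro has_bochner_integral_density) (auto simp: normal_density_nonneg)

lemma std_gauss_moment2: "has_bochner_integral std_gauss (\<lambda>y. y\<^sup>2) 1"
  by (rule has_bochner_integral_std_gauss) (use std_normal_moment_even[of 1] in simp_all)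

lemma std_gauss_moment4: "has_bochner_integral std_gauss (\<lambda>y. y ^ 4) 3"
  by (rule has_bochner_integral_std_gauss)
    (use std_normal_moment_even[of 2] in \<open>simp_all add: fact_numeral\<close>)

lemma nn_integral_gauss_square: "(\<integral>\<^sup>+x. ennreal ((x i)\<^sup>2) \<partial>gauss_seq) = 1"
proof -
  have "(\<integral>\<^sup>+x. ennreal ((x i)\<^sup>2) \<partial>gauss_seq) = (\<integral>\<^sup>+y. ennreal (y\<^sup>2) \<partial>std_gauss)"
    by (rule nn_integral_gauss_coordinate) simp
  also have "\<dots> = 1"
    using std_gauss_moment2 by (subst nn_integral_eq_integral) (auto simp: has_bochner_integral_iff)
  finally show ?thesis .
qed

lemma gauss1_scaled: "0 \<le> c \<Longrightarrow> gauss1 (c\<^sup>2) = distr std_gauss borel (\<lambda>y. c * y)"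
proof (cases "c = 0")
  case True
  then show ?thesis
    by (auto simp: gauss1_def std_gauss.distr_const)
next
  case False
  assume "0 \<le> c"
  have "distributed std_gauss lborel (\<lambda>y. y) std_normal_density"
    by (simp add: distributed_def std_gauss_def distr_id2 sets_density)
  from std_gauss.normal_density_affine[OF this, of c 0] False
  have "distributed std_gauss lborel (\<lambda>y. c * y) (normal_density 0 \<bar>c\<bar>)" by simp
  then have "distr std_gauss lborel (\<lambda>y. c * y) = density lborel (normal_density 0 \<bar>c\<bar>)"
    by (rule distributed_distr_eq_density)
  moreover have "distr std_gauss lborel (\<lambda>y. c * y) = distr std_gauss borel (\<lambda>y. c * y)"
    by (rule distr_cong) simp_all
  ultimately show ?thesis
    using False by (simp add: gauss1_def)
qed

lemma prob_space_gauss1: "prob_space (gauss1 v)" if "0 \<le> v"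
  using that by (auto simp: gauss1_def prob_space_return intro!: prob_space_normal_density)

lemma sets_gauss1 [simp, measurable_cong]: "sets (gauss1 v) = sets borel"
  by (simp add: gauss1_def)

lemma space_gauss1 [simp]: "space (gauss1 v) = UNIV"
  using sets_eq_imp_space_eq[OF sets_gauss1] by simp

lemma PiM_gauss1_scaled:
  assumes a: "\<And>i. 0 \<le> a i"
  shows "Pi\<^sub>M UNIV (\<lambda>i. gauss1 ((a i)\<^sup>2)) = distr gauss_seq (Pi\<^sub>M UNIV (\<lambda>_. borel)) (\<lambda>x i. a i * x i)"
proof -
  interpret P: product_prob_space "\<lambda>i. gauss1 ((a i)\<^sup>2)" UNIV
    by (intro product_prob_spaceI prob_space_gauss1) simp
  have [measurable]: "(\<lambda>x i. a i * x i) \<in> Pi\<^sub>M UNIV (\<lambda>_. borel) \<rightarrow>\<^sub>M Pi\<^sub>M UNIV (\<lambda>_. borel)"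
    by (rule measurable_PiM_single') auto
  show ?thesis
  proof (rule P.PiM_eq[symmetric])
    show "sets (distr gauss_seq (Pi\<^sub>M UNIV (\<lambda>_. borel)) (\<lambda>x i. a i * x i)) = sets (Pi\<^sub>M UNIV (\<lambda>i. gauss1 ((a i)\<^sup>2)))"
      by (simp, intro sets_PiM_cong) auto
    fix J :: "nat set" and F :: "nat \<Rightarrow> real set"
    assume J: "finite J" "J \<subseteq> UNIV" and "\<And>j. j \<in> J \<Longrightarrow> F j \<in> sets (gauss1 ((a j)\<^sup>2))"
    then have F [measurable]: "\<And>j. j \<in> J \<Longrightarrow> F j \<in> sets borel" by simp
    have emb: "prod_emb UNIV (\<lambda>i. gauss1 ((a i)\<^sup>2)) J (Pi\<^sub>E J F) = {x. \<forall>j\<in>J. x j \<in> F j}"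
      by (auto simp: prod_emb_def space_PiM PiE_iff)
    have "{x \<in> space (Pi\<^sub>M UNIV (\<lambda>_. borel)). \<forall>j\<in>J. x j \<in> F j} \<in> sets (Pi\<^sub>M UNIV (\<lambda>_. borel))"
      using J F by measurable
    then have "emeasure (distr gauss_seq (Pi\<^sub>M UNIV (\<lambda>_. borel)) (\<lambda>x i. a i * x i)) {x. \<forall>j\<in>J. x j \<in> F j}
        = emeasure gauss_seq {x \<in> space gauss_seq. \<forall>j\<in>J. x j \<in> (\<lambda>y. a j * y) -` F j}"
      by (subst emeasure_distr) (auto simp: space_PiM intro!: arg_cong[where f = "emeasure gauss_seq"])
    also have "\<dots> = (\<Prod>j\<in>J. emeasure std_gauss ((\<lambda>y. a j * y) -` F j))"
      using J F by (intro gauss_prod.emeasure_PiM_Collect) (auto intro!: measurable_sets_borel[of _ borel])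
    also have "\<dots> = (\<Prod>j\<in>J. emeasure (gauss1 ((a j)\<^sup>2)) (F j))"
      using F by (intro prod.cong) (auto simp: gauss1_scaled a emeasure_distr sets_eq_imp_space_eq[OF sets_std_gauss])
    finally show "emeasure (distr gauss_seq (Pi\<^sub>M UNIV (\<lambda>_. borel)) (\<lambda>x i. a i * x i))
        (prod_emb UNIV (\<lambda>i. gauss1 ((a i)\<^sup>2)) J (Pi\<^sub>E J F)) = (\<Prod>j\<in>J. emeasure (gauss1 ((a j)\<^sup>2)) (F j))"
      by (simp add: emb)
  qed
qed

text \<open>
  The expectation of \<open>\<Sum>(a\<^sub>i x\<^sub>i)\<^sup>2\<close> is \<open>\<Sum>a\<^sub>i\<^sup>2\<close>, which is finite.
\<close>

lemma AE_gauss_summable: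
  assumes a: "summable (\<lambda>i. (a i)\<^sup>2)"
  shows "AE x in gauss_seq. summable (\<lambda>i. (a i * x i)\<^sup>2)"
proof -
  have "(\<integral>\<^sup>+x. (\<Sum>i. ennreal ((a i * x i)\<^sup>2)) \<partial>gauss_seq) = (\<Sum>i. \<integral>\<^sup>+x. ennreal ((a i * x i)\<^sup>2) \<partial>gauss_seq)"
    by (rule nn_integral_suminf) simp
  also have "(\<lambda>i. \<integral>\<^sup>+x. ennreal ((a i * x i)\<^sup>2) \<partial>gauss_seq) = (\<lambda>i. ennreal ((a i)\<^sup>2))"
    by (auto simp: power_mult_distrib ennreal_mult nn_integral_cmult nn_integral_gauss_square)
  also have "(\<Sum>i. ennreal ((a i)\<^sup>2)) = ennreal (\<Sum>i. (a i)\<^sup>2)"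
    using a by (intro suminf_ennreal2) auto
  finally have "(\<integral>\<^sup>+x. (\<Sum>i. ennreal ((a i * x i)\<^sup>2)) \<partial>gauss_seq) \<noteq> \<infinity>" by simp
  then have "AE x in gauss_seq. (\<Sum>i. ennreal ((a i * x i)\<^sup>2)) \<noteq> \<infinity>"
    by (intro nn_integral_PInf_AE) measurable
  then show ?thesis
    by eventually_elim (intro summable_suminf_not_top, auto)
qed

lemma gauss_l2_eq_distr:
  assumes a: "summable (\<lambda>i. (a i)\<^sup>2)" "\<And>i. 0 \<le> a i"
  shows "gauss_l2 (\<lambda>i. (a i)\<^sup>2) = distr gauss_seq borel (gauss_point a)"
proof (rule measure_eqI)
  define S where "S = {x :: nat \<Rightarrow> real. summable (\<lambda>i. (x i)\<^sup>2)}"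
  let ?P = "Pi\<^sub>M UNIV (\<lambda>i. gauss1 ((a i)\<^sup>2))"
  have P: "sets ?P = sets (Pi\<^sub>M UNIV (\<lambda>_. borel))" by (intro sets_PiM_cong) auto
  have "{x \<in> space (Pi\<^sub>M UNIV (\<lambda>_. borel)). summable (\<lambda>i. (x i :: real)\<^sup>2)} \<in> sets (Pi\<^sub>M UNIV (\<lambda>_. borel))"
    by measurable
  then have S [measurable]: "S \<in> sets (Pi\<^sub>M UNIV (\<lambda>_. borel))" by (simp add: S_def space_PiM)
  have Abs: "Abs_l2 \<in> restrict_space (Pi\<^sub>M UNIV (\<lambda>_. borel)) S \<rightarrow>\<^sub>M borel"
  proof (rule measurable_l2I)
    fix i
    have "(\<lambda>x. x i) \<in> borel_measurable (restrict_space (Pi\<^sub>M UNIV (\<lambda>_. borel)) S)"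
      by (intro measurable_restrict_space1) measurable
    then show "(\<lambda>x. coord (Abs_l2 x) i) \<in> borel_measurable (restrict_space (Pi\<^sub>M UNIV (\<lambda>_. borel)) S)"
      by (rule measurable_cong[THEN iffD1, rotated])
        (auto simp: space_restrict_space S_def Abs_l2_inverse)
  qed
  have AbsP: "Abs_l2 \<in> restrict_space ?P S \<rightarrow>\<^sub>M borel"
    using Abs by (simp add: measurable_cong_sets[OF sets_restrict_space_cong[OF P] refl])
  have [measurable]: "(\<lambda>x i. a i * x i) \<in> Pi\<^sub>M UNIV (\<lambda>_. borel) \<rightarrow>\<^sub>M Pi\<^sub>M UNIV (\<lambda>_. borel)"
    by (rule measurable_PiM_single') auto
  fix A assume "A \<in> sets (gauss_l2 (\<lambda>i. (a i)\<^sup>2))"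
  then have A [measurable]: "A \<in> sets borel" by (simp add: gauss_l2_def)
  define B where "B = Abs_l2 -` A \<inter> S"
  have B [measurable]: "B \<in> sets (Pi\<^sub>M UNIV (\<lambda>_. borel))"
    using measurable_sets[OF Abs A] S
    by (simp add: B_def space_restrict_space space_PiM sets_restrict_space_iff)
  have "emeasure (gauss_l2 (\<lambda>i. (a i)\<^sup>2)) A = emeasure (restrict_space ?P S) B"
    unfolding gauss_l2_def S_def[symmetric]
    by (subst emeasure_distr[OF AbsP A]) (simp add: B_def space_restrict_space space_PiM)
  also have "\<dots> = emeasure ?P B"
    by (rule emeasure_restrict_space) (auto simp: P B_def space_PiM)
  also have "\<dots> = emeasure gauss_seq ((\<lambda>x i. a i * x i) -` B \<inter> space gauss_seq)"
    unfolding PiM_gauss1_scaled[of a, OF a(2)] by (rule emeasure_distr) measurable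
  also have "\<dots> = emeasure gauss_seq (gauss_point a -` A \<inter> space gauss_seq)"
  proof (rule emeasure_eq_AE)
    show "AE x in gauss_seq. x \<in> (\<lambda>x i. a i * x i) -` B \<inter> space gauss_seq \<longleftrightarrow>
        x \<in> gauss_point a -` A \<inter> space gauss_seq"
      using AE_gauss_summable[OF a(1)] by eventually_elim (simp add: B_def S_def gauss_point_def)
  qed measurable
  also have "\<dots> = emeasure (distr gauss_seq borel (gauss_point a)) A"
    by (rule emeasure_distr[symmetric]) measurable
  finally show "emeasure (gauss_l2 (\<lambda>i. (a i)\<^sup>2)) A = emeasure (distr gauss_seq borel (gauss_point a)) A" .
qed (simp add: gauss_l2_def)

section \<open>Moments of the Gaussian radius and direction\<close>

lemma borel_measurable_coordinate: "(\<lambda>x. x i) \<in> borel_measurable (Pi\<^sub>M UNIV (\<lambda>_. borel))"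
  by (rule measurable_component_singleton) simp

lemma measurable_sqnorm_seq [measurable]: "sqnorm n \<in> borel_measurable (Pi\<^sub>M UNIV (\<lambda>_. borel))"
  by (rule measurable_sqnorm) simp

text \<open>
  Transposing two coordinates preserves both the Gaussian measure and the norm.
\<close>

lemma nn_integral_coordinate_radial_swap:
  assumes g [measurable]: "g \<in> borel_measurable borel" and ik: "i < n" "k < n"
  shows "(\<integral>\<^sup>+x. ennreal ((x i)\<^sup>2) * g (sqnorm n x) \<partial>gauss_seq)
    = (\<integral>\<^sup>+x. ennreal ((x k)\<^sup>2) * g (sqnorm n x) \<partial>gauss_seq)"
proof -
  let ?\<tau> = "Transposition.transpose i k"
  have \<tau>: "(\<lambda>x j. x (?\<tau> j)) \<in> Pi\<^sub>M UNIV (\<lambda>_. borel :: real measure) \<rightarrow>\<^sub>M Pi\<^sub>M UNIV (\<lambda>_. borel)"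
    by (rule measurable_PiM_single') (auto intro: borel_measurable_coordinate)
  have "distr gauss_seq (Pi\<^sub>M UNIV (\<lambda>_. std_gauss)) (\<lambda>x. \<lambda>j\<in>UNIV. x (?\<tau> j)) = gauss_seq"
    by (rule distr_PiM_reindex[of UNIV "\<lambda>_. std_gauss" ?\<tau> UNIV, OF prob_space_std_gauss])
      (auto intro!: inj_on_subset[OF inj_transpose])
  then have inv: "distr gauss_seq gauss_seq (\<lambda>x j. x (?\<tau> j)) = gauss_seq"
    by (simp only: restrict_UNIV)
  have bij: "bij_betw ?\<tau> {..<n} {..<n}"
    by (rule bij_betwI[where g = ?\<tau>]) (use ik in \<open>auto simp: Transposition.transpose_def\<close>)
  have sq: "sqnorm n (\<lambda>j. x (?\<tau> j)) = sqnorm n x" for x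
    unfolding sqnorm_def by (rule sum.reindex_bij_betw[OF bij, of "\<lambda>j. (x j)\<^sup>2"])
  have "(\<integral>\<^sup>+x. ennreal ((x i)\<^sup>2) * g (sqnorm n x) \<partial>gauss_seq)
      = (\<integral>\<^sup>+x. ennreal ((x i)\<^sup>2) * g (sqnorm n x) \<partial>distr gauss_seq gauss_seq (\<lambda>x j. x (?\<tau> j)))"
    by (simp only: inv)
  also have "\<dots> = (\<integral>\<^sup>+x. ennreal ((x (?\<tau> i))\<^sup>2) * g (sqnorm n (\<lambda>j. x (?\<tau> j))) \<partial>gauss_seq)"
  proof (rule nn_integral_distr)
    show "(\<lambda>x j. x (?\<tau> j)) \<in> gauss_seq \<rightarrow>\<^sub>M gauss_seq"
      using \<tau> unfolding measurable_cong_sets[OF sets_gauss_prod sets_gauss_prod] .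
  qed measurable
  also have "\<dots> = (\<integral>\<^sup>+x. ennreal ((x k)\<^sup>2) * g (sqnorm n x) \<partial>gauss_seq)"
    by (simp only: sq transpose_apply_first)
  finally show ?thesis .
qed

text \<open>
  The expectations for the different \<open>i\<close> are equal and add up to the one on the right.
\<close>

lemma nn_integral_coordinate_radial:
  assumes g [measurable]: "g \<in> borel_measurable borel" and i: "i < n"
  shows "of_nat n * (\<integral>\<^sup>+x. ennreal ((x i)\<^sup>2) * g (sqnorm n x) \<partial>gauss_seq)
    = (\<integral>\<^sup>+x. ennreal (sqnorm n x) * g (sqnorm n x) \<partial>gauss_seq)"
proof -
  have "(\<integral>\<^sup>+x. ennreal (sqnorm n x) * g (sqnorm n x) \<partial>gauss_seq)
      = (\<integral>\<^sup>+x. (\<Sum>k<n. ennreal ((x k)\<^sup>2) * g (sqnorm n x)) \<partial>gauss_seq)"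
    by (simp add: sqnorm_def sum_ennreal sum_distrib_right[symmetric])
  also have "\<dots> = (\<Sum>k<n. \<integral>\<^sup>+x. ennreal ((x k)\<^sup>2) * g (sqnorm n x) \<partial>gauss_seq)"
    by (rule nn_integral_sum) simp
  also have "\<dots> = (\<Sum>k<n. \<integral>\<^sup>+x. ennreal ((x i)\<^sup>2) * g (sqnorm n x) \<partial>gauss_seq)"
    using i by (intro sum.cong nn_integral_coordinate_radial_swap) auto
  finally show ?thesis by simp
qed

lemma AE_sqnorm_pos:
  assumes "0 < n"
  shows "AE x in gauss_seq. 0 < sqnorm n x"
proof -
  have "AE y in std_gauss. y \<noteq> 0"
    unfolding std_gauss_def by (subst AE_density) (use AE_lborel_singleton[of 0] in auto)
  then have "AE x in gauss_seq. x 0 \<noteq> 0"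
    by (rule gauss_prod.AE_component[rotated]) simp
  then show ?thesis
  proof eventually_elim
    case (elim x)
    then have "0 < (x 0)\<^sup>2" by simp
    also have "\<dots> \<le> sqnorm n x"
      unfolding sqnorm_def using assms by (intro member_le_sum) auto
    finally show ?case .
  qed
qed

lemma has_bochner_integral_gauss_pair:
  assumes f: "integrable std_gauss f" "(\<integral>y. f y \<partial>std_gauss) = 0" and ik: "i \<noteq> k"
  shows "has_bochner_integral gauss_seq (\<lambda>x. f (x i) * f (x k) :: real) 0"
proof -
  let ?N = "Pi\<^sub>M {i, k} (\<lambda>_. std_gauss)"
  have N: "distr gauss_seq ?N (\<lambda>x. restrict x {i, k}) = ?N"
    by (rule gauss_prod.distr_PiM_restrict_finite) auto
  have "integrable ?N (\<lambda>x. \<Prod>j\<in>{i, k}. f (x j))" "(\<integral>x. (\<Prod>j\<in>{i, k}. f (x j)) \<partial>?N) = (\<Prod>j\<in>{i, k}. \<integral>y. f y \<partial>std_gauss)"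
    by (rule gauss_prod.product_integrable_prod gauss_prod.product_integral_prod; simp add: f)+
  then have "has_bochner_integral ?N (\<lambda>x. f (x i) * f (x k)) 0"
    using ik f(2) by (simp add: has_bochner_integral_iff)
  then have "has_bochner_integral (distr gauss_seq ?N (\<lambda>x. restrict x {i, k})) (\<lambda>x. f (x i) * f (x k)) 0"
    unfolding N .
  moreover have "(\<lambda>x. f (x i) * f (x k)) \<in> borel_measurable ?N" "(\<lambda>x. restrict x {i, k}) \<in> gauss_seq \<rightarrow>\<^sub>M ?N"
    using borel_measurable_integrable[OF f(1)] by measurable
  ultimately have "has_bochner_integral gauss_seq (\<lambda>x. f (restrict x {i, k} i) * f (restrict x {i, k} k)) 0"
    by (simp only: has_bochner_integral_iff integrable_distr_eq integral_distr)
  then show ?thesis by simp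
qed

lemma has_bochner_integral_gauss_coordinate:
  assumes "has_bochner_integral std_gauss (f :: real \<Rightarrow> real) c"
  shows "has_bochner_integral gauss_seq (\<lambda>x. f (x i)) c"
proof -
  have f [measurable]: "f \<in> borel_measurable borel"
    using borel_measurable_has_bochner_integral[OF assms] by simp
  have "has_bochner_integral (distr gauss_seq borel (\<lambda>x. x i)) f c"
    using assms by (simp add: distr_gauss_coordinate)
  moreover have "(\<lambda>x. x i) \<in> borel_measurable gauss_seq" by measurable
  ultimately show ?thesis
    using f by (simp only: has_bochner_integral_iff integrable_distr_eq integral_distr)
qed

text \<open>
  With \<open>f(y) = y\<^sup>2 - 1\<close> the squared deviation is \<open>(1 + \<Sum>f(x\<^sub>i))\<^sup>2\<close>. The \<open>f(x\<^sub>i)\<close> are centred and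
  uncorrelated with variance \<open>3 - 2 + 1 = 2\<close>, so that only the constant and the \<open>n\<close> diagonal terms
  contribute.
\<close>

lemma nn_integral_sqnorm_deviation:
  "(\<integral>\<^sup>+x. ennreal ((sqnorm n x - (real n - 1))\<^sup>2) \<partial>gauss_seq) = ennreal (2 * real n + 1)"
proof -
  define f where "f y = y\<^sup>2 - 1" for y :: real
  have f0: "has_bochner_integral std_gauss f 0"
    using has_bochner_integral_diff[OF std_gauss_moment2, of "\<lambda>_. 1" 1]
    by (simp add: f_def[abs_def] has_bochner_integral_iff std_gauss.prob_space)
  have f2: "has_bochner_integral std_gauss (\<lambda>y. f y * f y) 2"
  proof -
    have "has_bochner_integral std_gauss (\<lambda>y. (y ^ 4 - 2 * y\<^sup>2) + 1) ((3 - 2 * 1) + 1)"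
      by (intro has_bochner_integral_add has_bochner_integral_diff std_gauss_moment4
          has_bochner_integral_mult_right std_gauss_moment2)
        (simp_all add: has_bochner_integral_iff std_gauss.prob_space)
    moreover have "(y ^ 4 - 2 * y\<^sup>2) + 1 = f y * f y" for y
      by (simp add: f_def power2_eq_square power4_eq_xxxx algebra_simps)
    ultimately show ?thesis by simp
  qed
  have pair: "has_bochner_integral gauss_seq (\<lambda>x. f (x i) * f (x k)) (if i = k then 2 else 0)" for i k
    using has_bochner_integral_gauss_coordinate[OF f2, of i] has_bochner_integral_gauss_pair[of f i k] f0
    by (auto simp: has_bochner_integral_iff)
  have "has_bochner_integral gauss_seq (\<lambda>x. \<Sum>i<n. f (x i)) (\<Sum>i<n. 0)"
    by (rule has_bochner_integral_sum) (rule has_bochner_integral_gauss_coordinate[OF f0])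
  then have "has_bochner_integral gauss_seq (\<lambda>x. 2 * (\<Sum>i<n. f (x i))) (2 * (\<Sum>i<n. 0))"
    by (rule has_bochner_integral_mult_right[rotated])
  moreover have "has_bochner_integral gauss_seq (\<lambda>x. 1) (1 :: real)"
    by (simp add: has_bochner_integral_iff gauss_seq.prob_space)
  moreover have "has_bochner_integral gauss_seq (\<lambda>x. \<Sum>i<n. \<Sum>k<n. f (x i) * f (x k))
      (\<Sum>i<n. \<Sum>k<n. if i = k then 2 else 0)"
    by (rule has_bochner_integral_sum, rule has_bochner_integral_sum) (rule pair)
  ultimately have "has_bochner_integral gauss_seq
      (\<lambda>x. (1 + 2 * (\<Sum>i<n. f (x i))) + (\<Sum>i<n. \<Sum>k<n. f (x i) * f (x k)))
      ((1 + 2 * (\<Sum>i<n. 0)) + (\<Sum>i<n. \<Sum>k<n. if i = k then 2 else 0))"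
    by (intro has_bochner_integral_add)
  moreover have "(1 + 2 * (\<Sum>i<n. f (x i))) + (\<Sum>i<n. \<Sum>k<n. f (x i) * f (x k))
      = (sqnorm n x - (real n - 1))\<^sup>2" for x
  proof -
    have "(\<Sum>i<n. f (x i)) = sqnorm n x - real n" by (simp add: f_def sqnorm_def sum_subtractf)
    moreover have "(\<Sum>i<n. \<Sum>k<n. f (x i) * f (x k)) = (\<Sum>i<n. f (x i))\<^sup>2"
      by (simp add: power2_eq_square sum_product)
    moreover have "sqnorm n x - (real n - 1) = (sqnorm n x - real n) + 1" by simp
    ultimately show ?thesis by (simp only: power2_sum) simp
  qed
  ultimately have "has_bochner_integral gauss_seq (\<lambda>x. (sqnorm n x - (real n - 1))\<^sup>2) (2 * real n + 1)"
    by (simp add: add.commute mult.commute)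
  then show ?thesis
    by (subst nn_integral_eq_integral) (auto simp: has_bochner_integral_iff)
qed

lemma nn_integral_direction_square:
  assumes i: "i < n"
  shows "(\<integral>\<^sup>+x. ennreal ((direction n x i)\<^sup>2) \<partial>gauss_seq) \<le> ennreal (1 / real n)"
proof -
  define g where "g s = ennreal (1 / s)" for s :: real
  have [measurable]: "g \<in> borel_measurable borel" unfolding g_def[abs_def] by measurable
  have n: "0 < n" using i by simp
  have "of_nat n * (\<integral>\<^sup>+x. ennreal ((direction n x i)\<^sup>2) \<partial>gauss_seq)
      = of_nat n * (\<integral>\<^sup>+x. ennreal ((x i)\<^sup>2) * g (sqnorm n x) \<partial>gauss_seq)"
  proof (intro arg_cong2[where f = "(*)"] refl nn_integral_cong_AE)
    show "AE x in gauss_seq. ennreal ((direction n x i)\<^sup>2) = ennreal ((x i)\<^sup>2) * g (sqnorm n x)"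
      using AE_sqnorm_pos[OF n]
      by eventually_elim (use i in \<open>simp add: direction_def g_def ennreal_mult[symmetric] power_divide\<close>)
  qed
  also have "\<dots> = (\<integral>\<^sup>+x. ennreal (sqnorm n x) * g (sqnorm n x) \<partial>gauss_seq)"
    by (rule nn_integral_coordinate_radial[OF _ i]) measurable
  also have "\<dots> \<le> (\<integral>\<^sup>+x. 1 \<partial>gauss_seq)"
    by (intro nn_integral_mono) (auto simp: g_def ennreal_mult[symmetric])
  also have "\<dots> = 1" by (simp add: gauss_seq.emeasure_space_1)
  finally have le: "of_nat n * (\<integral>\<^sup>+x. ennreal ((direction n x i)\<^sup>2) \<partial>gauss_seq) \<le> 1" .
  have "(\<integral>\<^sup>+x. ennreal ((direction n x i)\<^sup>2) \<partial>gauss_seq)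
      = ennreal (1 / real n) * (of_nat n * (\<integral>\<^sup>+x. ennreal ((direction n x i)\<^sup>2) \<partial>gauss_seq))"
    using n by (simp add: mult.assoc[symmetric] ennreal_of_nat_eq_real_of_nat ennreal_mult[symmetric])
  also have "\<dots> \<le> ennreal (1 / real n) * 1" by (rule mult_left_mono[OF le]) simp
  finally show ?thesis by simp
qed

text \<open>
  The left-hand side is \<open>E x\<^sub>i\<^sup>2 (\<surd>c/|x| - 1)\<^sup>2\<close> with \<open>c = n - 1\<close>, which by symmetry equals
  \<open>E (\<surd>c - |x|)\<^sup>2 / n\<close>. Since \<open>\<surd>c \<le> \<surd>c + |x|\<close>, multiplying by the conjugate gives
  \<open>(\<surd>c - |x|)\<^sup>2 \<le> (c - |x|\<^sup>2)\<^sup>2 / c\<close>, whose expectation \<open>(2n + 1)/(n - 1)\<close> is at most \<open>5\<close> for \<open>n \<ge> 2\<close>.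
\<close>

lemma nn_integral_direction_deviation:
  assumes i: "i < n" and n: "2 \<le> n"
  shows "(\<integral>\<^sup>+x. ennreal ((sqrt (real n - 1) * direction n x i - x i)\<^sup>2) \<partial>gauss_seq) \<le> ennreal (5 / real n)"
proof -
  define c where "c = real n - 1"
  have c: "1 \<le> c" using n by (simp add: c_def)
  have n0: "0 < n" using n by simp
  define g where "g s = ennreal ((sqrt c / sqrt s - 1)\<^sup>2)" for s :: real
  have [measurable]: "g \<in> borel_measurable borel" unfolding g_def[abs_def] by measurable
  let ?I = "\<integral>\<^sup>+x. ennreal ((sqrt c * direction n x i - x i)\<^sup>2) \<partial>gauss_seq"
  have "of_nat n * ?I = of_nat n * (\<integral>\<^sup>+x. ennreal ((x i)\<^sup>2) * g (sqnorm n x) \<partial>gauss_seq)"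
  proof (intro arg_cong2[where f = "(*)"] refl nn_integral_cong_AE)
    show "AE x in gauss_seq. ennreal ((sqrt c * direction n x i - x i)\<^sup>2) = ennreal ((x i)\<^sup>2) * g (sqnorm n x)"
      using AE_sqnorm_pos[OF n0]
    proof eventually_elim
      case (elim x)
      have "sqrt c * direction n x i - x i = x i * (sqrt c / sqrt (sqnorm n x) - 1)"
        using i elim by (simp add: direction_def right_diff_distrib)
      then show ?case by (simp add: g_def ennreal_mult[symmetric] power_mult_distrib)
    qed
  qed
  also have "\<dots> = (\<integral>\<^sup>+x. ennreal (sqnorm n x) * g (sqnorm n x) \<partial>gauss_seq)"
    by (rule nn_integral_coordinate_radial[OF _ i]) measurable
  also have "\<dots> \<le> (\<integral>\<^sup>+x. ennreal (1 / c) * ennreal ((sqnorm n x - c)\<^sup>2) \<partial>gauss_seq)"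
  proof (intro nn_integral_mono)
    fix x
    define s where "s = sqnorm n x"
    have s: "0 \<le> s" by (simp add: s_def)
    have "s * (sqrt c / sqrt s - 1)\<^sup>2 \<le> 1 / c * (s - c)\<^sup>2"
    proof (cases "s = 0")
      case False
      then have "0 < sqrt s" using s by simp
      have "s * (sqrt c / sqrt s - 1)\<^sup>2 = (sqrt s * (sqrt c / sqrt s - 1))\<^sup>2"
        using s by (simp add: power_mult_distrib)
      also have "sqrt s * (sqrt c / sqrt s - 1) = sqrt c - sqrt s"
        using \<open>0 < sqrt s\<close> by (simp add: right_diff_distrib)
      also have "(sqrt c - sqrt s)\<^sup>2 * c \<le> (sqrt c - sqrt s)\<^sup>2 * (sqrt c + sqrt s)\<^sup>2"
      proof (rule mult_left_mono)
        have "(sqrt c)\<^sup>2 \<le> (sqrt c + sqrt s)\<^sup>2" using c s by (intro power_mono) auto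
        then show "c \<le> (sqrt c + sqrt s)\<^sup>2" using c by simp
      qed simp
      then have "(sqrt c - sqrt s)\<^sup>2 \<le> ((sqrt c - sqrt s) * (sqrt c + sqrt s))\<^sup>2 / c"
        using c by (simp add: pos_le_divide_eq power_mult_distrib)
      also have "(sqrt c - sqrt s) * (sqrt c + sqrt s) = c - s"
        using c s by (simp add: algebra_simps)
      finally show ?thesis by (simp add: power2_commute)
    qed (use c in simp)
    then show "ennreal (sqnorm n x) * g (sqnorm n x) \<le> ennreal (1 / c) * ennreal ((sqnorm n x - c)\<^sup>2)"
      using c by (simp add: g_def s_def ennreal_mult[symmetric] ennreal_leI)
  qed
  also have "\<dots> = ennreal (1 / c) * ennreal (2 * real n + 1)"
    unfolding c_def by (subst nn_integral_cmult) (simp_all add: nn_integral_sqnorm_deviation)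
  also have "\<dots> = ennreal ((2 * real n + 1) / c)"
    using c by (simp add: ennreal_mult[symmetric] del: ennreal_plus)
  also have "\<dots> \<le> ennreal 5"
    using n by (intro ennreal_leI) (simp add: c_def divide_simps)
  finally have le: "of_nat n * ?I \<le> ennreal 5" .
  have "?I = ennreal (1 / real n) * (of_nat n * ?I)"
    using n by (simp add: mult.assoc[symmetric] ennreal_of_nat_eq_real_of_nat ennreal_mult[symmetric])
  also have "\<dots> \<le> ennreal (1 / real n) * ennreal 5" by (rule mult_left_mono[OF le]) simp
  also have "\<dots> = ennreal (1 / real n * 5)" by (rule ennreal_mult[symmetric]) simp_all
  also have "1 / real n * 5 = 5 / real n" by simp
  finally show ?thesis by (simp add: c_def)
qed

section \<open>The quadratic distance between the coupled points\<close>

lemma square_sum3_le: "((a::real) + b + c)\<^sup>2 \<le> 3 * (a\<^sup>2 + b\<^sup>2 + c\<^sup>2)"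
proof -
  have "0 \<le> (a - b)\<^sup>2 + (b - c)\<^sup>2 + (a - c)\<^sup>2" by simp
  then show ?thesis by (simp add: power2_eq_square algebra_simps)
qed

lemma ennreal_square_sum3_le:
  "ennreal ((a + b + c)\<^sup>2) \<le> ennreal 3 * (ennreal (a\<^sup>2) + ennreal (b\<^sup>2) + ennreal (c\<^sup>2))"
proof -
  have "ennreal 3 * (ennreal (a\<^sup>2) + ennreal (b\<^sup>2) + ennreal (c\<^sup>2)) = ennreal (3 * (a\<^sup>2 + b\<^sup>2 + c\<^sup>2))"
    by (subst ennreal_mult) simp_all
  then show ?thesis using square_sum3_le[of a b c] by (simp only: ennreal_leI)
qed

lemma measurable_direction_coordinate [measurable]:
  assumes "i < n"
  shows "(\<lambda>x. direction n x i) \<in> borel_measurable (Pi\<^sub>M UNIV (\<lambda>_. borel))"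
  by (rule measurable_compose[OF measurable_direction_seq])
    (rule measurable_component_singleton, use assms in simp)

text \<open>
  With \<open>c = \<surd>(n - 1)\<close> and the \<open>i\<close>-th coordinate \<open>d\<close> of the direction, the difference is the sum of
  \<open>-(1 - \<rho>) c b d\<close>, \<open>c (b - a) d\<close> and \<open>a (c d - x\<^sub>i)\<close>. The first two are estimated with \<open>c\<^sup>2 E d\<^sup>2 \<le> 1\<close>, and
  \<open>\<rho>\<close> is independent of \<open>d\<close>.
\<close>

lemma nn_integral_coupled_coordinate:
  assumes n: "2 \<le> n" and i: "i < n" and [measurable]: "\<rho> \<in> borel_measurable borel"
    and \<tau>: "(\<integral>\<^sup>+u. ennreal ((1 - \<rho> u)\<^sup>2) \<partial>unif01) \<le> ennreal \<tau>" "0 \<le> \<tau>"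
  shows "(\<integral>\<^sup>+p. ennreal ((\<rho> (snd p) * (sqrt (real n - 1) * b * direction n (fst p) i) - a * fst p i)\<^sup>2) \<partial>model_space)
    \<le> ennreal (3 * (\<tau> * b\<^sup>2 + (b - a)\<^sup>2 + 5 / real n * a\<^sup>2))"
proof -
  define c where "c = sqrt (real n - 1)"
  have c2: "c\<^sup>2 = real n - 1" using n by (simp add: c_def)
  define d where "d x = direction n x i" for x
  note [measurable] = measurable_direction_coordinate[OF i, folded d_def]
  have D: "(\<integral>\<^sup>+x. ennreal ((d x)\<^sup>2) \<partial>gauss_seq) \<le> ennreal (1 / real n)"
    unfolding d_def by (rule nn_integral_direction_square[OF i])
  have E: "(\<integral>\<^sup>+x. ennreal ((c * d x - x i)\<^sup>2) \<partial>gauss_seq) \<le> ennreal (5 / real n)"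
    unfolding d_def c_def by (rule nn_integral_direction_deviation[OF i n])
  have cn: "c\<^sup>2 * (1 / real n) \<le> 1" using n by (simp add: c2 divide_simps)
  have T1: "(\<integral>\<^sup>+p. ennreal (((1 - \<rho> (snd p)) * (c * b * d (fst p)))\<^sup>2) \<partial>model_space) \<le> ennreal (\<tau> * b\<^sup>2)"
  proof -
    have "(\<integral>\<^sup>+p. ennreal (((1 - \<rho> (snd p)) * (c * b * d (fst p)))\<^sup>2) \<partial>model_space)
        = (\<integral>\<^sup>+x. \<integral>\<^sup>+u. (ennreal (c\<^sup>2 * b\<^sup>2) * ennreal ((d x)\<^sup>2)) * ennreal ((1 - \<rho> u)\<^sup>2) \<partial>unif01 \<partial>gauss_seq)"
      by (subst nn_integral_model_space(1))
        (auto simp: power_mult_distrib ennreal_mult[symmetric] ac_simps intro!: nn_integral_cong)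
    also have "\<dots> = (\<integral>\<^sup>+x. (ennreal (c\<^sup>2 * b\<^sup>2) * ennreal ((d x)\<^sup>2)) *
        (\<integral>\<^sup>+u. ennreal ((1 - \<rho> u)\<^sup>2) \<partial>unif01) \<partial>gauss_seq)"
      by (intro nn_integral_cong nn_integral_cmult) measurable
    also have "\<dots> = (\<integral>\<^sup>+x. ennreal (c\<^sup>2 * b\<^sup>2) * ennreal ((d x)\<^sup>2) \<partial>gauss_seq) *
        (\<integral>\<^sup>+u. ennreal ((1 - \<rho> u)\<^sup>2) \<partial>unif01)"
      by (rule nn_integral_multc) measurable
    also have "(\<integral>\<^sup>+x. ennreal (c\<^sup>2 * b\<^sup>2) * ennreal ((d x)\<^sup>2) \<partial>gauss_seq)
        = ennreal (c\<^sup>2 * b\<^sup>2) * (\<integral>\<^sup>+x. ennreal ((d x)\<^sup>2) \<partial>gauss_seq)"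
      by (rule nn_integral_cmult) measurable
    also have "(ennreal (c\<^sup>2 * b\<^sup>2) * (\<integral>\<^sup>+x. ennreal ((d x)\<^sup>2) \<partial>gauss_seq)) *
        (\<integral>\<^sup>+u. ennreal ((1 - \<rho> u)\<^sup>2) \<partial>unif01)
      \<le> (ennreal (c\<^sup>2 * b\<^sup>2) * ennreal (1 / real n)) * ennreal \<tau>"
      by (intro mult_mono[OF mult_left_mono[OF D] \<tau>(1)]) auto
    also have "\<dots> = ennreal ((c\<^sup>2 * (1 / real n)) * (b\<^sup>2 * \<tau>))"
      using \<tau>(2) by (simp add: ennreal_mult[symmetric] ac_simps)
    also have "\<dots> \<le> ennreal (1 * (b\<^sup>2 * \<tau>))"
      using cn \<tau>(2) by (intro ennreal_leI mult_right_mono) auto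
    finally show ?thesis by (simp add: mult.commute)
  qed
  have marg: "(\<integral>\<^sup>+p. ennreal (h (fst p)) \<partial>model_space) = (\<integral>\<^sup>+x. ennreal (h x) \<partial>gauss_seq)"
    if [measurable]: "h \<in> borel_measurable (Pi\<^sub>M UNIV (\<lambda>_. borel))" for h
    by (subst nn_integral_model_space(1)) (simp_all add: unif01.emeasure_space_1)
  have T2: "(\<integral>\<^sup>+p. ennreal ((c * (b - a) * d (fst p))\<^sup>2) \<partial>model_space) \<le> ennreal ((b - a)\<^sup>2)"
  proof -
    have "(\<integral>\<^sup>+p. ennreal ((c * (b - a) * d (fst p))\<^sup>2) \<partial>model_space)
        = (\<integral>\<^sup>+x. ennreal (c\<^sup>2 * (b - a)\<^sup>2) * ennreal ((d x)\<^sup>2) \<partial>gauss_seq)"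
      by (subst marg) (simp_all add: power_mult_distrib ennreal_mult[symmetric])
    also have "\<dots> = ennreal (c\<^sup>2 * (b - a)\<^sup>2) * (\<integral>\<^sup>+x. ennreal ((d x)\<^sup>2) \<partial>gauss_seq)"
      by (rule nn_integral_cmult) measurable
    also have "\<dots> \<le> ennreal (c\<^sup>2 * (b - a)\<^sup>2) * ennreal (1 / real n)" by (intro mult_mono D) auto
    also have "\<dots> = ennreal ((c\<^sup>2 * (1 / real n)) * (b - a)\<^sup>2)" by (simp add: ennreal_mult[symmetric] ac_simps)
    also have "\<dots> \<le> ennreal (1 * (b - a)\<^sup>2)" using cn by (intro ennreal_leI mult_right_mono) auto
    finally show ?thesis by simp
  qed
  have T3: "(\<integral>\<^sup>+p. ennreal ((a * (c * d (fst p) - fst p i))\<^sup>2) \<partial>model_space) \<le> ennreal (5 / real n * a\<^sup>2)"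
  proof -
    have "(\<integral>\<^sup>+p. ennreal ((a * (c * d (fst p) - fst p i))\<^sup>2) \<partial>model_space)
        = (\<integral>\<^sup>+x. ennreal (a\<^sup>2) * ennreal ((c * d x - x i)\<^sup>2) \<partial>gauss_seq)"
      by (subst marg) (simp_all add: power_mult_distrib ennreal_mult[symmetric])
    also have "\<dots> = ennreal (a\<^sup>2) * (\<integral>\<^sup>+x. ennreal ((c * d x - x i)\<^sup>2) \<partial>gauss_seq)"
      by (rule nn_integral_cmult) measurable
    also have "\<dots> \<le> ennreal (a\<^sup>2) * ennreal (5 / real n)" by (intro mult_mono E) auto
    finally show ?thesis by (simp add: ennreal_mult[symmetric] mult.commute)
  qed
  have "(\<integral>\<^sup>+p. ennreal ((\<rho> (snd p) * (c * b * d (fst p)) - a * fst p i)\<^sup>2) \<partial>model_space)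
    \<le> (\<integral>\<^sup>+p. ennreal 3 * (ennreal (((1 - \<rho> (snd p)) * (c * b * d (fst p)))\<^sup>2)
        + ennreal ((c * (b - a) * d (fst p))\<^sup>2) + ennreal ((a * (c * d (fst p) - fst p i))\<^sup>2)) \<partial>model_space)"
  proof (intro nn_integral_mono)
    fix p :: "(nat \<Rightarrow> real) \<times> real"
    have "\<rho> (snd p) * (c * b * d (fst p)) - a * fst p i
        = - ((1 - \<rho> (snd p)) * (c * b * d (fst p))) + c * (b - a) * d (fst p) + a * (c * d (fst p) - fst p i)"
      by (simp add: algebra_simps)
    then show "ennreal ((\<rho> (snd p) * (c * b * d (fst p)) - a * fst p i)\<^sup>2)
      \<le> ennreal 3 * (ennreal (((1 - \<rho> (snd p)) * (c * b * d (fst p)))\<^sup>2)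
        + ennreal ((c * (b - a) * d (fst p))\<^sup>2) + ennreal ((a * (c * d (fst p) - fst p i))\<^sup>2))"
      using ennreal_square_sum3_le[of "- ((1 - \<rho> (snd p)) * (c * b * d (fst p)))" "c * (b - a) * d (fst p)"
          "a * (c * d (fst p) - fst p i)"]
      by (simp only: power2_minus)
  qed
  also have "\<dots> = ennreal 3 * (\<integral>\<^sup>+p. ennreal (((1 - \<rho> (snd p)) * (c * b * d (fst p)))\<^sup>2)
        + ennreal ((c * (b - a) * d (fst p))\<^sup>2) + ennreal ((a * (c * d (fst p) - fst p i))\<^sup>2) \<partial>model_space)"
    by (rule nn_integral_cmult) measurable
  also have "(\<integral>\<^sup>+p. ennreal (((1 - \<rho> (snd p)) * (c * b * d (fst p)))\<^sup>2)
        + ennreal ((c * (b - a) * d (fst p))\<^sup>2) + ennreal ((a * (c * d (fst p) - fst p i))\<^sup>2) \<partial>model_space)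
      = (\<integral>\<^sup>+p. ennreal (((1 - \<rho> (snd p)) * (c * b * d (fst p)))\<^sup>2)
        + ennreal ((c * (b - a) * d (fst p))\<^sup>2) \<partial>model_space)
      + (\<integral>\<^sup>+p. ennreal ((a * (c * d (fst p) - fst p i))\<^sup>2) \<partial>model_space)"
    by (rule nn_integral_add) measurable
  also have "(\<integral>\<^sup>+p. ennreal (((1 - \<rho> (snd p)) * (c * b * d (fst p)))\<^sup>2)
        + ennreal ((c * (b - a) * d (fst p))\<^sup>2) \<partial>model_space)
      = (\<integral>\<^sup>+p. ennreal (((1 - \<rho> (snd p)) * (c * b * d (fst p)))\<^sup>2) \<partial>model_space)
      + (\<integral>\<^sup>+p. ennreal ((c * (b - a) * d (fst p))\<^sup>2) \<partial>model_space)"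
    by (rule nn_integral_add) measurable
  also have "ennreal 3 * ((\<integral>\<^sup>+p. ennreal (((1 - \<rho> (snd p)) * (c * b * d (fst p)))\<^sup>2) \<partial>model_space)
      + (\<integral>\<^sup>+p. ennreal ((c * (b - a) * d (fst p))\<^sup>2) \<partial>model_space)
      + (\<integral>\<^sup>+p. ennreal ((a * (c * d (fst p) - fst p i))\<^sup>2) \<partial>model_space))
    \<le> ennreal 3 * (ennreal (\<tau> * b\<^sup>2) + ennreal ((b - a)\<^sup>2) + ennreal (5 / real n * a\<^sup>2))"
    by (intro mult_left_mono add_mono T1 T2 T3) auto
  also have "\<dots> = ennreal (3 * (\<tau> * b\<^sup>2 + (b - a)\<^sup>2 + 5 / real n * a\<^sup>2))"
    using \<tau>(2) by (subst ennreal_mult) simp_all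
  finally show ?thesis by (simp add: c_def d_def)
qed

text \<open>
  The point of the ellipsoid with semi-axes \<open>\<surd>(n - 1) b\<^sub>i\<close>, shrunk by the factor \<open>\<rho> u\<close>. Its coupling
  with \<open>gauss_point a\<close> consists in using the same Gaussian sequence.
\<close>

definition coupled_point :: "nat \<Rightarrow> (nat \<Rightarrow> real) \<Rightarrow> (real \<Rightarrow> real) \<Rightarrow> (nat \<Rightarrow> real) \<times> real \<Rightarrow> nat \<Rightarrow> real" where
  "coupled_point n b \<rho> p = ellipsoid_point n (\<lambda>i. sqrt (real n - 1) * b i) (\<rho> (snd p)) (fst p)"

lemma measurable_coupled_point [measurable]:
  assumes [measurable]: "\<rho> \<in> borel_measurable borel"
  shows "coupled_point n b \<rho> \<in> Pi\<^sub>M UNIV (\<lambda>_. borel) \<Otimes>\<^sub>M borel \<rightarrow>\<^sub>M borel_Rn n"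
  unfolding coupled_point_def by measurable

lemma nn_integral_coupled_dist:
  assumes n: "2 \<le> n" and [measurable]: "\<rho> \<in> borel_measurable borel"
    and \<tau>: "(\<integral>\<^sup>+u. ennreal ((1 - \<rho> u)\<^sup>2) \<partial>unif01) \<le> ennreal \<tau>" "0 \<le> \<tau>"
    and a: "summable (\<lambda>i. (a i)\<^sup>2)"
  shows "(\<integral>\<^sup>+p. ennreal ((dist (embed n (coupled_point n b \<rho> p)) (gauss_point a (fst p)))\<^sup>2) \<partial>model_space)
    \<le> ennreal (3 * (\<tau> * (\<Sum>i<n. (b i)\<^sup>2) + (\<Sum>i<n. (b i - a i)\<^sup>2) + 5 / real n * (\<Sum>i<n. (a i)\<^sup>2))
      + (\<Sum>i. (a (i + n))\<^sup>2))"
proof -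
  define X where "X i p = (if i < n then \<rho> (snd p) * (sqrt (real n - 1) * b i * direction n (fst p) i) else 0)"
    for i p
  note [measurable] = measurable_direction_coordinate
  have [measurable]: "X i \<in> borel_measurable (Pi\<^sub>M UNIV (\<lambda>_. borel) \<Otimes>\<^sub>M borel)" for i
    unfolding X_def by (cases "i < n") simp_all
  (* The bounds for the expected squares of the coordinates of the difference. *)
  define \<beta> where "\<beta> i = (if i < n then 3 * (\<tau> * (b i)\<^sup>2 + (b i - a i)\<^sup>2 + 5 / real n * (a i)\<^sup>2) else (a i)\<^sup>2)" for i
  have \<beta>0: "0 \<le> \<beta> i" for i using \<tau>(2) by (simp add: \<beta>_def)
  have tail: "summable (\<lambda>i. \<beta> (i + n))" using summable_ignore_initial_segment[OF a, of n] by (simp add: \<beta>_def)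
  then have \<beta>: "summable \<beta>" by (simp add: summable_iff_shift)
  have "AE p in model_space. summable (\<lambda>i. (a i * fst p i)\<^sup>2)"
  proof -
    have "AE x in distr model_space gauss_seq fst. summable (\<lambda>i. (a i * x i)\<^sup>2)"
      unfolding model_space_def unif01.distr_pair_fst by (rule AE_gauss_summable[OF a])
    then show ?thesis by (rule AE_distrD[rotated]) measurable
  qed
  then have "AE p in model_space. ennreal ((dist (embed n (coupled_point n b \<rho> p)) (gauss_point a (fst p)))\<^sup>2)
      = (\<Sum>i. ennreal ((X i p - a i * fst p i)\<^sup>2))"
  proof eventually_elim
    case (elim p)
    define D where "D = embed n (coupled_point n b \<rho> p) - gauss_point a (fst p)"
    have D: "coord D i = X i p - a i * fst p i" for i
      using elim by (simp add: D_def X_def coord_simps coord_embed coord_gauss_point coupled_point_def ellipsoid_point_def)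
    have "ennreal ((norm D)\<^sup>2) = ennreal (\<Sum>i. (coord D i)\<^sup>2)" by (simp add: norm_l2_sq)
    also have "\<dots> = (\<Sum>i. ennreal ((coord D i)\<^sup>2))"
      by (rule suminf_ennreal2[symmetric]) (simp_all add: summable_coord_sq)
    finally show ?case by (simp add: D D_def[symmetric] dist_norm)
  qed
  then have "(\<integral>\<^sup>+p. ennreal ((dist (embed n (coupled_point n b \<rho> p)) (gauss_point a (fst p)))\<^sup>2) \<partial>model_space)
      = (\<integral>\<^sup>+p. (\<Sum>i. ennreal ((X i p - a i * fst p i)\<^sup>2)) \<partial>model_space)"
    by (rule nn_integral_cong_AE)
  also have "\<dots> = (\<Sum>i. \<integral>\<^sup>+p. ennreal ((X i p - a i * fst p i)\<^sup>2) \<partial>model_space)"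
    by (rule nn_integral_suminf) measurable
  also have "\<dots> \<le> (\<Sum>i. ennreal (\<beta> i))"
  proof (rule suminf_le)
    fix i
    show "(\<integral>\<^sup>+p. ennreal ((X i p - a i * fst p i)\<^sup>2) \<partial>model_space) \<le> ennreal (\<beta> i)"
    proof (cases "i < n")
      case True
      with nn_integral_coupled_coordinate[OF n True \<open>\<rho> \<in> borel_measurable borel\<close> \<tau>, of "b i" "a i"]
      show ?thesis by (simp add: X_def \<beta>_def)
    next
      case False
      have "(\<integral>\<^sup>+p. ennreal ((a i * fst p i)\<^sup>2) \<partial>model_space) = (\<integral>\<^sup>+x. ennreal ((a i)\<^sup>2) * ennreal ((x i)\<^sup>2) \<partial>gauss_seq)"
        by (subst nn_integral_model_space(1))
          (simp_all add: unif01.emeasure_space_1 power_mult_distrib ennreal_mult)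
      also have "\<dots> = ennreal ((a i)\<^sup>2)" by (simp add: nn_integral_cmult nn_integral_gauss_square)
      finally show ?thesis using False by (simp add: X_def \<beta>_def)
    qed
  qed auto
  also have "\<dots> = ennreal (\<Sum>i. \<beta> i)" using \<beta> \<beta>0 by (intro suminf_ennreal2) auto
  also have "(\<Sum>i. \<beta> i) = (\<Sum>i. \<beta> (i + n)) + (\<Sum>i<n. \<beta> i)" by (rule suminf_split_initial_segment[OF \<beta>])
  also have "(\<Sum>i<n. \<beta> i) = 3 * (\<tau> * (\<Sum>i<n. (b i)\<^sup>2) + (\<Sum>i<n. (b i - a i)\<^sup>2) + 5 / real n * (\<Sum>i<n. (a i)\<^sup>2))"
    by (simp add: \<beta>_def sum.distrib sum_distrib_left distrib_left)
  also have "(\<Sum>i. \<beta> (i + n)) = (\<Sum>i. (a (i + n))\<^sup>2)" by (simp add: \<beta>_def)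
  finally show ?thesis by (simp add: add.commute)
qed

text \<open>
  Bounding \<open>(1 - r)\<^sup>2\<close> by \<open>1 - r\<close> leaves the expectation of \<open>1 - u\<^bsup>1/(m+1)\<^esup>\<close>, an elementary integral.
\<close>

lemma nn_integral_clamped_root_deviation:
  "(\<integral>\<^sup>+u. ennreal ((1 - clamped_root (Suc m) u)\<^sup>2) \<partial>unif01) \<le> ennreal (1 / (real m + 2))"
proof -
  let ?n = "Suc m"
  have "(\<integral>\<^sup>+u. ennreal ((1 - clamped_root ?n u)\<^sup>2) \<partial>unif01)
      = ennreal (real ?n) * (\<integral>\<^sup>+r. ennreal (r ^ m) * ennreal ((1 - r)\<^sup>2) * indicator {0..1} r \<partial>lborel)"
    by (rule nn_integral_root_substitution[symmetric]) measurable
  also have "(\<integral>\<^sup>+r. ennreal (r ^ m) * ennreal ((1 - r)\<^sup>2) * indicator {0..1} r \<partial>lborel)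
      \<le> (\<integral>\<^sup>+r. ennreal (r ^ m * (1 - r)) * indicator {0..1} r \<partial>lborel)"
  proof (intro nn_integral_mono)
    fix r :: real
    have "r ^ m * (1 - r)\<^sup>2 \<le> r ^ m * (1 - r)" if "r \<in> {0..1}"
      using that by (intro mult_left_mono) (auto simp: power2_eq_square mult_left_le)
    then show "ennreal (r ^ m) * ennreal ((1 - r)\<^sup>2) * indicator {0..1} r \<le> ennreal (r ^ m * (1 - r)) * indicator {0..1} r"
      by (auto simp: indicator_def ennreal_mult[symmetric] intro!: ennreal_leI)
  qed
  also have "(\<integral>\<^sup>+r. ennreal (r ^ m * (1 - r)) * indicator {0..1} r \<partial>lborel)
      = ennreal ((1 ^ ?n / real ?n - 1 ^ (?n + 1) / (real ?n + 1)) - (0 ^ ?n / real ?n - 0 ^ (?n + 1) / (real ?n + 1)))"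
  proof (rule nn_integral_FTC_Icc)
    fix r :: real
    have "((\<lambda>r. r ^ ?n / real ?n - r ^ (?n + 1) / (real ?n + 1)) has_real_derivative
        real ?n * r ^ (?n - Suc 0) / real ?n - real (?n + 1) * r ^ (?n + 1 - Suc 0) / (real ?n + 1)) (at r)"
      by (intro DERIV_diff DERIV_cdivide DERIV_pow)
    also have "real ?n * r ^ (?n - Suc 0) / real ?n - real (?n + 1) * r ^ (?n + 1 - Suc 0) / (real ?n + 1) = r ^ m * (1 - r)"
    proof -
      have "real ?n * r ^ m / real ?n = r ^ m" "real (?n + 1) * r ^ ?n / (real ?n + 1) = r ^ ?n"
        by (simp_all add: field_simps)
      then show ?thesis by (simp add: algebra_simps del: of_nat_Suc)
    qed
    finally show "((\<lambda>r. r ^ ?n / real ?n - r ^ (?n + 1) / (real ?n + 1)) has_real_derivative r ^ m * (1 - r)) (at r)" .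
  qed auto
  finally have "(\<integral>\<^sup>+u. ennreal ((1 - clamped_root ?n u)\<^sup>2) \<partial>unif01)
      \<le> ennreal (real ?n) * ennreal ((1 ^ ?n / real ?n - 1 ^ (?n + 1) / (real ?n + 1)) - (0 ^ ?n / real ?n - 0 ^ (?n + 1) / (real ?n + 1)))"
    by (simp add: mult_left_mono)
  also have "\<dots> = ennreal (1 / (real m + 2))"
    by (subst ennreal_mult'[symmetric]) (simp_all add: divide_simps)
  finally show ?thesis .
qed

section \<open>Parametrising a probability measure by the unit interval\<close>

definition binary_digit :: "nat \<Rightarrow> real \<Rightarrow> int" where
  "binary_digit k y = \<lfloor>2 ^ Suc k * y\<rfloor> mod 2"

text \<open>
  The partial sum of the first \<open>K\<close> digits is \<open>\<lfloor>2\<^sup>K y\<rfloor> / 2\<^sup>K\<close>.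
\<close>

lemma binary_expansion:
  assumes y: "0 \<le> y" "y < 1"
  shows "(\<lambda>k. real_of_int (binary_digit k y) / 2 ^ Suc k) sums y"
proof -
  have partial: "(\<Sum>k<K. real_of_int (binary_digit k y) / 2 ^ Suc k) = real_of_int \<lfloor>2 ^ K * y\<rfloor> / 2 ^ K" for K
  proof (induction K)
    case 0
    have "\<lfloor>y\<rfloor> = 0" using y by (simp add: floor_eq_iff)
    then show ?case by simp
  next
    case (Suc K)
    have "\<lfloor>2 ^ K * y\<rfloor> = \<lfloor>2 ^ Suc K * y\<rfloor> div 2"
      using floor_divide_real_eq_div[of 2 "2 ^ Suc K * y"] by simp
    then have "\<lfloor>2 ^ Suc K * y\<rfloor> = 2 * \<lfloor>2 ^ K * y\<rfloor> + binary_digit K y"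
      by (simp add: binary_digit_def)
    then have "real_of_int \<lfloor>2 ^ Suc K * y\<rfloor> = 2 * real_of_int \<lfloor>2 ^ K * y\<rfloor> + real_of_int (binary_digit K y)"
      by (metis of_int_add of_int_mult of_int_numeral)
    then show ?case using Suc.IH by (simp add: field_simps)
  qed
  have "(\<lambda>K. real_of_int \<lfloor>2 ^ K * y\<rfloor> / 2 ^ K) \<longlonglongrightarrow> y"
  proof (rule tendsto_sandwich[OF always_eventually always_eventually])
    show "\<forall>K. y - (1 / 2) ^ K \<le> real_of_int \<lfloor>2 ^ K * y\<rfloor> / 2 ^ K"
    proof
      fix K :: nat
      have "2 ^ K * y - 1 \<le> real_of_int \<lfloor>2 ^ K * y\<rfloor>" by linarith
      then have "(2 ^ K * y - 1) / 2 ^ K \<le> real_of_int \<lfloor>2 ^ K * y\<rfloor> / 2 ^ K" by (rule divide_right_mono) simp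
      then show "y - (1 / 2) ^ K \<le> real_of_int \<lfloor>2 ^ K * y\<rfloor> / 2 ^ K" by (simp add: diff_divide_distrib power_one_over)
    qed
    show "\<forall>K. real_of_int \<lfloor>2 ^ K * y\<rfloor> / 2 ^ K \<le> y"
      by (auto simp: divide_le_eq mult.commute)
    have "(\<lambda>K. y - (1 / 2) ^ K) \<longlonglongrightarrow> y - 0"
      by (intro tendsto_diff tendsto_const LIMSEQ_power_zero) simp
    then show "(\<lambda>K. y - (1 / 2) ^ K) \<longlonglongrightarrow> y" by simp
  qed simp
  then show ?thesis unfolding sums_def partial .
qed

text \<open>
  Bits are packed into one real number in base \<open>3\<close> rather than \<open>2\<close>: with digits \<open>0\<close> and \<open>1\<close>
  only, the fractional part \<open>3\<^sup>m z - \<lfloor>3\<^sup>m z\<rfloor>\<close> is at most \<open>1/2\<close>, so that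
  ambiguities like \<open>0.0111\<dots> = 0.1\<close> in base \<open>2\<close> cannot occur and every digit can be read off.
\<close>

definition ternary_digit :: "nat \<Rightarrow> real \<Rightarrow> int" where
  "ternary_digit m z = \<lfloor>3 ^ Suc m * z\<rfloor> mod 3"

lemma ternary_digit_of_binary_sequence:
  fixes d :: "nat \<Rightarrow> int"
  assumes d: "\<And>m. d m \<in> {0, 1}"
  shows "ternary_digit M (\<Sum>m. real_of_int (d m) / 3 ^ Suc m) = d M"
proof -
  (* The number whose expansion is the tail of d from the M-th digit on. *)
  define z where "z M = (\<Sum>k. real_of_int (d (k + M)) / 3 ^ Suc k)" for M
  have d01: "0 \<le> real_of_int (d m)" "real_of_int (d m) \<le> 1" for m using d[of m] by auto
  have g: "(\<lambda>k. 1 / 3 ^ Suc k :: real) sums (1 / 2)"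
    using sums_mult[OF geometric_sums[of "1 / 3 :: real"], of "1 / 3"] by (simp add: power_one_over)
  have sm: "summable (\<lambda>k. real_of_int (d (k + M)) / 3 ^ Suc k)" for M
    by (rule summable_comparison_test'[OF sums_summable[OF g]]) (use d01 in \<open>auto simp: divide_right_mono\<close>)
  have z: "0 \<le> z M" "z M \<le> 1 / 2" for M
  proof -
    show "0 \<le> z M" unfolding z_def using d01 by (intro suminf_nonneg sm) auto
    have "z M \<le> (\<Sum>k. 1 / 3 ^ Suc k)"
      unfolding z_def by (intro suminf_le sm sums_summable[OF g]) (use d01 in \<open>auto simp: divide_right_mono\<close>)
    also have "\<dots> = 1 / 2" by (rule sums_unique[OF g, symmetric])
    finally show "z M \<le> 1 / 2" .
  qed
  have step: "3 * z M = real_of_int (d M) + z (Suc M)" for M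
  proof -
    have "z M = (\<Sum>k. real_of_int (d (Suc k + M)) / 3 ^ Suc (Suc k)) + real_of_int (d (0 + M)) / 3 ^ Suc 0"
      unfolding z_def using suminf_split_head[OF sm[of M]] by (simp only: eq_diff_eq)
    also have "(\<Sum>k. real_of_int (d (Suc k + M)) / 3 ^ Suc (Suc k)) = (\<Sum>k. real_of_int (d (k + Suc M)) / 3 ^ Suc k / 3)"
      by (simp add: mult.commute)
    also have "\<dots> = z (Suc M) / 3" unfolding z_def by (rule suminf_divide[OF sm])
    finally show ?thesis by simp
  qed
  have "\<exists>N :: int. 3 ^ M * z 0 = real_of_int N + z M" for M
  proof (induction M)
    case (Suc M)
    then obtain N :: int where "3 ^ M * z 0 = real_of_int N + z M" by blast
    then have "3 ^ Suc M * z 0 = 3 * (real_of_int N + z M)" by simp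
    also have "\<dots> = real_of_int (3 * N + d M) + z (Suc M)" using step[of M] by simp
    finally show ?case by blast
  qed (auto intro: exI[of _ 0])
  then obtain N :: int where N: "3 ^ M * z 0 = real_of_int N + z M" by blast
  have "3 ^ Suc M * z 0 = 3 * (3 ^ M * z 0)" by simp
  also have "\<dots> = real_of_int (3 * N + d M) + z (Suc M)" unfolding N using step[of M] by simp
  finally have "\<lfloor>3 ^ Suc M * z 0\<rfloor> = 3 * N + d M"
    using z[of "Suc M"] by (intro floor_unique) linarith+
  moreover have "(3 * N + d M) mod 3 = d M" using d[of M] by auto
  moreover have "z 0 = (\<Sum>m. real_of_int (d m) / 3 ^ Suc m)" by (simp add: z_def)
  ultimately show ?thesis unfolding ternary_digit_def by simp
qed

text \<open>
  A bijection from the reals to the interval \<open>(0, 1)\<close>, where the binary digits determine a number.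
\<close>

definition squash :: "real \<Rightarrow> real" where
  "squash x = arctan x / pi + 1 / 2"

definition unsquash :: "real \<Rightarrow> real" where
  "unsquash y = tan (pi * (y - 1 / 2))"

lemma unsquash_squash: "unsquash (squash x) = x"
  by (simp add: squash_def unsquash_def tan_arctan)

lemma squash_bounds: "0 < squash x" "squash x < 1"
  using arctan_bounded[of x] pi_gt_zero by (auto simp: squash_def field_simps)

definition encode_seq :: "(nat \<Rightarrow> real) \<Rightarrow> real" where
  "encode_seq x = (\<Sum>m. real_of_int (binary_digit (snd (prod_decode m)) (squash (x (fst (prod_decode m))))) / 3 ^ Suc m)"

definition decode_seq :: "real \<Rightarrow> nat \<Rightarrow> real" where
  "decode_seq z i = unsquash (\<Sum>k. real_of_int (ternary_digit (prod_encode (i, k)) z) / 2 ^ Suc k)"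

lemma decode_encode: "decode_seq (encode_seq x) = x"
proof
  fix i
  define d where "d m = binary_digit (snd (prod_decode m)) (squash (x (fst (prod_decode m))))" for m
  have "d m \<in> {0, 1}" for m
    by (auto simp: d_def binary_digit_def)
  then have "ternary_digit (prod_encode (i, k)) (encode_seq x) = d (prod_encode (i, k))" for k
    unfolding encode_seq_def d_def[symmetric] by (rule ternary_digit_of_binary_sequence)
  then have "decode_seq (encode_seq x) i = unsquash (\<Sum>k. real_of_int (binary_digit k (squash (x i))) / 2 ^ Suc k)"
    by (simp add: decode_seq_def d_def)
  also have "(\<Sum>k. real_of_int (binary_digit k (squash (x i))) / 2 ^ Suc k) = squash (x i)"
    using binary_expansion[of "squash (x i)"] squash_bounds[of "x i"] by (simp add: sums_iff)
  finally show "decode_seq (encode_seq x) i = x i" by (simp add: unsquash_squash)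
qed

lemma measurable_binary_digit [measurable]: "(\<lambda>y. real_of_int (binary_digit k y)) \<in> borel_measurable borel"
  unfolding binary_digit_def by measurable

lemma measurable_ternary_digit [measurable]: "(\<lambda>y. real_of_int (ternary_digit k y)) \<in> borel_measurable borel"
  unfolding ternary_digit_def by measurable

lemma measurable_squash [measurable]: "squash \<in> borel_measurable borel"
  unfolding squash_def[abs_def] by (intro borel_measurable_continuous_onI continuous_intros) auto

lemma measurable_unsquash [measurable]: "unsquash \<in> borel_measurable borel"
  unfolding unsquash_def[abs_def] tan_def by measurable

lemma measurable_encode_seq [measurable]: "encode_seq \<in> borel_measurable (Pi\<^sub>M UNIV (\<lambda>_. borel))"
  unfolding encode_seq_def[abs_def]
proof (rule borel_measurable_suminf)
  fix m
  have "(\<lambda>x. real_of_int (binary_digit (snd (prod_decode m)) (squash (x (fst (prod_decode m))))))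
      \<in> borel_measurable (Pi\<^sub>M UNIV (\<lambda>_. borel))"
    by (rule measurable_compose[OF measurable_compose[OF borel_measurable_coordinate measurable_squash] measurable_binary_digit])
  then show "(\<lambda>x. real_of_int (binary_digit (snd (prod_decode m)) (squash (x (fst (prod_decode m))))) / 3 ^ Suc m)
      \<in> borel_measurable (Pi\<^sub>M UNIV (\<lambda>_. borel))"
    by (rule borel_measurable_divide) simp
qed

lemma measurable_decode_seq [measurable]: "decode_seq \<in> borel \<rightarrow>\<^sub>M Pi\<^sub>M UNIV (\<lambda>_. borel)"
proof (rule measurable_PiM_single')
  fix i show "(\<lambda>z. decode_seq z i) \<in> borel_measurable borel"
    unfolding decode_seq_def by measurable
qed auto

text \<open>
  The code of a random element is a random real number. Its quantile function maps the uniform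
  distribution to its law, and decoding maps that law to the given measure. Any measurable
  space that embeds into the sequences of reals with a measurable left inverse can be treated in this way.
\<close>

lemma exists_parameter:
  assumes P: "prob_space P"
    and e: "e \<in> P \<rightarrow>\<^sub>M Pi\<^sub>M UNIV (\<lambda>_::nat. borel :: real measure)"
    and d: "d \<in> Pi\<^sub>M UNIV (\<lambda>_. borel) \<rightarrow>\<^sub>M P"
    and de: "\<And>w. w \<in> space P \<Longrightarrow> d (e w) = w"
  shows "\<exists>\<Psi> \<in> restrict_space lborel {0..<1::real} \<rightarrow>\<^sub>M P. distr (restrict_space lborel {0..<1}) P \<Psi> = P"
proof -
  interpret P: prob_space P by fact
  define enc where "enc = (\<lambda>w. encode_seq (e w))"
  define dec where "dec = (\<lambda>z. d (decode_seq z))"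
  have enc [measurable]: "enc \<in> borel_measurable P"
    unfolding enc_def by (rule measurable_compose[OF e measurable_encode_seq])
  have dec [measurable]: "dec \<in> borel \<rightarrow>\<^sub>M P"
    unfolding dec_def by (rule measurable_compose[OF measurable_decode_seq d])
  have dec_enc: "dec (enc w) = w" if "w \<in> space P" for w
    using that by (simp add: dec_def enc_def decode_encode de)
  define \<mu> where "\<mu> = distr P borel enc"
  interpret \<mu>: cdf_distribution \<mu>
    unfolding \<mu>_def cdf_distribution_def real_distribution_def real_distribution_axioms_def
    by (auto intro: P.prob_space_distr)
  let ?J = "restrict_space lborel {0<..<1} :: real measure" and ?K = "restrict_space lborel {0..<1} :: real measure"
  (* The quantile function is only controlled on the open interval; 0 is a null set. *)
  define \<Psi> where "\<Psi> s = dec (if 0 < s \<and> s < 1 then \<mu>.I s else 0)" for s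
  have I: "(\<lambda>s. if 0 < s \<and> s < 1 then \<mu>.I s else 0) \<in> borel_measurable borel"
  proof -
    have "(\<lambda>s. if s \<in> {0<..<1} then \<mu>.I s else 0) \<in> borel_measurable borel"
      using \<mu>.measurable_CI by (subst (asm) measurable_restrict_space_iff) auto
    then show ?thesis by simp
  qed
  have \<Psi>: "\<Psi> \<in> borel \<rightarrow>\<^sub>M P"
    unfolding \<Psi>_def by (rule measurable_compose[OF I dec])
  have \<Psi>K: "\<Psi> \<in> ?K \<rightarrow>\<^sub>M P" and \<Psi>J: "\<Psi> \<in> ?J \<rightarrow>\<^sub>M P"
    using \<Psi> by (auto intro!: measurable_restrict_space1)
  have "distr ?K P \<Psi> = distr ?J P \<Psi>"
  proof (rule measure_eqI)
    fix A assume "A \<in> sets (distr ?K P \<Psi>)"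
    then have A: "A \<in> sets P" by simp
    have S: "\<Psi> -` A \<in> sets borel" using measurable_sets[OF \<Psi> A] by simp
    have "emeasure (distr ?K P \<Psi>) A = emeasure lborel (\<Psi> -` A \<inter> {0..<1})"
      using S by (simp add: emeasure_distr[OF \<Psi>K A] space_restrict_space emeasure_restrict_space)
    also have "\<dots> = emeasure lborel (\<Psi> -` A \<inter> {0<..<1})"
    proof (rule emeasure_eq_AE)
      show "AE s in lborel. s \<in> \<Psi> -` A \<inter> {0..<1} \<longleftrightarrow> s \<in> \<Psi> -` A \<inter> {0<..<1}"
        using AE_lborel_singleton[of 0] by eventually_elim auto
    qed (use S in auto)
    also have "\<dots> = emeasure (distr ?J P \<Psi>) A"
      using S by (simp add: emeasure_distr[OF \<Psi>J A] space_restrict_space emeasure_restrict_space)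
    finally show "emeasure (distr ?K P \<Psi>) A = emeasure (distr ?J P \<Psi>) A" .
  qed simp
  also have "distr ?J P \<Psi> = distr ?J P (\<lambda>s. dec (\<mu>.I s))"
    by (rule distr_cong) (auto simp: \<Psi>_def space_restrict_space)
  also have "\<dots> = distr (distr ?J borel \<mu>.I) P dec"
  proof -
    have "\<mu>.I \<in> borel_measurable ?J"
      using \<mu>.measurable_CI by (simp add: measurable_cong_sets[OF sets_restrict_space_cong[OF sets_lborel] refl])
    then show ?thesis by (subst distr_distr) (auto simp: comp_def)
  qed
  also have "distr ?J borel \<mu>.I = \<mu>" by (rule \<mu>.distr_I_eq_M)
  also have "distr \<mu> P dec = distr P P (\<lambda>w. dec (enc w))"
    unfolding \<mu>_def by (subst distr_distr) (auto simp: comp_def)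
  also have "\<dots> = P"
    using dec_enc by (simp add: distr_id2 cong: distr_cong)
  finally have "distr ?K P \<Psi> = P" .
  then show ?thesis using \<Psi>K by (intro bexI[of _ \<Psi>])
qed

lemma exists_parameter_model_space:
  "\<exists>\<Psi> \<in> restrict_space lborel {0..<1::real} \<rightarrow>\<^sub>M model_space. distr (restrict_space lborel {0..<1}) model_space \<Psi> = model_space"
proof (rule exists_parameter[OF model_space.prob_space_axioms])
  let ?S = "Pi\<^sub>M UNIV (\<lambda>_::nat. borel :: real measure)"
  have "(\<lambda>p. case_nat (snd p) (fst p)) \<in> ?S \<Otimes>\<^sub>M borel \<rightarrow>\<^sub>M ?S"
  proof (rule measurable_PiM_single')
    fix i
    show "(\<lambda>p. (case i of 0 \<Rightarrow> snd p | Suc k \<Rightarrow> fst p k)) \<in> borel_measurable (?S \<Otimes>\<^sub>M borel)"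
      by (cases i) simp_all
  qed auto
  then show "(\<lambda>p. case_nat (snd p) (fst p)) \<in> model_space \<rightarrow>\<^sub>M ?S"
    by (simp cong: measurable_cong_sets)
  have "(\<lambda>y. (\<lambda>i. y (Suc i), y 0)) \<in> ?S \<rightarrow>\<^sub>M ?S \<Otimes>\<^sub>M borel"
    by (intro measurable_Pair measurable_PiM_single') (auto intro: borel_measurable_coordinate)
  then show "(\<lambda>y. (\<lambda>i. y (Suc i), y 0)) \<in> ?S \<rightarrow>\<^sub>M model_space"
    by (simp cong: measurable_cong_sets)
qed auto

section \<open>Consequences of a coupling with small quadratic cost\<close>

text \<open>
  If the expectations of \<open>f\<close> stayed away from the limit along a subsequence, then a further subsequence
  of the points would converge almost surely, because the squared distances tend to \<open>0\<close> in mean,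
  and dominated convergence would give a contradiction.
\<close>

lemma weakly_converges_to_coupling:
  fixes X :: "nat \<Rightarrow> 'w \<Rightarrow> 'a::{metric_space, second_countable_topology}"
  assumes "prob_space M"
    and X [measurable]: "\<And>j. X j \<in> borel_measurable M" and Z [measurable]: "Z \<in> borel_measurable M"
    and E: "\<And>j. (\<integral>\<^sup>+w. ennreal ((dist (X j w) (Z w))\<^sup>2) \<partial>M) \<le> ennreal (B j)"
    and B: "B \<longlonglongrightarrow> 0" "\<And>j. 0 \<le> B j"
  shows "weakly_converges_to (\<lambda>j. distr M borel (X j)) (distr M borel Z)"
  unfolding weakly_converges_to_def
proof (intro allI impI)
  interpret M: prob_space M by fact
  fix f :: "'a \<Rightarrow> real"
  assume f: "continuous_on UNIV f \<and> bounded (range f)"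
  then have [measurable]: "f \<in> borel_measurable borel" by (auto intro: borel_measurable_continuous_onI)
  obtain K where K: "\<And>x. \<bar>f x\<bar> \<le> K" using f by (auto simp: bounded_iff)
  define c where "c j = (\<integral>w. f (X j w) \<partial>M)" for j
  define c0 where "c0 = (\<integral>w. f (Z w) \<partial>M)"
  have int: "integrable M (\<lambda>w. (dist (X j w) (Z w))\<^sup>2)"
    and int_le: "(\<integral>w. (dist (X j w) (Z w))\<^sup>2 \<partial>M) \<le> B j" for j
  proof -
    show "integrable M (\<lambda>w. (dist (X j w) (Z w))\<^sup>2)"
      using le_less_trans[OF E[of j] ennreal_less_top] by (intro integrableI_nonneg) auto
    then have "ennreal (\<integral>w. (dist (X j w) (Z w))\<^sup>2 \<partial>M) \<le> ennreal (B j)"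
      using E[of j] by (subst nn_integral_eq_integral[symmetric]) auto
    then show "(\<integral>w. (dist (X j w) (Z w))\<^sup>2 \<partial>M) \<le> B j" using B(2)[of j] by simp
  qed
  have "c \<longlonglongrightarrow> c0"
  proof (rule ccontr)
    assume "\<not> c \<longlonglongrightarrow> c0"
    then obtain e where e: "0 < e" "\<not> (\<forall>\<^sub>F j in sequentially. dist (c j) c0 < e)"
      by (auto simp: tendsto_iff)
    have "\<exists>j\<ge>N. e \<le> dist (c j) c0" for N
      using e(2) by (auto simp: eventually_sequentially not_less)
    then have "infinite {j. e \<le> dist (c j) c0}"
      by (auto simp: infinite_nat_iff_unbounded_le)
    then obtain r :: "nat \<Rightarrow> nat" where r: "strict_mono r" "\<And>k. e \<le> dist (c (r k)) c0"
      using infinite_enumerate[of "{j. e \<le> dist (c j) c0}"] by auto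
    have "(\<lambda>k. \<integral>w. norm ((dist (X (r k) w) (Z w))\<^sup>2) \<partial>M) \<longlonglongrightarrow> 0"
    proof (rule tendsto_sandwich)
      show "\<forall>\<^sub>F k in sequentially. (\<integral>w. norm ((dist (X (r k) w) (Z w))\<^sup>2) \<partial>M) \<le> B (r k)"
        using int_le by simp
      show "\<forall>\<^sub>F k in sequentially. (0 :: real) \<le> (\<integral>w. norm ((dist (X (r k) w) (Z w))\<^sup>2) \<partial>M)"
        by simp
      show "(\<lambda>k. B (r k)) \<longlonglongrightarrow> 0" using LIMSEQ_subseq_LIMSEQ[OF B(1) r(1)] by (simp add: comp_def)
    qed simp
    then obtain s :: "nat \<Rightarrow> nat" where s: "strict_mono s"
      "AE w in M. (\<lambda>k. (dist (X (r (s k)) w) (Z w))\<^sup>2) \<longlonglongrightarrow> 0"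
      using tendsto_L1_AE_subseq[of M "\<lambda>k w. (dist (X (r k) w) (Z w))\<^sup>2"] int by auto
    have "(\<lambda>k. c (r (s k))) \<longlonglongrightarrow> c0"
      unfolding c_def c0_def
    proof (rule integral_dominated_convergence)
      show "AE w in M. (\<lambda>k. f (X (r (s k)) w)) \<longlonglongrightarrow> f (Z w)"
        using s(2)
      proof eventually_elim
        case (elim w)
        then have "(\<lambda>k. sqrt ((dist (X (r (s k)) w) (Z w))\<^sup>2)) \<longlonglongrightarrow> sqrt 0" by (rule tendsto_real_sqrt)
        then have "(\<lambda>k. X (r (s k)) w) \<longlonglongrightarrow> Z w" by (subst tendsto_dist_iff) simp
        with f show ?case by (intro continuous_on_tendsto_compose[of UNIV f]) auto
      qed
      show "integrable M (\<lambda>_. K)" by simp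
    qed (use K in auto)
    then have "\<forall>\<^sub>F k in sequentially. dist (c (r (s k))) c0 < e" using e(1) by (auto simp: tendsto_iff)
    then show False using r(2) by (auto simp: eventually_sequentially not_le[symmetric])
  qed
  then show "(\<lambda>j. \<integral>x. f x \<partial>distr M borel (X j)) \<longlonglongrightarrow> (\<integral>x. f x \<partial>distr M borel Z)"
    by (simp add: c_def[abs_def] c0_def integral_distr)
qed

lemma W2_coupling_le:
  fixes X Z :: "'w \<Rightarrow> 'a::{metric_space, second_countable_topology}"
  assumes X [measurable]: "X \<in> borel_measurable M" and Z [measurable]: "Z \<in> borel_measurable M"
    and E: "(\<integral>\<^sup>+w. ennreal ((dist (X w) (Z w))\<^sup>2) \<partial>M) \<le> ennreal B" and B: "0 \<le> B"
  shows "W2 (distr M borel X) (distr M borel Z) \<le> ennreal (sqrt B)"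
proof -
  define \<pi> where "\<pi> = distr M (borel \<Otimes>\<^sub>M borel) (\<lambda>w. (X w, Z w))"
  have "\<pi> \<in> couplings (distr M borel X) (distr M borel Z)"
  proof -
    have "distr \<pi> (distr M borel X) fst = distr M (distr M borel X) X"
      unfolding \<pi>_def by (subst distr_distr) (auto simp: comp_def)
    moreover have "distr M (distr M borel X) X = distr M borel X" by (rule distr_cong) simp_all
    moreover have "distr \<pi> (distr M borel Z) snd = distr M (distr M borel Z) Z"
      unfolding \<pi>_def by (subst distr_distr) (auto simp: comp_def)
    moreover have "distr M (distr M borel Z) Z = distr M borel Z" by (rule distr_cong) simp_all
    moreover have "sets \<pi> = sets (distr M borel X \<Otimes>\<^sub>M distr M borel Z)"
      unfolding \<pi>_def sets_distr by (rule sets_pair_measure_cong) simp_all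
    ultimately show ?thesis by (simp add: couplings_def)
  qed
  then have "W2 (distr M borel X) (distr M borel Z)
      \<le> ennreal_sqrt (\<integral>\<^sup>+ (x, x'). ennreal ((dist x x')\<^sup>2) \<partial>\<pi>)"
    unfolding W2_def by (rule INF_lower)
  also have "(\<integral>\<^sup>+ (x, x'). ennreal ((dist x x')\<^sup>2) \<partial>\<pi>) = (\<integral>\<^sup>+w. ennreal ((dist (X w) (Z w))\<^sup>2) \<partial>M)"
    unfolding \<pi>_def by (subst nn_integral_distr) auto
  also have "ennreal_sqrt \<dots> \<le> ennreal (sqrt B)"
  proof -
    have "enn2real (\<integral>\<^sup>+w. ennreal ((dist (X w) (Z w))\<^sup>2) \<partial>M) \<le> B"
      using E B by (metis enn2real_ennreal enn2real_mono ennreal_less_top)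
    moreover have "(\<integral>\<^sup>+w. ennreal ((dist (X w) (Z w))\<^sup>2) \<partial>M) \<noteq> \<top>" using E by (auto simp: top_unique)
    ultimately show ?thesis by (simp add: ennreal_sqrt_def ennreal_leI)
  qed
  finally show ?thesis .
qed

lemma parameter_compose:
  assumes \<Psi>: "\<Psi> \<in> restrict_space lborel {0..<1} \<rightarrow>\<^sub>M M" "distr (restrict_space lborel {0..<1}) M \<Psi> = M"
    and k: "k \<in> M \<rightarrow>\<^sub>M snd X" "distr M (snd X) k = snd X"
  shows "(\<lambda>s. k (\<Psi> s)) \<in> parameters X"
proof -
  let ?K = "restrict_space lborel {0..<1::real}"
  have "(\<lambda>s. k (\<Psi> s)) \<in> ?K \<rightarrow>\<^sub>M snd X" using measurable_compose[OF \<Psi>(1) k(1)] .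
  moreover have "distr ?K (snd X) (\<lambda>s. k (\<Psi> s)) = distr (distr ?K M \<Psi>) (snd X) k"
    using k \<Psi> by (subst distr_distr) (auto simp: comp_def)
  then have "distr ?K (snd X) (\<lambda>s. k (\<Psi> s)) = snd X" using \<Psi>(2) k(2) by simp
  ultimately show ?thesis by (cases X) (simp add: parameters_def)
qed

text \<open>
  The function \<open>h\<close> is the distance of the coupled points after an embedding into a common space. By
  Chebyshev's inequality \<open>h > \<epsilon>/2\<close> has probability at most \<open>4 B / \<epsilon>\<^sup>2\<close>, and this is \<open>\<epsilon>\<close> for
  \<open>\<epsilon>\<^sup>3 = 4 B\<close>. Where \<open>h \<le> \<epsilon>/2\<close>, the two distances differ by at most \<open>\<epsilon>\<close>.
\<close>

lemma box_dist_coupling_le: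
  fixes X :: "'a mm" and Y :: "'b mm"
  assumes M: "prob_space M"
    and \<Psi>: "\<Psi> \<in> restrict_space lborel {0..<1::real} \<rightarrow>\<^sub>M M" "distr (restrict_space lborel {0..<1}) M \<Psi> = M"
    and f: "f \<in> M \<rightarrow>\<^sub>M snd X" "distr M (snd X) f = snd X"
    and g: "g \<in> M \<rightarrow>\<^sub>M snd Y" "distr M (snd Y) g = snd Y"
    and h: "h \<in> borel_measurable M" "\<And>p. 0 \<le> h p"
    and dist: "\<And>p q. p \<in> space M \<Longrightarrow> q \<in> space M \<Longrightarrow>
      \<bar>mdist (fst X) (f p) (f q) - mdist (fst Y) (g p) (g q)\<bar> \<le> h p + h q"
    and E: "(\<integral>\<^sup>+p. ennreal ((h p)\<^sup>2) \<partial>M) \<le> ennreal B" and B: "0 < B"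
  shows "box_dist X Y \<le> ennreal (root 3 (4 * B))"
proof -
  interpret M: prob_space M by fact
  note [measurable] = h(1)
  let ?K = "restrict_space lborel {0..<1::real}"
  define \<epsilon> where "\<epsilon> = root 3 (4 * B)"
  have \<epsilon>: "0 < \<epsilon>" "\<epsilon> ^ 3 = 4 * B" using B by (simp_all add: \<epsilon>_def)
  define S where "S = {p \<in> space M. h p \<le> \<epsilon> / 2}"
  have S [measurable]: "S \<in> sets M" unfolding S_def by measurable
  have "emeasure M (space M - S) \<le> emeasure M {p \<in> space M. 1 \<le> ennreal (4 / \<epsilon>\<^sup>2) * ennreal ((h p)\<^sup>2)}"
  proof (rule emeasure_mono)
    show "space M - S \<subseteq> {p \<in> space M. 1 \<le> ennreal (4 / \<epsilon>\<^sup>2) * ennreal ((h p)\<^sup>2)}"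
    proof
      fix p assume "p \<in> space M - S"
      then have p: "p \<in> space M" "\<epsilon> / 2 < h p" by (auto simp: S_def)
      then have "(\<epsilon> / 2)\<^sup>2 \<le> (h p)\<^sup>2" using \<epsilon>(1) by (intro power_mono) auto
      then have "1 \<le> 4 / \<epsilon>\<^sup>2 * (h p)\<^sup>2" using \<epsilon>(1) by (simp add: field_simps)
      then have "ennreal 1 \<le> ennreal (4 / \<epsilon>\<^sup>2) * ennreal ((h p)\<^sup>2)"
        by (subst ennreal_mult[symmetric]) (auto intro: ennreal_leI)
      with p show "p \<in> {p \<in> space M. 1 \<le> ennreal (4 / \<epsilon>\<^sup>2) * ennreal ((h p)\<^sup>2)}" by simp
    qed
  qed measurable
  also have "\<dots> \<le> ennreal (4 / \<epsilon>\<^sup>2) * (\<integral>\<^sup>+p. ennreal ((h p)\<^sup>2) * indicator (space M) p \<partial>M)"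
    by (rule nn_integral_Markov_inequality) measurable
  also have "(\<integral>\<^sup>+p. ennreal ((h p)\<^sup>2) * indicator (space M) p \<partial>M) = (\<integral>\<^sup>+p. ennreal ((h p)\<^sup>2) \<partial>M)"
    by (rule nn_integral_cong) simp
  also have "ennreal (4 / \<epsilon>\<^sup>2) * (\<integral>\<^sup>+p. ennreal ((h p)\<^sup>2) \<partial>M) \<le> ennreal (4 / \<epsilon>\<^sup>2) * ennreal B"
    by (rule mult_left_mono[OF E]) simp
  also have "\<dots> = ennreal (4 / \<epsilon>\<^sup>2 * B)" using B by (subst ennreal_mult) auto
  also have "4 / \<epsilon>\<^sup>2 * B = \<epsilon>"
  proof -
    have "4 / \<epsilon>\<^sup>2 * B = \<epsilon> ^ 3 / \<epsilon>\<^sup>2" by (simp add: \<epsilon>(2))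
    also have "\<dots> = \<epsilon>" using \<epsilon>(1) by (simp add: power2_eq_square power3_eq_cube)
    finally show ?thesis .
  qed
  finally have "M.prob (space M - S) \<le> \<epsilon>"
    using \<epsilon>(1) by (simp add: M.emeasure_eq_measure)
  then have probS: "1 - \<epsilon> \<le> M.prob S" using M.prob_compl[OF S] by simp
  define J where "J = \<Psi> -` S \<inter> {0..<1}"
  have JK: "J \<in> sets ?K" using measurable_sets[OF \<Psi>(1) S] by (simp add: J_def space_restrict_space)
  then have J: "J \<in> sets borel" by (simp add: sets_restrict_space_iff)
  have "M.prob S = measure (distr ?K M \<Psi>) S" by (simp add: \<Psi>(2))
  also have "\<dots> = measure ?K J"
    using \<Psi>(1) S by (simp add: measure_distr J_def space_restrict_space)
  also have "\<dots> = measure lborel J"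
    by (rule measure_restrict_space) (auto simp: J_def)
  finally have Jm: "1 - \<epsilon> \<le> measure lborel J" using probS by simp
  have close: "\<bar>mdist (fst X) (f (\<Psi> s)) (f (\<Psi> t)) - mdist (fst Y) (g (\<Psi> s)) (g (\<Psi> t))\<bar> \<le> \<epsilon>"
    if "s \<in> J" "t \<in> J" for s t
  proof -
    have "\<Psi> s \<in> S" "\<Psi> t \<in> S" using that by (auto simp: J_def)
    then show ?thesis using dist[of "\<Psi> s" "\<Psi> t"] by (auto simp: S_def)
  qed
  have "ennreal \<epsilon> \<in> {ennreal \<epsilon> | \<epsilon>. 0 \<le> \<epsilon> \<and>
     (\<exists>\<phi>\<in>parameters X. \<exists>\<psi>\<in>parameters Y. \<exists>J\<in>sets borel.
        J \<subseteq> {0..<1} \<and> measure lborel J \<ge> 1 - \<epsilon> \<and>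
        (\<forall>s\<in>J. \<forall>t\<in>J.
           \<bar>mdist (fst X) (\<phi> s) (\<phi> t) - mdist (fst Y) (\<psi> s) (\<psi> t)\<bar> \<le> \<epsilon>))}"
  proof (intro CollectI exI[of _ \<epsilon>] conjI refl bexI)
    show "\<forall>s\<in>J. \<forall>t\<in>J. \<bar>mdist (fst X) (f (\<Psi> s)) (f (\<Psi> t)) - mdist (fst Y) (g (\<Psi> s)) (g (\<Psi> t))\<bar> \<le> \<epsilon>"
      using close by blast
    show "(\<lambda>s. f (\<Psi> s)) \<in> parameters X" by (rule parameter_compose[OF \<Psi> f])
    show "(\<lambda>s. g (\<Psi> s)) \<in> parameters Y" by (rule parameter_compose[OF \<Psi> g])
  qed (use \<epsilon>(1) J Jm in \<open>auto simp: J_def\<close>)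
  then show ?thesis unfolding box_dist_def \<epsilon>_def by (rule Inf_lower)
qed

section \<open>The quadratic cost vanishes in the limit\<close>

text \<open>
  The sums \<open>\<Sum>A\<^sub>i\<^sup>2\<close> stay bounded, by \<open>2 \<Sum>(A\<^sub>i - a\<^sub>i)\<^sup>2 + 2 \<Sum>a\<^sub>i\<^sup>2\<close>.
\<close>

lemma coupled_dist_bound_tendsto:
  fixes n :: "nat \<Rightarrow> nat" and A :: "nat \<Rightarrow> nat \<Rightarrow> real"
  assumes n: "filterlim n at_top sequentially" and a: "summable (\<lambda>i. (a i)\<^sup>2)"
    and A: "(\<lambda>j. \<Sum>i<n j. (A i j - a i)\<^sup>2) \<longlonglongrightarrow> 0"
    and \<tau>: "\<tau> \<longlonglongrightarrow> 0" "\<And>j. 0 \<le> \<tau> j"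
  shows "(\<lambda>j. 3 * (\<tau> j * (\<Sum>i<n j. (A i j)\<^sup>2) + (\<Sum>i<n j. (A i j - a i)\<^sup>2)
      + 5 / real (n j) * (\<Sum>i<n j. (a i)\<^sup>2)) + (\<Sum>i. (a (i + n j))\<^sup>2)) \<longlonglongrightarrow> 0"
proof (rule tendsto_sandwich[OF always_eventually always_eventually])
  define S where "S = (\<Sum>i. (a i)\<^sup>2)"
  define D where "D j = (\<Sum>i<n j. (A i j - a i)\<^sup>2)" for j
  have S: "(\<Sum>i<N. (a i)\<^sup>2) \<le> S" for N
    unfolding S_def by (rule sum_le_suminf[OF a]) auto
  have tail: "(\<Sum>i. (a (i + N))\<^sup>2) = S - (\<Sum>i<N. (a i)\<^sup>2)" for N
    unfolding S_def by (rule suminf_minus_initial_segment[OF a])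
  have AD: "(\<Sum>i<n j. (A i j)\<^sup>2) \<le> 2 * D j + 2 * S" for j
  proof -
    have "(A i j)\<^sup>2 \<le> 2 * (A i j - a i)\<^sup>2 + 2 * (a i)\<^sup>2" for i
      using sum_squares_ge_zero[of "A i j - 2 * a i" 0] by (simp add: power2_eq_square algebra_simps)
    then have "(\<Sum>i<n j. (A i j)\<^sup>2) \<le> (\<Sum>i<n j. 2 * (A i j - a i)\<^sup>2 + 2 * (a i)\<^sup>2)" by (intro sum_mono)
    also have "\<dots> = 2 * D j + 2 * (\<Sum>i<n j. (a i)\<^sup>2)" by (simp add: D_def sum.distrib sum_distrib_left)
    finally show ?thesis using S[of "n j"] by simp
  qed
  show "\<forall>j. 3 * (\<tau> j * (\<Sum>i<n j. (A i j)\<^sup>2) + (\<Sum>i<n j. (A i j - a i)\<^sup>2)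
      + 5 / real (n j) * (\<Sum>i<n j. (a i)\<^sup>2)) + (\<Sum>i. (a (i + n j))\<^sup>2)
    \<le> 3 * (\<tau> j * (2 * D j + 2 * S) + D j + 5 / real (n j) * S) + (S - (\<Sum>i<n j. (a i)\<^sup>2))"
    unfolding tail D_def[symmetric] using AD S \<tau>(2)
    by (intro allI add_mono mult_left_mono order_refl) auto
  show "\<forall>j. 0 \<le> 3 * (\<tau> j * (\<Sum>i<n j. (A i j)\<^sup>2) + (\<Sum>i<n j. (A i j - a i)\<^sup>2)
      + 5 / real (n j) * (\<Sum>i<n j. (a i)\<^sup>2)) + (\<Sum>i. (a (i + n j))\<^sup>2)"
    using \<tau>(2) S by (auto intro!: add_nonneg_nonneg mult_nonneg_nonneg divide_nonneg_nonneg sum_nonneg simp: tail)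
  have D: "D \<longlonglongrightarrow> 0" using A by (simp add: D_def[abs_def])
  have n': "(\<lambda>j. 5 / real (n j)) \<longlonglongrightarrow> 0"
    by (intro tendsto_divide_0[OF tendsto_const] filterlim_at_top_imp_at_infinity
        filterlim_compose[OF filterlim_real_sequentially n])
  have t: "(\<lambda>j. \<Sum>i<n j. (a i)\<^sup>2) \<longlonglongrightarrow> S"
    unfolding S_def by (rule filterlim_compose[OF summable_LIMSEQ[OF a] n])
  have "(\<lambda>j. 3 * (\<tau> j * (2 * D j + 2 * S) + D j + 5 / real (n j) * S) + (S - (\<Sum>i<n j. (a i)\<^sup>2)))
      \<longlonglongrightarrow> 3 * (0 * (2 * 0 + 2 * S) + 0 + 0 * S) + (S - S)"
    by (intro tendsto_intros \<tau> D n' t)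
  then show "(\<lambda>j. 3 * (\<tau> j * (2 * D j + 2 * S) + D j + 5 / real (n j) * S) + (S - (\<Sum>i<n j. (a i)\<^sup>2))) \<longlonglongrightarrow> 0"
    by simp
qed simp

section \<open>Coordinate spaces as subspaces of the Hilbert space\<close>

abbreviation top_Rn :: "nat \<Rightarrow> (nat \<Rightarrow> real) topology" where
  "top_Rn n \<equiv> mtopology_of (metric_Rn n)"

lemma norm_l2_finite:
  assumes "\<And>i. n \<le> i \<Longrightarrow> coord x i = 0"
  shows "norm x = L2_set (coord x) {..<n}"
proof -
  have "(norm x)\<^sup>2 = (\<Sum>i<n. (coord x i)\<^sup>2)"
    unfolding norm_l2_sq using assms by (intro suminf_finite) (auto simp: not_less)
  then show ?thesis by (simp add: L2_set_def real_sqrt_unique)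
qed

lemma dist_embed: "dist (embed n x) (embed n y) = mdist (metric_Rn n) x y"
proof -
  have "dist (embed n x) (embed n y) = L2_set (coord (embed n x - embed n y)) {..<n}"
    unfolding dist_norm by (rule norm_l2_finite) (simp add: coord_simps coord_embed)
  also have "\<dots> = L2_set (\<lambda>i. x i - y i) {..<n}"
    by (rule L2_set_cong) (simp_all add: coord_simps coord_embed)
  finally show ?thesis by simp
qed

text \<open>
  As \<open>embed n\<close> is an isometry, the topology of the coordinate space is induced from the Hilbert space. This
  reduces its closed sets, countable base and Borel sets to facts about \<open>l2\<close>.
\<close>

lemma openin_top_Rn_iff:
  "openin (top_Rn n) U \<longleftrightarrow> (\<exists>W. open W \<and> U = {x \<in> Rn n. embed n x \<in> W})"
proof -
  interpret R: Metric_space "Rn n" "mdist (metric_Rn n)"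
    using Metric_space_mspace_mdist[of "metric_Rn n"] by simp
  have top: "top_Rn n = R.mtopology" by (simp add: mtopology_of_def)
  have ball: "R.mball x r = {y \<in> Rn n. embed n y \<in> ball (embed n x) r}" if "x \<in> Rn n" for x r
    using that by (auto simp: R.mball_def dist_embed simp del: mdist_metric_Rn)
  show ?thesis
  proof
    assume "openin (top_Rn n) U"
    then have U: "U \<subseteq> Rn n" "\<And>x. x \<in> U \<Longrightarrow> \<exists>r>0. R.mball x r \<subseteq> U"
      unfolding top R.openin_mtopology by auto
    then obtain r where r: "\<And>x. x \<in> U \<Longrightarrow> 0 < r x" "\<And>x. x \<in> U \<Longrightarrow> R.mball x (r x) \<subseteq> U" by metis
    define W where "W = (\<Union>x\<in>U. ball (embed n x) (r x))"
    have "U = {x \<in> Rn n. embed n x \<in> W}"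
    proof (intro equalityI subsetI)
      fix x assume "x \<in> U"
      then show "x \<in> {x \<in> Rn n. embed n x \<in> W}" using U(1) r(1)[of x] by (auto simp: W_def intro!: bexI[of _ x])
    next
      fix y assume "y \<in> {x \<in> Rn n. embed n x \<in> W}"
      then obtain x where "x \<in> U" "y \<in> Rn n" "embed n y \<in> ball (embed n x) (r x)" by (auto simp: W_def)
      then show "y \<in> U" using ball[of x "r x"] r(2)[of x] U(1) by blast
    qed
    moreover have "open W" by (auto simp: W_def)
    ultimately show "\<exists>W. open W \<and> U = {x \<in> Rn n. embed n x \<in> W}" by blast
  next
    assume "\<exists>W. open W \<and> U = {x \<in> Rn n. embed n x \<in> W}"
    then obtain W where W: "open W" "U = {x \<in> Rn n. embed n x \<in> W}" by blast
    show "openin (top_Rn n) U"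
      unfolding top R.openin_mtopology
    proof (intro conjI allI impI)
      fix x assume "x \<in> U"
      then have x: "x \<in> Rn n" "embed n x \<in> W" using W by auto
      then obtain r where "0 < r" "ball (embed n x) r \<subseteq> W" using W(1) by (meson open_contains_ball)
      then show "\<exists>r>0. R.mball x r \<subseteq> U" using ball[OF x(1)] W(2) by (intro exI[of _ r]) auto
    qed (use W in auto)
  qed
qed

lemma topspace_top_Rn: "topspace (top_Rn n) = Rn n"
  by simp

lemma closedin_top_RnI:
  assumes "closed C" "E = {x \<in> Rn n. embed n x \<in> C}"
  shows "closedin (top_Rn n) E"
proof -
  have "Rn n - E = {x \<in> Rn n. embed n x \<in> - C}" using assms by auto
  moreover have "open (- C)" using assms by auto
  ultimately have "openin (top_Rn n) (Rn n - E)" unfolding openin_top_Rn_iff by blast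
  then show ?thesis using assms by (auto simp: closedin_def)
qed

lemma second_countable_top_Rn: "second_countable (top_Rn n)"
proof -
  obtain B :: "l2 set set" where B: "countable B" "topological_basis B"
    using ex_countable_basis by blast
  define B' where "B' = (\<lambda>W. {x \<in> Rn n. embed n x \<in> W}) ` B"
  show ?thesis
    unfolding second_countable_def
  proof (intro exI[of _ B'] conjI allI impI ballI)
    show "countable B'" using B by (simp add: B'_def)
    fix V assume "V \<in> B'"
    then show "openin (top_Rn n) V"
      unfolding openin_top_Rn_iff B'_def using topological_basis_open[OF B(2)] by blast
  next
    fix U x assume "openin (top_Rn n) U \<and> x \<in> U"
    then obtain W where W: "open W" "U = {x \<in> Rn n. embed n x \<in> W}" "x \<in> Rn n" "embed n x \<in> W"
      unfolding openin_top_Rn_iff by auto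
    obtain V where "V \<in> B" "embed n x \<in> V" "V \<subseteq> W"
      using topological_basisE[OF B(2) W(1,4)] by blast
    then show "\<exists>V\<in>B'. x \<in> V \<and> V \<subseteq> U"
      using W unfolding B'_def by (intro bexI[of _ "{x \<in> Rn n. embed n x \<in> V}"]) auto
  qed
qed

text \<open>
  A Cauchy sequence converges in the Hilbert space, and truncating the limit to the first \<open>n\<close> coordinates
  does not increase its distance to points of the coordinate space.
\<close>

lemma mcomplete_of_metric_Rn: "mcomplete_of (metric_Rn n)"
proof -
  interpret R: Metric_space "Rn n" "mdist (metric_Rn n)"
    using Metric_space_mspace_mdist[of "metric_Rn n"] by simp
  have "R.mcomplete"
    unfolding R.mcomplete_def
  proof (intro allI impI)
    fix \<sigma> assume \<sigma>: "R.MCauchy \<sigma>"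
    then have "Cauchy (\<lambda>k. embed n (\<sigma> k))"
      unfolding R.MCauchy_def Cauchy_def dist_embed by meson
    then obtain z where z: "(\<lambda>k. embed n (\<sigma> k)) \<longlonglongrightarrow> z"
      using Cauchy_convergent_iff convergent_def by blast
    define y where "y = (\<lambda>i\<in>{..<n}. coord z i)"
    have le: "mdist (metric_Rn n) (\<sigma> k) y \<le> dist (embed n (\<sigma> k)) z" for k
    proof -
      have "(mdist (metric_Rn n) (\<sigma> k) y)\<^sup>2 = (\<Sum>i<n. (coord (embed n (\<sigma> k) - z) i)\<^sup>2)"
        by (simp add: L2_set_def sum_nonneg coord_simps coord_embed y_def)
      also have "\<dots> \<le> (norm (embed n (\<sigma> k) - z))\<^sup>2" by (rule sum_coord_sq_le)
      finally show ?thesis unfolding dist_norm by (rule power2_le_imp_le) simp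
    qed
    have "limitin R.mtopology \<sigma> y sequentially"
      unfolding R.limit_metric_sequentially
    proof (intro conjI allI impI)
      show "y \<in> Rn n" by (simp add: y_def)
      fix e :: real assume "0 < e"
      then obtain N where "\<And>k. N \<le> k \<Longrightarrow> dist (embed n (\<sigma> k)) z < e"
        using metric_LIMSEQ_D[OF z] by blast
      moreover have "\<sigma> k \<in> Rn n" for k using \<sigma> unfolding R.MCauchy_def by blast
      ultimately show "\<exists>N. \<forall>k\<ge>N. \<sigma> k \<in> Rn n \<and> mdist (metric_Rn n) (\<sigma> k) y < e"
        using le by (meson le_less_trans)
    qed
    then show "\<exists>x. limitin R.mtopology \<sigma> x sequentially" by blast
  qed
  then show ?thesis by (simp add: mcomplete_of_def)
qed

text \<open>
  The coordinates are continuous, which gives one inclusion. For the other, open sets are preimages of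
  open sets under the measurable map \<open>embed n\<close>.
\<close>

lemma sets_borel_Rn_eq_open: "sets (borel_Rn n) = sigma_sets (Rn n) {U. openin (top_Rn n) U}"
proof
  have sub: "{U. openin (top_Rn n) U} \<subseteq> Pow (Rn n)"
    using openin_subset[of "top_Rn n"] by (auto simp: topspace_top_Rn)
  define N where "N = sigma (Rn n) {U. openin (top_Rn n) U}"
  have N: "sets N = sigma_sets (Rn n) {U. openin (top_Rn n) U}" "space N = Rn n"
    using sub by (simp_all add: N_def)
  have "(\<lambda>x. x) \<in> N \<rightarrow>\<^sub>M borel_Rn n"
  proof (rule measurable_PiM_single')
    fix i assume "i \<in> {..<n}"
    then have i: "i < n" by simp
    show "(\<lambda>x. x i) \<in> borel_measurable N"
    proof (rule borel_measurableI)
      fix S :: "real set" assume "open S"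
      then have "open ((\<lambda>y. coord y i) -` S)" by (rule open_vimage[OF _ continuous_on_coord])
      moreover have "(\<lambda>x. x i) -` S \<inter> space N = {x \<in> Rn n. embed n x \<in> (\<lambda>y. coord y i) -` S}"
        using i by (auto simp: N coord_embed)
      ultimately have "openin (top_Rn n) ((\<lambda>x. x i) -` S \<inter> space N)"
        unfolding openin_top_Rn_iff by blast
      then show "(\<lambda>x. x i) -` S \<inter> space N \<in> sets N" by (auto simp: N(1) intro: sigma_sets.Basic)
    qed
  qed (simp add: N)
  then have "A \<in> sets N" if "A \<in> sets (borel_Rn n)" for A
  proof -
    have "(\<lambda>x. x) -` A \<inter> space N = A" using sets.sets_into_space[OF that] by (auto simp: N space_borel_Rn)
    with measurable_sets[OF \<open>(\<lambda>x. x) \<in> N \<rightarrow>\<^sub>M borel_Rn n\<close> that] show ?thesis by simp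
  qed
  then show "sets (borel_Rn n) \<subseteq> sigma_sets (Rn n) {U. openin (top_Rn n) U}" by (auto simp: N)
  have "U \<in> sets (borel_Rn n)" if "openin (top_Rn n) U" for U
  proof -
    obtain W where "open W" "U = {x \<in> Rn n. embed n x \<in> W}" using \<open>openin (top_Rn n) U\<close> unfolding openin_top_Rn_iff by blast
    moreover have "embed n -` W \<inter> space (borel_Rn n) \<in> sets (borel_Rn n)"
      using \<open>open W\<close> by (intro measurable_sets[OF measurable_embed]) simp
    ultimately show ?thesis by (simp add: space_borel_Rn vimage_def Int_def conj_commute)
  qed
  then show "sigma_sets (Rn n) {U. openin (top_Rn n) U} \<subseteq> sets (borel_Rn n)"
    using sets.sigma_sets_subset[of "{U. openin (top_Rn n) U}" "borel_Rn n"] by (auto simp: space_borel_Rn)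
qed

lemma mm_space_closed_subset:
  assumes E: "closedin (top_Rn n) E" and \<mu>: "prob_space \<mu>" "sets \<mu> = sets (borel_Rn n)" "emeasure \<mu> E = 1"
  shows "mm_space (submetric (metric_Rn n) E, restrict_space \<mu> E)"
proof -
  interpret R: Metric_space "Rn n" "mdist (metric_Rn n)"
    using Metric_space_mspace_mdist[of "metric_Rn n"] by simp
  have ERn: "E \<subseteq> Rn n" using closedin_subset[OF E] by simp
  interpret S: Submetric "Rn n" "mdist (metric_Rn n)" E by standard (rule ERn)
  have sp: "space \<mu> = Rn n" using sets_eq_imp_space_eq[OF \<mu>(2)] by (simp add: space_borel_Rn)
  have "openin (top_Rn n) (Rn n - E)" using E by (auto simp: closedin_def)
  then have "Rn n - E \<in> sigma_sets (Rn n) {U. openin (top_Rn n) U}" by (auto intro: sigma_sets.Basic)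
  then have "Rn n - (Rn n - E) \<in> sigma_sets (Rn n) {U. openin (top_Rn n) U}" by (rule sigma_sets.Compl)
  then have Es: "E \<in> sigma_sets (Rn n) {U. openin (top_Rn n) U}" using ERn by (simp add: double_diff)
  then have E\<mu>: "E \<in> sets \<mu>" using \<mu>(2) sets_borel_Rn_eq_open by simp
  have ms: "mspace (submetric (metric_Rn n) E) = E" using ERn by auto
  have "mcomplete_of (submetric (metric_Rn n) E)"
    using S.closedin_mcomplete_imp_mcomplete E mcomplete_of_metric_Rn[of n] ERn
    by (simp add: mcomplete_of_def mtopology_of_def Int_absorb2)
  moreover have "separable_space (mtopology_of (submetric (metric_Rn n) E))"
    unfolding mtopology_of_submetric
    by (intro second_countable_imp_separable_space second_countable_subtopology second_countable_top_Rn)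
  moreover have "sets (restrict_space \<mu> E) = sigma_sets E {U. openin (mtopology_of (submetric (metric_Rn n) E)) U}"
  proof -
    have "sets (restrict_space \<mu> E) = (\<inter>) E ` sigma_sets (Rn n) {U. openin (top_Rn n) U}"
      by (simp add: sets_restrict_space \<mu>(2) sets_borel_Rn_eq_open)
    also have "\<dots> = sigma_sets E ((\<inter>) E ` {U. openin (top_Rn n) U})"
      by (rule sigma_sets_Int[OF Es ERn])
    also have "(\<inter>) E ` {U. openin (top_Rn n) U} = {U. openin (mtopology_of (submetric (metric_Rn n) E)) U}"
      unfolding mtopology_of_submetric by (auto simp: openin_subtopology)
    finally show ?thesis .
  qed
  moreover have "prob_space (restrict_space \<mu> E)"
    using E\<mu> \<mu>(3) ERn sp
    by (intro prob_spaceI) (simp add: emeasure_restrict_space space_restrict_space Int_absorb2)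
  ultimately show ?thesis
    using ERn sp by (simp add: mm_space_def ms space_restrict_space Int_absorb2)
qed

lemma mm_space_l2:
  assumes \<mu>: "prob_space \<mu>" "sets \<mu> = sets borel"
  shows "mm_space (euclidean_metric :: l2 metric, \<mu>)"
proof -
  have "mcomplete_of (euclidean_metric :: l2 metric)"
    unfolding mcomplete_of_def mspace_euclidean_metric mdist_euclidean_metric mcomplete_iff_complete
    by (rule complete_UNIV)
  moreover have "second_countable (euclidean :: l2 topology)"
    unfolding second_countable_def using ex_countable_basis[where 'a = l2]
    by (metis openin_open_eq open_openin topological_basisE topological_basis_open)
  then have "separable_space (euclidean :: l2 topology)" by (rule second_countable_imp_separable_space)
  moreover have "sets (borel :: l2 measure) = sigma_sets UNIV {U. open U}"
    by (simp add: borel_def sets_measure_of)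
  moreover have "space \<mu> = UNIV" using sets_eq_imp_space_eq[OF \<mu>(2)] by simp
  ultimately show ?thesis using \<mu> by (simp add: mm_space_def)
qed

section \<open>Convergence of the ellipsoids\<close>

lemma coupled_point_sum:
  assumes n: "2 \<le> n" and b: "\<And>i. i < n \<Longrightarrow> 0 < b i"
  shows "(\<Sum>i<n. (coupled_point n b \<rho> p i)\<^sup>2 / (sqrt (real n - 1) * b i)\<^sup>2) = (\<rho> (snd p))\<^sup>2"
proof -
  have "(\<Sum>i<n. (coupled_point n b \<rho> p i)\<^sup>2 / (sqrt (real n - 1) * b i)\<^sup>2)
      = (\<Sum>i<n. (\<rho> (snd p))\<^sup>2 * (direction n (fst p) i)\<^sup>2)"
  proof (rule sum.cong)
    fix i assume "i \<in> {..<n}"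
    define c where "c = sqrt (real n - 1) * b i"
    have "c \<noteq> 0" using \<open>i \<in> {..<n}\<close> n b[of i] by (simp add: c_def)
    moreover have "coupled_point n b \<rho> p i = \<rho> (snd p) * (c * direction n (fst p) i)"
      using \<open>i \<in> {..<n}\<close> by (simp add: coupled_point_def ellipsoid_point_def c_def)
    ultimately show "(coupled_point n b \<rho> p i)\<^sup>2 / (sqrt (real n - 1) * b i)\<^sup>2
        = (\<rho> (snd p))\<^sup>2 * (direction n (fst p) i)\<^sup>2"
      unfolding c_def[symmetric] by (simp add: power_mult_distrib)
  qed simp
  also have "\<dots> = (\<rho> (snd p))\<^sup>2 * sqnorm n (direction n (fst p))"
    by (simp add: sqnorm_def[of n "direction n (fst p)"] sum_distrib_left)
  finally show ?thesis using n by (simp add: sqnorm_direction)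
qed

lemma coupled_point_in_Rn: "coupled_point n b \<rho> p \<in> Rn n"
  by (simp add: coupled_point_def ellipsoid_point_def)

lemma closedin_ellipsoid: "closedin (top_Rn n) (ellipsoid n \<alpha>)"
proof (rule closedin_top_RnI)
  show "closed {y :: l2. (\<Sum>i<n. (coord y i)\<^sup>2 / (\<alpha> i)\<^sup>2) = 1}"
    unfolding divide_inverse by (intro closed_Collect_eq continuous_intros continuous_on_coord)
qed (auto simp: ellipsoid_def coord_embed)

lemma closedin_solid_ellipsoid: "closedin (top_Rn n) (solid_ellipsoid n \<alpha>)"
proof (rule closedin_top_RnI)
  show "closed {y :: l2. (\<Sum>i<n. (coord y i)\<^sup>2 / (\<alpha> i)\<^sup>2) \<le> 1}"
    unfolding divide_inverse by (intro closed_Collect_le continuous_intros continuous_on_coord)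
qed (auto simp: solid_ellipsoid_def coord_embed)

lemma gauss_l2_eq_model:
  assumes "summable (\<lambda>i. (a i)\<^sup>2)" "\<And>i. 0 \<le> a i"
  shows "gauss_l2 (\<lambda>i. (a i)\<^sup>2) = distr model_space borel (\<lambda>p. gauss_point a (fst p))"
proof -
  have "distr model_space borel (\<lambda>p. gauss_point a (fst p)) = distr (distr model_space gauss_seq fst) borel (gauss_point a)"
    by (subst distr_distr) (auto simp: comp_def)
  also have "distr model_space gauss_seq fst = gauss_seq"
    unfolding model_space_def by (rule unif01.distr_pair_fst)
  finally show ?thesis using gauss_l2_eq_distr[OF assms] by simp
qed

text \<open>
  If all values of \<open>f\<close> lie in \<open>E\<close>, its law may be regarded as a measure on \<open>E\<close>. That this holds for
  every sample, and not only almost surely, makes \<open>f\<close> measurable as a map into \<open>E\<close>.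
\<close>

lemma distr_restrict_space_codomain:
  assumes f: "f \<in> M \<rightarrow>\<^sub>M N" and E: "E \<in> sets N" "\<And>w. w \<in> space M \<Longrightarrow> f w \<in> E"
  shows "f \<in> M \<rightarrow>\<^sub>M restrict_space (distr M N f) E"
    and "distr M (restrict_space (distr M N f) E) f = restrict_space (distr M N f) E"
proof -
  show fE: "f \<in> M \<rightarrow>\<^sub>M restrict_space (distr M N f) E"
    using assms by (intro measurable_restrict_space2) auto
  have EN: "E \<inter> space N = E" using sets.sets_into_space[OF E(1)] by auto
  show "distr M (restrict_space (distr M N f) E) f = restrict_space (distr M N f) E"
  proof (rule measure_eqI)
    fix A assume "A \<in> sets (distr M (restrict_space (distr M N f) E) f)"
    then have A: "A \<in> sets (restrict_space (distr M N f) E)" by simp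
    then have AN: "A \<in> sets N" "A \<subseteq> E" using E(1) by (simp_all add: sets_restrict_space_iff EN)
    have "emeasure (restrict_space (distr M N f) E) A = emeasure (distr M N f) A"
      using E(1) AN by (intro emeasure_restrict_space) (simp_all add: EN)
    then show "emeasure (distr M (restrict_space (distr M N f) E) f) A = emeasure (restrict_space (distr M N f) E) A"
      using AN f by (simp add: emeasure_distr[OF fE A] emeasure_distr)
  qed simp
qed

text \<open>
  The three conclusions for solid ellipsoids and ellipsoids at once: only the radial factor \<open>\<rho>\<close>, with
  \<open>E (1 - \<rho>)\<^sup>2 \<longrightarrow> 0\<close>, and the set \<open>E\<close> that carries the points are different.
\<close>

lemma coupled_point_convergence:
  fixes n :: "nat \<Rightarrow> nat" and A :: "nat \<Rightarrow> nat \<Rightarrow> real" and a :: "nat \<Rightarrow> real"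
    and \<rho> :: "nat \<Rightarrow> real \<Rightarrow> real" and E :: "nat \<Rightarrow> (nat \<Rightarrow> real) set"
  defines "f \<equiv> \<lambda>j. coupled_point (n j) (\<lambda>i. A i j) (\<rho> j)"
  defines "\<mu> \<equiv> \<lambda>j. distr model_space (borel_Rn (n j)) (f j)"
  assumes n: "\<And>j. 2 \<le> n j" "filterlim n at_top sequentially"
    and a: "\<And>i. 0 \<le> a i" "summable (\<lambda>i. (a i)\<^sup>2)"
    and A: "(\<lambda>j. \<Sum>i<n j. (A i j - a i)\<^sup>2) \<longlonglongrightarrow> 0"
    and \<rho> [measurable]: "\<And>j. \<rho> j \<in> borel_measurable borel"
    and \<tau>: "\<And>j. (\<integral>\<^sup>+u. ennreal ((1 - \<rho> j u)\<^sup>2) \<partial>unif01) \<le> ennreal (\<tau> j)" "\<And>j. 0 \<le> \<tau> j" "\<tau> \<longlonglongrightarrow> 0"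
    and E: "\<And>j. closedin (top_Rn (n j)) (E j)" "\<And>j. E j \<in> sets (borel_Rn (n j))" "\<And>j p. f j p \<in> E j"
  shows "weakly_converges_to (\<lambda>j. on_l2 (n j) (\<mu> j)) (gauss_l2 (\<lambda>i. (a i)\<^sup>2))"
    and "(\<lambda>j. W2 (on_l2 (n j) (\<mu> j)) (gauss_l2 (\<lambda>i. (a i)\<^sup>2))) \<longlonglongrightarrow> 0"
    and "box_converges_to (\<lambda>j. (submetric (metric_Rn (n j)) (E j), restrict_space (\<mu> j) (E j)))
      (gauss_mm (\<lambda>i. (a i)\<^sup>2))"
proof -
  define B where "B j = 3 * (\<tau> j * (\<Sum>i<n j. (A i j)\<^sup>2) + (\<Sum>i<n j. (A i j - a i)\<^sup>2)
      + 5 / real (n j) * (\<Sum>i<n j. (a i)\<^sup>2)) + (\<Sum>i. (a (i + n j))\<^sup>2)" for j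
  define X where "X j p = embed (n j) (f j p)" for j p
  define Z where "Z p = gauss_point a (fst p)" for p :: "(nat \<Rightarrow> real) \<times> real"
  have f [measurable]: "f j \<in> model_space \<rightarrow>\<^sub>M borel_Rn (n j)" for j
    unfolding f_def by measurable
  have X [measurable]: "X j \<in> borel_measurable model_space" for j
    unfolding X_def by measurable
  have Z [measurable]: "Z \<in> borel_measurable model_space" unfolding Z_def by measurable
  have XE: "on_l2 (n j) (\<mu> j) = distr model_space borel (X j)" for j
    unfolding on_l2_def \<mu>_def by (subst distr_distr) (auto simp: comp_def X_def[abs_def])
  have ZE: "gauss_l2 (\<lambda>i. (a i)\<^sup>2) = distr model_space borel Z"
    using gauss_l2_eq_model[OF a(2,1)] by (simp add: Z_def[abs_def])
  have B: "B \<longlonglongrightarrow> 0"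
    unfolding B_def[abs_def] by (rule coupled_dist_bound_tendsto[OF n(2) a(2) A \<tau>(3,2)])
  have B0: "0 \<le> B j" for j
    unfolding B_def using \<tau>(2)
    by (auto intro!: add_nonneg_nonneg mult_nonneg_nonneg divide_nonneg_nonneg sum_nonneg suminf_nonneg
        summable_ignore_initial_segment[OF a(2)])
  have cost: "(\<integral>\<^sup>+p. ennreal ((dist (X j p) (Z p))\<^sup>2) \<partial>model_space) \<le> ennreal (B j)" for j
    unfolding X_def Z_def B_def f_def by (rule nn_integral_coupled_dist[OF n(1) \<rho> \<tau>(1,2) a(2)])
  show "weakly_converges_to (\<lambda>j. on_l2 (n j) (\<mu> j)) (gauss_l2 (\<lambda>i. (a i)\<^sup>2))"
    unfolding XE ZE
    by (rule weakly_converges_to_coupling[OF model_space.prob_space_axioms X Z cost B B0])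
  show "(\<lambda>j. W2 (on_l2 (n j) (\<mu> j)) (gauss_l2 (\<lambda>i. (a i)\<^sup>2))) \<longlonglongrightarrow> 0"
  proof (rule tendsto_sandwich)
    show "\<forall>\<^sub>F j in sequentially. W2 (on_l2 (n j) (\<mu> j)) (gauss_l2 (\<lambda>i. (a i)\<^sup>2)) \<le> ennreal (sqrt (B j))"
      unfolding XE ZE by (intro always_eventually allI W2_coupling_le X Z cost B0)
    show "\<forall>\<^sub>F j in sequentially. 0 \<le> W2 (on_l2 (n j) (\<mu> j)) (gauss_l2 (\<lambda>i. (a i)\<^sup>2))" by simp
    have "(\<lambda>j. ennreal (sqrt (B j))) \<longlonglongrightarrow> ennreal (sqrt 0)"
      by (intro tendsto_ennrealI tendsto_real_sqrt B)
    then show "(\<lambda>j. ennreal (sqrt (B j))) \<longlonglongrightarrow> 0" by simp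
  qed simp
  show "box_converges_to (\<lambda>j. (submetric (metric_Rn (n j)) (E j), restrict_space (\<mu> j) (E j)))
      (gauss_mm (\<lambda>i. (a i)\<^sup>2))"
    unfolding box_converges_to_def
  proof (intro conjI allI)
    fix j
    have "prob_space (\<mu> j)" unfolding \<mu>_def by (rule model_space.prob_space_distr) measurable
    moreover have "emeasure (\<mu> j) (E j) = 1"
      unfolding \<mu>_def using E(2,3) by (subst emeasure_distr) (auto simp: vimage_def model_space.emeasure_space_1)
    ultimately show "mm_space (submetric (metric_Rn (n j)) (E j), restrict_space (\<mu> j) (E j))"
      by (intro mm_space_closed_subset E(1)) (simp_all add: \<mu>_def)
  next
    show "mm_space (gauss_mm (\<lambda>i. (a i)\<^sup>2))"
      unfolding gauss_mm_def ZE by (intro mm_space_l2 model_space.prob_space_distr) simp_all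
  next
    (* The bound on the box distance needs a positive cost. *)
    define B' where "B' j = B j + 1 / (real j + 1)" for j
    have B'pos: "0 < B' j" for j using B0[of j] by (simp add: B'_def add_nonneg_pos)
    obtain \<Psi> where \<Psi>: "\<Psi> \<in> restrict_space lborel {0..<1::real} \<rightarrow>\<^sub>M model_space"
      "distr (restrict_space lborel {0..<1}) model_space \<Psi> = model_space"
      using exists_parameter_model_space by blast
    have le: "box_dist (submetric (metric_Rn (n j)) (E j), restrict_space (\<mu> j) (E j)) (gauss_mm (\<lambda>i. (a i)\<^sup>2))
        \<le> ennreal (root 3 (4 * B' j))" for j
    proof (rule box_dist_coupling_le[OF model_space.prob_space_axioms \<Psi>,
          where f = "f j" and g = Z and h = "\<lambda>p. dist (X j p) (Z p)"])
      show "f j \<in> model_space \<rightarrow>\<^sub>M snd (submetric (metric_Rn (n j)) (E j), restrict_space (\<mu> j) (E j))"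
        "distr model_space (snd (submetric (metric_Rn (n j)) (E j), restrict_space (\<mu> j) (E j))) (f j)
          = snd (submetric (metric_Rn (n j)) (E j), restrict_space (\<mu> j) (E j))"
        unfolding snd_conv \<mu>_def by (rule distr_restrict_space_codomain[OF f E(2,3)])+
      show "Z \<in> model_space \<rightarrow>\<^sub>M snd (gauss_mm (\<lambda>i. (a i)\<^sup>2))"
        by (simp add: gauss_mm_def ZE)
      show "distr model_space (snd (gauss_mm (\<lambda>i. (a i)\<^sup>2))) Z = snd (gauss_mm (\<lambda>i. (a i)\<^sup>2))"
        unfolding gauss_mm_def snd_conv ZE by (rule distr_cong) simp_all
      fix p q
      have "mdist (metric_Rn (n j)) (f j p) (f j q) = dist (X j p) (X j q)"
        unfolding X_def by (rule dist_embed[symmetric])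
      then show "\<bar>mdist (fst (submetric (metric_Rn (n j)) (E j), restrict_space (\<mu> j) (E j))) (f j p) (f j q)
          - mdist (fst (gauss_mm (\<lambda>i. (a i)\<^sup>2))) (Z p) (Z q)\<bar> \<le> dist (X j p) (Z p) + dist (X j q) (Z q)"
        using dist_triangle[of "X j p" "X j q" "Z p"] dist_triangle[of "Z p" "X j q" "Z q"]
          dist_triangle[of "Z p" "Z q" "X j p"] dist_triangle[of "X j p" "Z q" "X j q"]
        unfolding gauss_mm_def fst_conv mdist_submetric mdist_euclidean_metric
        by (simp add: dist_commute abs_le_iff)
    next
      have "ennreal (B j) \<le> ennreal (B' j)" by (rule ennreal_leI) (simp add: B'_def)
      then show "(\<integral>\<^sup>+p. ennreal ((dist (X j p) (Z p))\<^sup>2) \<partial>model_space) \<le> ennreal (B' j)"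
        by (rule order_trans[OF cost])
    qed (simp_all add: B'pos)
    show "(\<lambda>j. box_dist (submetric (metric_Rn (n j)) (E j), restrict_space (\<mu> j) (E j)) (gauss_mm (\<lambda>i. (a i)\<^sup>2))) \<longlonglongrightarrow> 0"
    proof (rule tendsto_sandwich)
      show "\<forall>\<^sub>F j in sequentially. box_dist (submetric (metric_Rn (n j)) (E j), restrict_space (\<mu> j) (E j))
          (gauss_mm (\<lambda>i. (a i)\<^sup>2)) \<le> ennreal (root 3 (4 * B' j))" using le by simp
      show "\<forall>\<^sub>F j in sequentially. 0 \<le> box_dist (submetric (metric_Rn (n j)) (E j), restrict_space (\<mu> j) (E j))
          (gauss_mm (\<lambda>i. (a i)\<^sup>2))" by simp
      have "(\<lambda>j. 1 / (real j + 1)) \<longlonglongrightarrow> 0"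
        using LIMSEQ_inverse_real_of_nat by (simp add: inverse_eq_divide add.commute)
      then have "(\<lambda>j. ennreal (root 3 (4 * (B j + 1 / (real j + 1))))) \<longlonglongrightarrow> ennreal (root 3 (4 * (0 + 0)))"
        by (intro tendsto_ennrealI tendsto_real_root tendsto_mult tendsto_const tendsto_add B)
      then show "(\<lambda>j. ennreal (root 3 (4 * B' j))) \<longlonglongrightarrow> 0" by (simp add: B'_def)
    qed simp
  qed
qed

theorem proposition4p2:
  fixes n :: "nat \<Rightarrow> nat" and A :: "nat \<Rightarrow> nat \<Rightarrow> real" and a :: "nat \<Rightarrow> real"
  assumes "\<And>j. 2 \<le> n j"
    and "filterlim n at_top sequentially"
    and "\<And>i j. i < n j \<Longrightarrow> 0 < A i j"
    and "\<And>i. 0 \<le> a i"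
    and "summable (\<lambda>i. (a i)\<^sup>2)"
    and "(\<lambda>j. \<Sum>i<n j. (A i j - a i)\<^sup>2) \<longlonglongrightarrow> 0"
  shows "
    weakly_converges_to
      (\<lambda>j. on_l2 (n j) (solid_ellipsoid_measure (n j) (\<lambda>i. sqrt (real (n j) - 1) * A i j)))
      (gauss_l2 (\<lambda>i. (a i)\<^sup>2)) \<and>
    (\<lambda>j. W2
      (on_l2 (n j) (ellipsoid_measure (n j) (\<lambda>i. sqrt (real (n j) - 1) * A i j)))
      (gauss_l2 (\<lambda>i. (a i)\<^sup>2))) \<longlonglongrightarrow> 0 \<and>
    box_converges_to
      (\<lambda>j. solid_ellipsoid_mm (n j) (\<lambda>i. sqrt (real (n j) - 1) * A i j))
      (gauss_mm (\<lambda>i. (a i)\<^sup>2)) \<and>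
    box_converges_to
      (\<lambda>j. ellipsoid_mm (n j) (\<lambda>i. sqrt (real (n j) - 1) * A i j))
      (gauss_mm (\<lambda>i. (a i)\<^sup>2))"
proof -
  have n0: "0 < n j" for j using assms(1)[of j] by simp
  have \<alpha>: "0 < sqrt (real (n j) - 1) * A i j" if "i < n j" for i j
    using assms(1)[of j] assms(3)[OF that] by simp
  have sphere: "ellipsoid_measure (n j) (\<lambda>i. sqrt (real (n j) - 1) * A i j)
      = distr model_space (borel_Rn (n j)) (coupled_point (n j) (\<lambda>i. A i j) (\<lambda>_. 1))" for j
    unfolding ellipsoid_measure_eq_model[OF n0] by (simp add: coupled_point_def[abs_def] split_beta')
  have solid: "solid_ellipsoid_measure (n j) (\<lambda>i. sqrt (real (n j) - 1) * A i j)
      = distr model_space (borel_Rn (n j)) (coupled_point (n j) (\<lambda>i. A i j) (clamped_root (n j)))" for j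
  proof -
    have "solid_ellipsoid_measure (n j) (\<lambda>i. sqrt (real (n j) - 1) * A i j) = distr model_space (borel_Rn (n j))
        (\<lambda>(x, u). ellipsoid_point (n j) (\<lambda>i. sqrt (real (n j) - 1) * A i j) (clamped_root (n j) u) x)"
      by (rule solid_ellipsoid_measure_eq_model) (use n0 \<alpha> in auto)
    then show ?thesis by (simp add: coupled_point_def[abs_def] split_beta')
  qed
  have on_sphere: "coupled_point (n j) (\<lambda>i. A i j) (\<lambda>_. 1) p \<in> ellipsoid (n j) (\<lambda>i. sqrt (real (n j) - 1) * A i j)" for j p
    using coupled_point_sum[where n = "n j" and b = "\<lambda>i. A i j" and \<rho> = "\<lambda>_. 1" and p = p, OF assms(1) assms(3)]
    by (simp add: ellipsoid_def coupled_point_in_Rn)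
  have in_solid: "coupled_point (n j) (\<lambda>i. A i j) (clamped_root (n j)) p
      \<in> solid_ellipsoid (n j) (\<lambda>i. sqrt (real (n j) - 1) * A i j)" for j p
    using coupled_point_sum[where n = "n j" and b = "\<lambda>i. A i j" and \<rho> = "clamped_root (n j)" and p = p,
        OF assms(1) assms(3)] clamped_root_bounds[of "n j" "snd p"]
    by (simp add: solid_ellipsoid_def coupled_point_in_Rn abs_square_le_1)
  have \<tau>_solid: "(\<integral>\<^sup>+u. ennreal ((1 - clamped_root (n j) u)\<^sup>2) \<partial>unif01) \<le> ennreal (1 / (real (n j) + 1))" for j
    using nn_integral_clamped_root_deviation[of "n j - 1"] n0[of j] by (simp add: add.commute)
  have \<tau>_lim: "(\<lambda>j. 1 / (real (n j) + 1)) \<longlonglongrightarrow> 0"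
    using filterlim_compose[OF LIMSEQ_inverse_real_of_nat assms(2)] by (simp add: inverse_eq_divide add.commute)
  note solid_conv = coupled_point_convergence[where n = n and A = A and \<rho> = "\<lambda>j. clamped_root (n j)"
      and E = "\<lambda>j. solid_ellipsoid (n j) (\<lambda>i. sqrt (real (n j) - 1) * A i j)",
      OF assms(1,2,4,5,6) measurable_clamped_root \<tau>_solid _ \<tau>_lim closedin_solid_ellipsoid
        sets_solid_ellipsoid in_solid, folded solid]
  note sphere_conv = coupled_point_convergence[where n = n and A = A and \<rho> = "\<lambda>j _. 1"
      and E = "\<lambda>j. ellipsoid (n j) (\<lambda>i. sqrt (real (n j) - 1) * A i j)" and \<tau> = "\<lambda>_. 0",
      OF assms(1,2,4,5,6) _ _ _ _ closedin_ellipsoid sets_ellipsoid on_sphere, folded sphere]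
  show ?thesis
    unfolding solid_ellipsoid_mm_def ellipsoid_mm_def
    by (intro conjI solid_conv sphere_conv) simp_all
qed

end
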